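(* Let $(a_1,b_1)$ and $(a_2,b_2)$ be bi-free, bi-partite, self-adjoint two-faced pairs in a $C^*$-noncommutative probability space, with none of $a_1,b_1,a_2,b_2$ being a multiple of the identity. Let $\eta_j$ be the distribution of $(a_j,b_j)$ and $\mu_j$ and $\nu_j$ its first and second marginal, respectively, $j=1,2$. Assume that there exist $u,x\in\mathbb R$ and $\alpha>1/2$ such that $$\lim_{(y_1,y_2)\to(0,0)}(y_1y_2)^\alpha\,|G_{\eta_1\boxplus\boxplus\eta_2}(x+iy_1,u+iy_2)|=+\infty,$$ where $y_1,y_2>0$. Then there exist $\alpha_1,\alpha_2,\beta_1,\beta_2\in\mathbb R$ such that $\alpha_1+\beta_1=x$, $\alpha_2+\beta_2=u$, $\mu_1(\{\alpha_1\})+\mu_2(\{\beta_1\})\ge1$, and $\nu_1(\{\alpha_2\})+\nu_2(\{\beta_2\})\ge1$.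
   Context: A $C^*$-noncommutative probability space $(\mathcal A,\varphi)$ is a unital $C^*$-algebra with a faithful state. A two-faced pair $(a,b)\in\mathcal A^2$ is self-adjoint if $a=a^*,b=b^*$, and bi-partite if $ab=ba$. Bi-freeness: given vector spaces with state vectors $\mathcal X_j=\mathbb C\xi_j\oplus\mathcal X_j^\circ$, $j=1,2$, their free product is $\mathcal X=\mathbb C\xi\oplus\bigoplus_{n\ge1}\bigoplus_{i_1\ne i_2\ne\cdots\ne i_n}\mathcal X^\circ_{i_1}\otimes\cdots\otimes\mathcal X^\circ_{i_n}$. Let $\mathcal X(\ell,j)$ (resp. $\mathcal X(r,j)$) be the sum of $\mathbb C\xi$ and the summands with $i_1\ne j$ (resp. $i_n\neq j$), with natural isomorphisms $V_j:\mathcal X_j\otimes\mathcal X(\ell,j)\to\mathcal X$ and $W_j:\mathcal X(r,j)\otimes\mathcal X_j\to\mathcal X$, and $\lambda_j(T)=V_j(T\otimes I)V_j^{-1}$, $\rho_j(T)=W_j(I\otimes T)W_j^{-1}$ for linear $T$ on $\mathcal X_j$. Let $\varphi_\xi(T)$ be the $\xi$-coefficient of $T\xi$. Pairs $(a_1,b_1),(a_2,b_2)$ are bi-free with respect to $\varphi$ if there exist such $\mathcal X_1,\mathcal X_2$ and linear operators $T_j,S_j$ on $\mathcal X_j$ such that the joint moments of $a_1,a_2,b_1,b_2$ under $\varphi$ equal those of $\lambda_1(T_1),\lambda_2(T_2),\rho_1(S_1),\rho_2(S_2)$ under $\varphi_\xi$. The distribution $\eta_j$ is the compactly supported probability measure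 on $\mathbb R^2$ with $\varphi(a_j^mb_j^n)=\int t^ms^n\,d\eta_j(t,s)$ for all $m,n\ge0$. $\eta_1\boxplus\boxplus\eta_2$ (bi-free additive convolution) is the distribution of the commuting self-adjoint pair $(a_1+a_2,b_1+b_2)$; its marginals are the free additive convolutions $\mu_1\boxplus\mu_2$ and $\nu_1\boxplus\nu_2$. The Cauchy transform of a probability measure $\eta$ on $\mathbb R^2$ is $G_\eta(z,w)=\int_{\mathbb R^2}\frac{d\eta(t,s)}{(z-t)(w-s)}$. *)

theory Defs
  imports
    "HOL-Probability.Probability_Measure"
    "HOL-Library.Poly_Mapping"
begin

section \<open>Complex vector spaces\<close>

class scaleC =
  fixes scaleC :: "complex \<Rightarrow> 'a \<Rightarrow> 'a" (infixr \<open>*\<^sub>C\<close> 75)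

class complex_vector = scaleC + ab_group_add +
  assumes scaleC_add_right: "a *\<^sub>C (x + y) = a *\<^sub>C x + a *\<^sub>C y"
    and scaleC_add_left: "(a + b) *\<^sub>C x = a *\<^sub>C x + b *\<^sub>C x"
    and scaleC_scaleC: "a *\<^sub>C b *\<^sub>C x = (a * b) *\<^sub>C x"
    and scaleC_one: "1 *\<^sub>C x = x"

global_interpretation complex_vector: vector_space "scaleC :: complex \<Rightarrow> 'a \<Rightarrow> 'a :: complex_vector"
  by unfold_locales (simp_all add: scaleC_add_right scaleC_add_left scaleC_scaleC scaleC_one)

abbreviation clinear :: "('a::complex_vector \<Rightarrow> 'b::complex_vector) \<Rightarrow> bool"
  where "clinear \<equiv> Vector_Spaces.linear scaleC scaleC"

lemma clinearI:
  assumes "\<And>x y. f (x + y) = f x + f y" "\<And>c x. f (c *\<^sub>C x) = c *\<^sub>C f x"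
  shows "clinear f"
  by (simp add: Vector_Spaces.linear_iff assms complex_vector.vector_space_axioms)

lemma clinear_add: "clinear f \<Longrightarrow> f (x + y) = f x + f y"
  and clinear_scaleC: "clinear f \<Longrightarrow> f (c *\<^sub>C x) = c *\<^sub>C f x"
  by (simp_all add: Vector_Spaces.linear_iff)

instantiation complex :: complex_vector
begin
definition scaleC_complex_def: "c *\<^sub>C (x::complex) = c * x"
instance by standard (simp_all add: scaleC_complex_def algebra_simps)
end

instantiation prod :: (complex_vector, complex_vector) complex_vector
begin
definition scaleC_prod_def: "c *\<^sub>C p = (c *\<^sub>C fst p, c *\<^sub>C snd p)"
instance
  by standard (simp_all add: scaleC_prod_def scaleC_add_right scaleC_add_left scaleC_scaleC scaleC_one)
end

instantiation poly_mapping :: (type, complex_vector) complex_vector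
begin
definition scaleC_poly_mapping_def: "c *\<^sub>C p = Poly_Mapping.map (scaleC c) p"
lemma lookup_scaleC: "Poly_Mapping.lookup (c *\<^sub>C p) k = c *\<^sub>C Poly_Mapping.lookup p k" for p :: "'a \<Rightarrow>\<^sub>0 'b"
  by (cases "Poly_Mapping.lookup p k = 0") (simp_all add: scaleC_poly_mapping_def Poly_Mapping.map.rep_eq)
instance
  by standard (rule poly_mapping_eqI, simp add: lookup_scaleC lookup_add scaleC_add_right
      scaleC_add_left scaleC_scaleC scaleC_one)+
end


section \<open>$C^*$-noncommutative probability spaces\<close>

class cstar_algebra = complex_vector + real_normed_algebra_1 + banach +
  fixes star :: "'a \<Rightarrow> 'a"
  assumes scaleR_eq_scaleC: "r *\<^sub>R x = complex_of_real r *\<^sub>C x"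
    and mult_scaleC_left: "(c *\<^sub>C x) * y = c *\<^sub>C (x * y)"
    and mult_scaleC_right: "x * (c *\<^sub>C y) = c *\<^sub>C (x * y)"
    and norm_scaleC: "norm (c *\<^sub>C x) = cmod c * norm x"
    and star_star: "star (star x) = x"
    and star_add: "star (x + y) = star x + star y"
    and star_scaleC: "star (c *\<^sub>C x) = cnj c *\<^sub>C star x"
    and star_mult: "star (x * y) = star y * star x"
    and norm_star_mult_self: "norm (star x * x) = (norm x)\<^sup>2"

definition faithful_state :: "('a::cstar_algebra \<Rightarrow> complex) \<Rightarrow> bool" where
  "faithful_state \<phi> \<longleftrightarrow>
     clinear \<phi> \<and> \<phi> 1 = 1 \<and>
     (\<forall>x. Im (\<phi> (star x * x)) = 0 \<and> 0 \<le> Re (\<phi> (star x * x))) \<and>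
     (\<forall>x. \<phi> (star x * x) = 0 \<longrightarrow> x = 0)"

definition self_adjoint_pair :: "'a::cstar_algebra \<Rightarrow> 'a \<Rightarrow> bool" where
  "self_adjoint_pair a b \<longleftrightarrow> star a = a \<and> star b = b"

definition bipartite_pair :: "'a::cstar_algebra \<Rightarrow> 'a \<Rightarrow> bool" where
  "bipartite_pair a b \<longleftrightarrow> a * b = b * a"

definition scalar_multiple_of_one :: "'a::cstar_algebra \<Rightarrow> bool" where
  "scalar_multiple_of_one a \<longleftrightarrow> (\<exists>c. a = c *\<^sub>C 1)"


section \<open>Free products of vector spaces with state vectors\<close>

text \<open>
  A vector space with state vector is represented as the direct sum
  $\mathcal X_j = \mathbb C \oplus \mathcal X_j^\circ$, that is, as the type
  \<^typ>\<open>complex \<times> 'u\<close> (resp. \<^typ>\<open>complex \<times> 'v\<close>) where \<open>'u\<close> (resp. \<open>'v\<close>) is the complex vector space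
  $\mathcal X_j^\circ$; the state vector $\xi_j$ is \<^term>\<open>(1, 0)\<close>.

  The free product is the free vector space on all words in
  $\mathcal X_1^\circ \sqcup \mathcal X_2^\circ$ modulo multilinearity in each letter, and modulo
  the words having two neighbouring letters from the same space. What remains is the direct sum,
  over the sequences $i_1 \neq i_2 \neq \cdots \neq i_n$, $n \ge 0$, of the algebraic tensor
  products $\mathcal X_{i_1}^\circ \otimes \cdots \otimes \mathcal X_{i_n}^\circ$; the empty
  word is the state vector $\xi$.
\<close>

definition alternating :: "('u + 'v) list \<Rightarrow> bool" where
  "alternating w \<longleftrightarrow> successively (\<lambda>k l. isl k \<noteq> isl l) w"

abbreviation formal_word :: "('u + 'v) list \<Rightarrow> ('u + 'v) list \<Rightarrow>\<^sub>0 complex" where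
  "formal_word w \<equiv> Poly_Mapping.single w 1"

inductive_set free_product_relations ::
    "(('u::complex_vector + 'v::complex_vector) list \<Rightarrow>\<^sub>0 complex) set" where
  add1: "formal_word (us @ Inl (x + y) # vs)
           - (formal_word (us @ Inl x # vs) + formal_word (us @ Inl y # vs))
         \<in> free_product_relations"
| scale1: "formal_word (us @ Inl (c *\<^sub>C x) # vs) - c *\<^sub>C formal_word (us @ Inl x # vs)
         \<in> free_product_relations"
| add2: "formal_word (us @ Inr (x + y) # vs)
           - (formal_word (us @ Inr x # vs) + formal_word (us @ Inr y # vs))
         \<in> free_product_relations"
| scale2: "formal_word (us @ Inr (c *\<^sub>C x) # vs) - c *\<^sub>C formal_word (us @ Inr x # vs)
         \<in> free_product_relations"
| non_alternating: "\<not> alternating w \<Longrightarrow> formal_word w \<in> free_product_relations"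

definition free_product_rel ::
    "(('u::complex_vector + 'v::complex_vector) list \<Rightarrow>\<^sub>0 complex) \<Rightarrow>
     (('u + 'v) list \<Rightarrow>\<^sub>0 complex) \<Rightarrow> bool" where
  "free_product_rel p q \<longleftrightarrow> p - q \<in> complex_vector.span free_product_relations"

quotient_type (overloaded) ('u, 'v) free_product =
    "('u::complex_vector + 'v::complex_vector) list \<Rightarrow>\<^sub>0 complex" / free_product_rel
proof (rule equivpI)
  show "reflp (free_product_rel :: (('u + 'v) list \<Rightarrow>\<^sub>0 complex) \<Rightarrow> _)"
    by (simp add: reflp_def free_product_rel_def complex_vector.span_zero)
  show "symp (free_product_rel :: (('u + 'v) list \<Rightarrow>\<^sub>0 complex) \<Rightarrow> _)"
    unfolding symp_def free_product_rel_def using complex_vector.span_neg by fastforce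
  show "transp (free_product_rel :: (('u + 'v) list \<Rightarrow>\<^sub>0 complex) \<Rightarrow> _)"
    unfolding transp_def free_product_rel_def
    using complex_vector.span_add by fastforce
qed

instantiation free_product :: (complex_vector, complex_vector) complex_vector
begin

lift_definition zero_free_product :: "('a, 'b) free_product" is 0 .

lift_definition plus_free_product ::
    "('a, 'b) free_product \<Rightarrow> ('a, 'b) free_product \<Rightarrow> ('a, 'b) free_product" is plus
  unfolding free_product_rel_def by (simp add: add_diff_add complex_vector.span_add)

lift_definition minus_free_product ::
    "('a, 'b) free_product \<Rightarrow> ('a, 'b) free_product \<Rightarrow> ('a, 'b) free_product" is minus
proof -
  fix p1 p2 q1 q2 :: "('a + 'b) list \<Rightarrow>\<^sub>0 complex"
  assume "free_product_rel p1 p2" "free_product_rel q1 q2"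
  then have "(p1 - p2) - (q1 - q2) \<in> complex_vector.span free_product_relations"
    unfolding free_product_rel_def by (rule complex_vector.span_diff)
  then show "free_product_rel (p1 - q1) (p2 - q2)"
    by (simp add: free_product_rel_def algebra_simps)
qed

lift_definition uminus_free_product ::
    "('a, 'b) free_product \<Rightarrow> ('a, 'b) free_product" is uminus
proof -
  fix p q :: "('a + 'b) list \<Rightarrow>\<^sub>0 complex"
  assume "free_product_rel p q"
  then have "- (p - q) \<in> complex_vector.span free_product_relations"
    unfolding free_product_rel_def by (rule complex_vector.span_neg)
  then show "free_product_rel (- p) (- q)"
    by (simp add: free_product_rel_def)
qed

lift_definition scaleC_free_product ::
    "complex \<Rightarrow> ('a, 'b) free_product \<Rightarrow> ('a, 'b) free_product" is scaleC
  unfolding free_product_rel_def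
  by (simp add: complex_vector.span_scale flip: complex_vector.scale_right_diff_distrib)

instance
  by standard (transfer; simp add: free_product_rel_def complex_vector.span_zero algebra_simps
      scaleC_add_right scaleC_add_left scaleC_scaleC scaleC_one)+

end

text \<open>The elementary tensor $x_1 \otimes \cdots \otimes x_n$ of an alternating word; it is
  \<^term>\<open>0\<close> for other words.\<close>

lift_definition tensor_word ::
    "('u::complex_vector + 'v::complex_vector) list \<Rightarrow> ('u, 'v) free_product" is formal_word .

text \<open>Linear extension of a function given on elementary tensors. It is independent of the chosen
  representative when \<open>f\<close> respects \<^const>\<open>free_product_relations\<close>.\<close>

definition extend_words ::
    "(('u::complex_vector + 'v::complex_vector) list \<Rightarrow> 'x::complex_vector) \<Rightarrow>
     ('u, 'v) free_product \<Rightarrow> 'x" where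
  "extend_words f p =
     (let r = rep_free_product p in \<Sum>w\<in>Poly_Mapping.keys r. Poly_Mapping.lookup r w *\<^sub>C f w)"

text \<open>
  In the following, the embedding \<open>e\<close> is \<^const>\<open>Inl\<close> for $j = 1$ and \<^const>\<open>Inr\<close> for $j = 2$.
  On \<^term>\<open>left_space e\<close>, i.e. $\mathcal X(\ell, j)$, the map \<open>left_tensor e\<close> is
  $(x, p) \mapsto V_j (x \otimes p)$; on \<^term>\<open>right_space e\<close>, i.e. $\mathcal X(r, j)$, the map
  \<open>right_tensor e\<close> is $(p, x) \mapsto W_j (p \otimes x)$.
\<close>

definition left_space ::
    "('w \<Rightarrow> 'u + 'v) \<Rightarrow> ('u::complex_vector, 'v::complex_vector) free_product set" where
  "left_space e = complex_vector.span {tensor_word w |w. w = [] \<or> hd w \<notin> range e}"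

definition right_space ::
    "('w \<Rightarrow> 'u + 'v) \<Rightarrow> ('u::complex_vector, 'v::complex_vector) free_product set" where
  "right_space e = complex_vector.span {tensor_word w |w. w = [] \<or> last w \<notin> range e}"

definition left_tensor :: "('w \<Rightarrow> 'u::complex_vector + 'v::complex_vector) \<Rightarrow> complex \<times> 'w \<Rightarrow>
    ('u, 'v) free_product \<Rightarrow> ('u, 'v) free_product" where
  "left_tensor e x p = fst x *\<^sub>C p + extend_words (\<lambda>w. tensor_word (e (snd x) # w)) p"

definition right_tensor :: "('w \<Rightarrow> 'u::complex_vector + 'v::complex_vector) \<Rightarrow> ('u, 'v) free_product \<Rightarrow>
    complex \<times> 'w \<Rightarrow> ('u, 'v) free_product" where
  "right_tensor e p x = fst x *\<^sub>C p + extend_words (\<lambda>w. tensor_word (w @ [e (snd x)])) p"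

text \<open>$\lambda_j(T) = V_j (T \otimes I) V_j^{-1}$ and $\rho_j(T) = W_j (I \otimes T) W_j^{-1}$; existence
  and uniqueness are proved below for linear $T$.\<close>

definition left_rep :: "('w \<Rightarrow> 'u::complex_vector + 'v::complex_vector) \<Rightarrow>
    (complex \<times> 'w \<Rightarrow> complex \<times> 'w) \<Rightarrow> ('u, 'v) free_product \<Rightarrow> ('u, 'v) free_product" where
  "left_rep e T = (THE L. clinear L \<and>
     (\<forall>x. \<forall>p\<in>left_space e. L (left_tensor e x p) = left_tensor e (T x) p))"

definition right_rep :: "('w \<Rightarrow> 'u::complex_vector + 'v::complex_vector) \<Rightarrow>
    (complex \<times> 'w \<Rightarrow> complex \<times> 'w) \<Rightarrow> ('u, 'v) free_product \<Rightarrow> ('u, 'v) free_product" where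
  "right_rep e T = (THE R. clinear R \<and>
     (\<forall>x. \<forall>p\<in>right_space e. R (right_tensor e p x) = right_tensor e p (T x)))"

definition vacuum_state ::
    "(('u::complex_vector, 'v::complex_vector) free_product \<Rightarrow> ('u, 'v) free_product) \<Rightarrow> complex"
  where \<comment> \<open>the $\xi$-coefficient of $L\xi$\<close>
  "vacuum_state L = extend_words (\<lambda>w. if w = [] then 1 else 0) (L (tensor_word []))"

subsection \<open>The operators are well defined\<close>

definition multilinear_on_words ::
    "(('u::complex_vector + 'v::complex_vector) list \<Rightarrow> 'x::complex_vector) \<Rightarrow> bool" where
  "multilinear_on_words f \<longleftrightarrow>
     (\<forall>us vs x y. f (us @ Inl (x + y) # vs) = f (us @ Inl x # vs) + f (us @ Inl y # vs)) \<and>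
     (\<forall>us vs c x. f (us @ Inl (c *\<^sub>C x) # vs) = c *\<^sub>C f (us @ Inl x # vs)) \<and>
     (\<forall>us vs x y. f (us @ Inr (x + y) # vs) = f (us @ Inr x # vs) + f (us @ Inr y # vs)) \<and>
     (\<forall>us vs c x. f (us @ Inr (c *\<^sub>C x) # vs) = c *\<^sub>C f (us @ Inr x # vs)) \<and>
     (\<forall>w. \<not> alternating w \<longrightarrow> f w = 0)"

context
  fixes f :: "('u::complex_vector + 'v::complex_vector) list \<Rightarrow> 'x::complex_vector"
  assumes f: "multilinear_on_words f"
begin

private definition F :: "(('u + 'v) list \<Rightarrow>\<^sub>0 complex) \<Rightarrow> 'x" where
  "F r = (\<Sum>w\<in>Poly_Mapping.keys r. Poly_Mapping.lookup r w *\<^sub>C f w)"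

private lemma F_single: "F (Poly_Mapping.single w c) = c *\<^sub>C f w"
  by (simp add: F_def)

private lemma clinear_F: "clinear F"
proof (rule clinearI)
  show "F (p + q) = F p + F q" for p q
    unfolding F_def by (rule setsum_keys_plus_distrib) (simp_all add: scaleC_add_left)
  show "F (c *\<^sub>C p) = c *\<^sub>C F p" for c p
  proof -
    have "F (c *\<^sub>C p) =
        (\<Sum>w\<in>Poly_Mapping.keys p. Poly_Mapping.lookup (c *\<^sub>C p) w *\<^sub>C f w)"
      unfolding F_def
      by (rule sum.mono_neutral_left) (auto simp: in_keys_iff lookup_scaleC scaleC_complex_def)
    then show ?thesis
      by (simp add: F_def lookup_scaleC scaleC_complex_def complex_vector.scale_sum_right
          flip: scaleC_scaleC)
  qed
qed

private lemma F_relation: "r \<in> free_product_relations \<Longrightarrow> F r = 0"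
proof -
  interpret F: Vector_Spaces.linear scaleC scaleC F by (rule clinear_F)
  note lin = F.diff F.add F.scale F_single scaleC_one
  assume "r \<in> free_product_relations"
  then show ?thesis
  proof cases
    case (add1 us x y vs)
    have "f (us @ Inl (x + y) # vs) = f (us @ Inl x # vs) + f (us @ Inl y # vs)"
      using f by (simp add: multilinear_on_words_def)
    then show ?thesis by (simp add: add1 lin)
  next
    case (scale1 us c x vs)
    have "f (us @ Inl (c *\<^sub>C x) # vs) = c *\<^sub>C f (us @ Inl x # vs)"
      using f by (simp add: multilinear_on_words_def)
    then show ?thesis by (simp add: scale1 lin)
  next
    case (add2 us x y vs)
    have "f (us @ Inr (x + y) # vs) = f (us @ Inr x # vs) + f (us @ Inr y # vs)"
      using f by (simp add: multilinear_on_words_def)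
    then show ?thesis by (simp add: add2 lin)
  next
    case (scale2 us c x vs)
    have "f (us @ Inr (c *\<^sub>C x) # vs) = c *\<^sub>C f (us @ Inr x # vs)"
      using f by (simp add: multilinear_on_words_def)
    then show ?thesis by (simp add: scale2 lin)
  next
    case (non_alternating w)
    then show ?thesis using f by (simp add: multilinear_on_words_def lin)
  qed
qed

private lemma F_cong: "free_product_rel p q \<Longrightarrow> F p = F q"
proof -
  interpret F: Vector_Spaces.linear scaleC scaleC F by (rule clinear_F)
  assume "free_product_rel p q"
  then have "p - q \<in> complex_vector.span free_product_relations"
    by (simp add: free_product_rel_def)
  then have "F (p - q) = 0"
    by (induction rule: complex_vector.span_induct_alt)
      (simp_all add: F.zero F.add F.scale F_relation)
  then show ?thesis by (simp add: F.diff)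
qed

private lemma extend_words_abs: "extend_words f (abs_free_product r) = F r"
proof -
  have "free_product_rel r r"
    by (simp add: free_product_rel_def complex_vector.span_zero)
  then have "free_product_rel (rep_free_product (abs_free_product r)) r"
    by (rule rep_abs_rsp_left[OF Quotient3_free_product])
  then have "F (rep_free_product (abs_free_product r)) = F r"
    by (rule F_cong)
  then show ?thesis
    by (simp only: extend_words_def Let_def F_def)
qed

lemma extend_words_tensor_word: "extend_words f (tensor_word w) = f w"
  by (simp add: tensor_word_def extend_words_abs F_single scaleC_one)

lemma clinear_extend_words: "clinear (extend_words f)"
proof (rule clinearI)
  interpret F: Vector_Spaces.linear scaleC scaleC F by (rule clinear_F)
  have ex: "\<exists>r. p = abs_free_product r" for p :: "('u, 'v) free_product"
    by (rule exI, rule Quotient3_abs_rep[OF Quotient3_free_product, symmetric])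
  show "extend_words f (p + q) = extend_words f p + extend_words f q" for p q
    using ex[of p] ex[of q]
    by (auto simp: plus_free_product.abs_eq extend_words_abs F.add)
  show "extend_words f (c *\<^sub>C p) = c *\<^sub>C extend_words f p" for c p
    using ex[of p] by (auto simp: scaleC_free_product.abs_eq extend_words_abs F.scale)
qed

end

lemma alternating_letter:
  "alternating (us @ Inl x # vs) = alternating (us @ Inl 0 # vs)"
  "alternating (us @ Inr y # vs) = alternating (us @ Inr 0 # vs)"
  by (auto simp: alternating_def successively_append_iff successively_Cons)

lemma multilinear_tensor_word:
  "multilinear_on_words (tensor_word :: ('u::complex_vector + 'v::complex_vector) list \<Rightarrow> _)"
  unfolding multilinear_on_words_def
proof (intro conjI allI impI)
  have rel: "tensor_word w = abs_free_product p"
    if "formal_word w - p \<in> free_product_relations" for w and p :: "('u + 'v) list \<Rightarrow>\<^sub>0 complex"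
    using that unfolding tensor_word_def
    by (simp add: free_product.abs_eq_iff free_product_rel_def complex_vector.span_base)
  note [simp] = tensor_word_def plus_free_product.abs_eq[symmetric]
    scaleC_free_product.abs_eq[symmetric]
  show "tensor_word (us @ Inl (x + y) # vs) =
      tensor_word (us @ Inl x # vs) + (tensor_word (us @ Inl y # vs) :: ('u, 'v) free_product)"
    for us vs x y using rel[OF add1[of us x y vs]] by simp
  show "tensor_word (us @ Inr (x + y) # vs) =
      tensor_word (us @ Inr x # vs) + (tensor_word (us @ Inr y # vs) :: ('u, 'v) free_product)"
    for us vs x y using rel[OF add2[of us x y vs]] by simp
  show "tensor_word (us @ Inl (c *\<^sub>C x) # vs) =
      c *\<^sub>C (tensor_word (us @ Inl x # vs) :: ('u, 'v) free_product)"
    for us vs c x using rel[OF scale1[of us c x vs]] by simp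
  show "tensor_word (us @ Inr (c *\<^sub>C x) # vs) =
      c *\<^sub>C (tensor_word (us @ Inr x # vs) :: ('u, 'v) free_product)"
    for us vs c x using rel[OF scale2[of us c x vs]] by simp
  show "tensor_word w = (0 :: ('u, 'v) free_product)" if "\<not> alternating w" for w
    using rel[of w 0] non_alternating[OF that] by (simp add: zero_free_product_def)
qed

lemma span_tensor_word:
  "complex_vector.span (range tensor_word) =
     (UNIV :: ('u::complex_vector, 'v::complex_vector) free_product set)"
proof -
  have "p \<in> complex_vector.span (range tensor_word)" for p :: "('u, 'v) free_product"
  proof -
    have p: "p = abs_free_product (rep_free_product p)"
      by (simp add: Quotient3_abs_rep[OF Quotient3_free_product])
    have "abs_free_product r \<in> complex_vector.span (range tensor_word)" for r :: "('u + 'v) list \<Rightarrow>\<^sub>0 complex"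
    proof (induction r rule: update_induct)
      case const
      show ?case by (simp flip: zero_free_product_def add: complex_vector.span_zero)
    next
      case (update f a b)
      have "Poly_Mapping.update a b f = f + b *\<^sub>C formal_word a"
        using update.hyps
        by (intro poly_mapping_eqI)
          (auto simp: lookup_update lookup_add lookup_scaleC lookup_single scaleC_complex_def
            when_def in_keys_iff)
      then have "abs_free_product (Poly_Mapping.update a b f)
          = abs_free_product f + b *\<^sub>C tensor_word a"
        by (simp add: plus_free_product.abs_eq scaleC_free_product.abs_eq tensor_word_def)
      then show ?case
        using update.IH by (simp add: complex_vector.span_add complex_vector.span_scale complex_vector.span_base)
    qed
    then show ?thesis by (subst p)
  qed
  then show ?thesis by blast
qed

text \<open>The assumptions hold for \<^const>\<open>Inl\<close> with \<^const>\<open>projl\<close> and for \<^const>\<open>Inr\<close> with \<^const>\<open>projr\<close>.\<close>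

context
  fixes e :: "'w::complex_vector \<Rightarrow> 'u::complex_vector + 'v::complex_vector"
    and d :: "'u + 'v \<Rightarrow> 'w" and s :: bool and T :: "complex \<times> 'w \<Rightarrow> complex \<times> 'w"
  assumes range_e: "\<And>l. l \<in> range e \<longleftrightarrow> isl l = s"
    and d_e: "\<And>x. d (e x) = x"
    and d_Inl_add: "\<And>x y. s \<Longrightarrow> d (Inl (x + y)) = d (Inl x) + d (Inl y)"
    and d_Inl_scale: "\<And>c x. s \<Longrightarrow> d (Inl (c *\<^sub>C x)) = c *\<^sub>C d (Inl x)"
    and d_Inr_add: "\<And>x y. \<not> s \<Longrightarrow> d (Inr (x + y)) = d (Inr x) + d (Inr y)"
    and d_Inr_scale: "\<And>c x. \<not> s \<Longrightarrow> d (Inr (c *\<^sub>C x)) = c *\<^sub>C d (Inr x)"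
    and e_add: "\<And>us vs x y. tensor_word (us @ e (x + y) # vs) =
      tensor_word (us @ e x # vs) + (tensor_word (us @ e y # vs) :: ('u, 'v) free_product)"
    and e_scale: "\<And>us vs c x. tensor_word (us @ e (c *\<^sub>C x) # vs) =
      c *\<^sub>C (tensor_word (us @ e x # vs) :: ('u, 'v) free_product)"
    and T: "clinear T"
begin

private lemma isl_e: "isl (e x) = s"
  using range_e[of "e x"] by blast

private lemma e_d: "isl l = s \<Longrightarrow> e (d l) = l"
  using range_e[of l] d_e by auto

private lemma T_split: "T x = fst x *\<^sub>C T (1, 0) + T (0, snd x)"
proof -
  have "x = fst x *\<^sub>C (1, 0) + (0, snd x)"
    by (simp add: scaleC_prod_def scaleC_complex_def)
  then show ?thesis using T clinear_add clinear_scaleC by metis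
qed

private lemma T_zero_add: "T (0, x + y) = T (0, x) + T (0, y)"
  using clinear_add[OF T, of "(0, x)" "(0, y)"] by simp

private lemma T_zero_scale: "T (0, c *\<^sub>C x) = c *\<^sub>C T (0, x)"
  using clinear_scaleC[OF T, of c "(0, x)"] by (simp add: scaleC_prod_def)

private lemma e_zero: "tensor_word (us @ e 0 # vs) = (0 :: ('u, 'v) free_product)"
  using e_scale[of us 0 0 vs] by simp

private lemma tensor_word_0: "\<not> alternating w \<Longrightarrow> tensor_word w = (0 :: ('u, 'v) free_product)"
  using multilinear_tensor_word[where 'u='u and 'v='v] by (simp add: multilinear_on_words_def)

private lemma letter_in: "Inl x \<in> range e \<longleftrightarrow> s" "Inr y \<in> range e \<longleftrightarrow> \<not> s"
  by (auto simp: range_e)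

private lemmas tw = multilinear_tensor_word[where 'u='u and 'v='v, unfolded multilinear_on_words_def,
  THEN conjunct1, rule_format]
  multilinear_tensor_word[where 'u='u and 'v='v, unfolded multilinear_on_words_def,
  THEN conjunct2, THEN conjunct1, rule_format]
  multilinear_tensor_word[where 'u='u and 'v='v, unfolded multilinear_on_words_def,
  THEN conjunct2, THEN conjunct2, THEN conjunct1, rule_format]
  multilinear_tensor_word[where 'u='u and 'v='v, unfolded multilinear_on_words_def,
  THEN conjunct2, THEN conjunct2, THEN conjunct2, THEN conjunct1, rule_format]

private lemma multilinear_cons:
  "multilinear_on_words (\<lambda>w. tensor_word (l # w) :: ('u, 'v) free_product)"
  unfolding multilinear_on_words_def
  using tw[of "l # us" for us, unfolded append_Cons]
  by (auto intro!: tensor_word_0 simp: alternating_def successively_Cons)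

private lemma multilinear_snoc:
  "multilinear_on_words (\<lambda>w. tensor_word (w @ [l]) :: ('u, 'v) free_product)"
  unfolding multilinear_on_words_def
  using tw[of _ _ _ "vs @ [l]" for vs] tw(2,4)[of _ _ _ "vs @ [l]" for vs]
  by (auto intro!: tensor_word_0 simp: alternating_def successively_append_iff)

private lemma left_tensor_word:
  "left_tensor e x (tensor_word w) = fst x *\<^sub>C tensor_word w + tensor_word (e (snd x) # w)"
  by (simp add: left_tensor_def extend_words_tensor_word multilinear_cons)

private lemma right_tensor_word:
  "right_tensor e (tensor_word w) x = fst x *\<^sub>C tensor_word w + tensor_word (w @ [e (snd x)])"
  by (simp add: right_tensor_def extend_words_tensor_word multilinear_snoc)

private lemma clinear_left_tensor: "clinear (left_tensor e x)"
  by (rule clinearI) (simp_all add: left_tensor_def scaleC_add_right scaleC_scaleC mult.commute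
      clinear_add[OF clinear_extend_words[OF multilinear_cons]]
      clinear_scaleC[OF clinear_extend_words[OF multilinear_cons]])

private lemma clinear_right_tensor: "clinear (\<lambda>p. right_tensor e p x)"
  by (rule clinearI) (simp_all add: right_tensor_def scaleC_add_right scaleC_scaleC mult.commute
      clinear_add[OF clinear_extend_words[OF multilinear_snoc]]
      clinear_scaleC[OF clinear_extend_words[OF multilinear_snoc]])

private lemma clinear_left_tensor': "clinear (\<lambda>x. left_tensor e x p)"
  using e_add[of "[]"] e_scale[of "[]"]
  by (intro clinearI)
    (simp_all add: left_tensor_def extend_words_def Let_def scaleC_prod_def scaleC_complex_def
      scaleC_add_left scaleC_add_right scaleC_scaleC sum.distrib complex_vector.scale_sum_right
      mult.commute)

private lemma clinear_right_tensor': "clinear (right_tensor e p)"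
  using e_add[of _ _ _ "[]"] e_scale[of _ _ _ "[]"]
  by (intro clinearI)
    (simp_all add: right_tensor_def extend_words_def Let_def scaleC_prod_def scaleC_complex_def
      scaleC_add_left scaleC_add_right scaleC_scaleC sum.distrib complex_vector.scale_sum_right
      mult.commute)

private lemmas left_lin =
  clinear_add[OF clinear_left_tensor] clinear_scaleC[OF clinear_left_tensor]
  clinear_add[OF clinear_left_tensor'] clinear_scaleC[OF clinear_left_tensor']

private lemmas right_lin =
  clinear_add[OF clinear_right_tensor] clinear_scaleC[OF clinear_right_tensor]
  clinear_add[OF clinear_right_tensor'] clinear_scaleC[OF clinear_right_tensor']

private definition left_op :: "('u + 'v) list \<Rightarrow> ('u, 'v) free_product" where
  "left_op w = (if \<not> alternating w then 0
     else if w \<noteq> [] \<and> hd w \<in> range e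
       then left_tensor e (T (0, d (hd w))) (tensor_word (tl w))
     else left_tensor e (T (1, 0)) (tensor_word w))"

private definition right_op :: "('u + 'v) list \<Rightarrow> ('u, 'v) free_product" where
  "right_op w = (if \<not> alternating w then 0
     else if w \<noteq> [] \<and> last w \<in> range e
       then right_tensor e (tensor_word (butlast w)) (T (0, d (last w)))
     else right_tensor e (tensor_word w) (T (1, 0)))"

private lemma multilinear_left_op: "multilinear_on_words left_op"
  unfolding multilinear_on_words_def
proof (intro conjI allI impI)
  fix us vs c
  show "left_op (us @ Inl (x + y) # vs) = left_op (us @ Inl x # vs) + left_op (us @ Inl y # vs)" for x y
    unfolding left_op_def alternating_letter(1)[of us "x + y"] alternating_letter(1)[of us x]
      alternating_letter(1)[of us y]
    by (cases us) (simp_all add: letter_in tw(1)[of "[]", simplified] tw(1)[of "l # us" for l us, simplified]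
        tw(1) left_lin d_Inl_add T_zero_add)
  show "left_op (us @ Inl (c *\<^sub>C x) # vs) = c *\<^sub>C left_op (us @ Inl x # vs)" for x
    unfolding left_op_def alternating_letter(1)[of us "c *\<^sub>C x"] alternating_letter(1)[of us x]
    by (cases us) (simp_all add: letter_in tw(2)[of "[]", simplified] tw(2)[of "l # us" for l us, simplified]
        tw(2) left_lin d_Inl_scale T_zero_scale)
  show "left_op (us @ Inr (x + y) # vs) = left_op (us @ Inr x # vs) + left_op (us @ Inr y # vs)" for x y
    unfolding left_op_def alternating_letter(2)[of us "x + y"] alternating_letter(2)[of us x]
      alternating_letter(2)[of us y]
    by (cases us) (simp_all add: letter_in tw(3)[of "[]", simplified] tw(3)[of "l # us" for l us, simplified]
        tw(3) left_lin d_Inr_add T_zero_add)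
  show "left_op (us @ Inr (c *\<^sub>C x) # vs) = c *\<^sub>C left_op (us @ Inr x # vs)" for x
    unfolding left_op_def alternating_letter(2)[of us "c *\<^sub>C x"] alternating_letter(2)[of us x]
    by (cases us) (simp_all add: letter_in tw(4)[of "[]", simplified] tw(4)[of "l # us" for l us, simplified]
        tw(4) left_lin d_Inr_scale T_zero_scale)
next
  show "left_op w = 0" if "\<not> alternating w" for w using that by (simp add: left_op_def)
qed

private lemma multilinear_right_op: "multilinear_on_words right_op"
  unfolding multilinear_on_words_def
proof (intro conjI allI impI)
  fix us vs c
  show "right_op (us @ Inl (x + y) # vs) = right_op (us @ Inl x # vs) + right_op (us @ Inl y # vs)" for x y
    unfolding right_op_def alternating_letter(1)[of us "x + y"] alternating_letter(1)[of us x]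
      alternating_letter(1)[of us y]
    by (cases vs rule: rev_cases)
      (simp_all add: letter_in tw(1) butlast_append right_lin d_Inl_add T_zero_add)
  show "right_op (us @ Inl (c *\<^sub>C x) # vs) = c *\<^sub>C right_op (us @ Inl x # vs)" for x
    unfolding right_op_def alternating_letter(1)[of us "c *\<^sub>C x"] alternating_letter(1)[of us x]
    by (cases vs rule: rev_cases)
      (simp_all add: letter_in tw(2) butlast_append right_lin d_Inl_scale T_zero_scale)
  show "right_op (us @ Inr (x + y) # vs) = right_op (us @ Inr x # vs) + right_op (us @ Inr y # vs)" for x y
    unfolding right_op_def alternating_letter(2)[of us "x + y"] alternating_letter(2)[of us x]
      alternating_letter(2)[of us y]
    by (cases vs rule: rev_cases)
      (simp_all add: letter_in tw(3) butlast_append right_lin d_Inr_add T_zero_add)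
  show "right_op (us @ Inr (c *\<^sub>C x) # vs) = c *\<^sub>C right_op (us @ Inr x # vs)" for x
    unfolding right_op_def alternating_letter(2)[of us "c *\<^sub>C x"] alternating_letter(2)[of us x]
    by (cases vs rule: rev_cases)
      (simp_all add: letter_in tw(4) butlast_append right_lin d_Inr_scale T_zero_scale)
next
  show "right_op w = 0" if "\<not> alternating w" for w using that by (simp add: right_op_def)
qed

private lemma clinear_eqI:
  assumes "clinear L" "clinear (M :: ('u, 'v) free_product \<Rightarrow> ('u, 'v) free_product)"
    and "\<And>w. w \<in> S \<Longrightarrow> L (tensor_word w) = M (tensor_word w)"
    and "p \<in> complex_vector.span (tensor_word ` S)"
  shows "L p = M p"
proof -
  interpret L: Vector_Spaces.linear scaleC scaleC L by fact
  interpret M: Vector_Spaces.linear scaleC scaleC M by fact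
  show ?thesis
    using assms(4)
    by (induction rule: complex_vector.span_induct_alt)
      (auto simp: L.zero M.zero L.add M.add L.scale M.scale assms(3))
qed

lemma left_rep_ex1_aux:
  "\<exists>!L. clinear L \<and> (\<forall>x. \<forall>p\<in>left_space e. L (left_tensor e x p) = left_tensor e (T x) p)"
proof (rule ex1I[of _ "extend_words left_op"], intro conjI allI ballI)
  let ?L = "extend_words left_op"
  show L: "clinear ?L" by (rule clinear_extend_words[OF multilinear_left_op])
  fix x and p :: "('u, 'v) free_product" assume "p \<in> left_space e"
  then have p: "p \<in> complex_vector.span (tensor_word ` {w. w = [] \<or> hd w \<notin> range e})"
    by (simp add: left_space_def setcompr_eq_image)
  show "?L (left_tensor e x p) = left_tensor e (T x) p"
  proof (rule clinear_eqI[OF _ clinear_left_tensor _ p])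
    show "clinear (\<lambda>p. ?L (left_tensor e x p))"
      by (intro clinearI) (simp_all add: left_lin clinear_add[OF L] clinear_scaleC[OF L])
    fix w :: "('u + 'v) list" assume w: "w \<in> {w. w = [] \<or> hd w \<notin> range e}"
    show "?L (left_tensor e x (tensor_word w)) = left_tensor e (T x) (tensor_word w)"
    proof (cases "alternating w")
      case True
      then have alt: "alternating (e (snd x) # w)"
        using w by (auto simp: alternating_def successively_Cons range_e isl_e)
      have "?L (left_tensor e x (tensor_word w)) = fst x *\<^sub>C left_op w + left_op (e (snd x) # w)"
        by (simp add: left_tensor_word clinear_add[OF L] clinear_scaleC[OF L]
            extend_words_tensor_word[OF multilinear_left_op])
      also have "left_op w = left_tensor e (T (1, 0)) (tensor_word w)"
        using True w by (auto simp: left_op_def)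
      also have "left_op (e (snd x) # w) = left_tensor e (T (0, snd x)) (tensor_word w)"
        using alt by (simp add: left_op_def d_e)
      finally show ?thesis by (subst T_split) (simp add: left_lin)
    next
      case False
      have "left_tensor e y 0 = 0" for y
        using left_lin(2)[of y 0 0] by simp
      moreover have "?L 0 = 0" using clinear_scaleC[OF L, of 0 0] by simp
      ultimately show ?thesis by (simp add: tensor_word_0[OF False])
    qed
  qed
next
  fix M assume M: "clinear M \<and> (\<forall>x. \<forall>p\<in>left_space e. M (left_tensor e x p) = left_tensor e (T x) p)"
  show "M = extend_words left_op"
  proof (rule ext, rule clinear_eqI[where L = M and M = "extend_words left_op" and S = UNIV])
    show "clinear M" using M by simp
    show L: "clinear (extend_words left_op)" by (rule clinear_extend_words[OF multilinear_left_op])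
    show "p \<in> complex_vector.span (range tensor_word)" for p :: "('u, 'v) free_product"
      by (simp add: span_tensor_word)
    have in_space: "tensor_word w \<in> left_space e" if "w = [] \<or> hd w \<notin> range e" for w
      unfolding left_space_def using that by (intro complex_vector.span_base) blast
    fix w :: "('u + 'v) list"
    consider "\<not> alternating w" | "alternating w" "w = [] \<or> hd w \<notin> range e"
      | "alternating w" "w \<noteq> []" "hd w \<in> range e" by blast
    then show "M (tensor_word w) = extend_words left_op (tensor_word w)"
    proof cases
      case 1
      then show ?thesis
        using clinear_scaleC[OF L, of 0 0] clinear_scaleC[OF conjunct1[OF M], of 0 0]
        by (simp add: tensor_word_0)
    next
      case 2
      have "tensor_word w = left_tensor e (1, 0) (tensor_word w)"
        using e_zero[of "[]" w] by (simp add: left_tensor_word scaleC_one)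
      then have "M (tensor_word w) = left_tensor e (T (1, 0)) (tensor_word w)"
        using M in_space[OF 2(2)] by metis
      then show ?thesis
        using 2 by (auto simp: extend_words_tensor_word[OF multilinear_left_op] left_op_def)
    next
      case 3
      then obtain l v where w: "w = l # v" by (cases w) auto
      have l: "isl l = s" "e (d l) = l" using 3 w by (auto simp: range_e e_d)
      have v: "v = [] \<or> hd v \<notin> range e"
        using 3(1) l by (auto simp: w alternating_def successively_Cons range_e)
      have "tensor_word w = left_tensor e (0, d l) (tensor_word v)"
        by (simp add: left_tensor_word w l)
      then have "M (tensor_word w) = left_tensor e (T (0, d l)) (tensor_word v)"
        using M in_space[OF v] by metis
      then show ?thesis
        using 3 by (auto simp: w extend_words_tensor_word[OF multilinear_left_op] left_op_def)
    qed
  qed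
qed

lemma right_rep_ex1_aux:
  "\<exists>!R. clinear R \<and> (\<forall>x. \<forall>p\<in>right_space e. R (right_tensor e p x) = right_tensor e p (T x))"
proof (rule ex1I[of _ "extend_words right_op"], intro conjI allI ballI)
  let ?R = "extend_words right_op"
  show R: "clinear ?R" by (rule clinear_extend_words[OF multilinear_right_op])
  fix x and p :: "('u, 'v) free_product" assume "p \<in> right_space e"
  then have p: "p \<in> complex_vector.span (tensor_word ` {w. w = [] \<or> last w \<notin> range e})"
    by (simp add: right_space_def setcompr_eq_image)
  show "?R (right_tensor e p x) = right_tensor e p (T x)"
  proof (rule clinear_eqI[OF _ clinear_right_tensor _ p])
    show "clinear (\<lambda>p. ?R (right_tensor e p x))"
      by (intro clinearI) (simp_all add: right_lin clinear_add[OF R] clinear_scaleC[OF R])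
    fix w :: "('u + 'v) list" assume w: "w \<in> {w. w = [] \<or> last w \<notin> range e}"
    show "?R (right_tensor e (tensor_word w) x) = right_tensor e (tensor_word w) (T x)"
    proof (cases "alternating w")
      case True
      then have alt: "alternating (w @ [e (snd x)])"
        using w by (auto simp: alternating_def successively_append_iff range_e isl_e)
      have "?R (right_tensor e (tensor_word w) x) = fst x *\<^sub>C right_op w + right_op (w @ [e (snd x)])"
        by (simp add: right_tensor_word clinear_add[OF R] clinear_scaleC[OF R]
            extend_words_tensor_word[OF multilinear_right_op])
      also have "right_op w = right_tensor e (tensor_word w) (T (1, 0))"
        using True w by (auto simp: right_op_def)
      also have "right_op (w @ [e (snd x)]) = right_tensor e (tensor_word w) (T (0, snd x))"
        using alt by (simp add: right_op_def d_e)
      finally show ?thesis by (subst T_split) (simp add: right_lin)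
    next
      case False
      have "right_tensor e 0 y = 0" for y
        using right_lin(2)[of 0 0 y] by simp
      moreover have "?R 0 = 0" using clinear_scaleC[OF R, of 0 0] by simp
      ultimately show ?thesis by (simp add: tensor_word_0[OF False])
    qed
  qed
next
  fix M assume M: "clinear M \<and> (\<forall>x. \<forall>p\<in>right_space e. M (right_tensor e p x) = right_tensor e p (T x))"
  show "M = extend_words right_op"
  proof (rule ext, rule clinear_eqI[where L = M and M = "extend_words right_op" and S = UNIV])
    show "clinear M" using M by simp
    show R: "clinear (extend_words right_op)" by (rule clinear_extend_words[OF multilinear_right_op])
    show "p \<in> complex_vector.span (range tensor_word)" for p :: "('u, 'v) free_product"
      by (simp add: span_tensor_word)
    have in_space: "tensor_word w \<in> right_space e" if "w = [] \<or> last w \<notin> range e" for w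
      unfolding right_space_def using that by (intro complex_vector.span_base) blast
    fix w :: "('u + 'v) list"
    consider "\<not> alternating w" | "alternating w" "w = [] \<or> last w \<notin> range e"
      | "alternating w" "w \<noteq> []" "last w \<in> range e" by blast
    then show "M (tensor_word w) = extend_words right_op (tensor_word w)"
    proof cases
      case 1
      then show ?thesis
        using clinear_scaleC[OF R, of 0 0] clinear_scaleC[OF conjunct1[OF M], of 0 0]
        by (simp add: tensor_word_0)
    next
      case 2
      have "tensor_word w = right_tensor e (tensor_word w) (1, 0)"
        using e_zero[of w "[]"] by (simp add: right_tensor_word scaleC_one)
      then have "M (tensor_word w) = right_tensor e (tensor_word w) (T (1, 0))"
        using M in_space[OF 2(2)] by metis
      then show ?thesis
        using 2 by (auto simp: extend_words_tensor_word[OF multilinear_right_op] right_op_def)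
    next
      case 3
      then obtain l v where w: "w = v @ [l]" by (cases w rule: rev_cases) auto
      have l: "isl l = s" "e (d l) = l" using 3 w by (auto simp: range_e e_d)
      have v: "v = [] \<or> last v \<notin> range e"
        using 3(1) l by (auto simp: w alternating_def successively_append_iff range_e)
      have "tensor_word w = right_tensor e (tensor_word v) (0, d l)"
        by (simp add: right_tensor_word w l)
      then have "M (tensor_word w) = right_tensor e (tensor_word v) (T (0, d l))"
        using M in_space[OF v] by metis
      then show ?thesis
        using 3 by (auto simp: w extend_words_tensor_word[OF multilinear_right_op] right_op_def)
    qed
  qed
qed

end

lemma range_Inr_iff: "l \<in> range Inr \<longleftrightarrow> \<not> isl l"
  by (cases l) auto

lemma left_rep_Inl_ex1:
  assumes "clinear T"
  shows "\<exists>!L. clinear L \<and> (\<forall>x. \<forall>p\<in>left_space Inl.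
           L (left_tensor Inl x p) = (left_tensor Inl (T x) p :: ('u::complex_vector, 'v::complex_vector) free_product))"
  using multilinear_tensor_word[where 'u='u and 'v='v] assms
  by (intro left_rep_ex1_aux[of _ True projl]) (auto simp: multilinear_on_words_def isl_def)

lemma left_rep_Inr_ex1:
  assumes "clinear T"
  shows "\<exists>!L. clinear L \<and> (\<forall>x. \<forall>p\<in>left_space Inr.
           L (left_tensor Inr x p) = (left_tensor Inr (T x) p :: ('u::complex_vector, 'v::complex_vector) free_product))"
  using multilinear_tensor_word[where 'u='u and 'v='v] assms
  by (intro left_rep_ex1_aux[of _ False projr]) (auto simp: multilinear_on_words_def range_Inr_iff)

lemma right_rep_Inl_ex1:
  assumes "clinear T"
  shows "\<exists>!R. clinear R \<and> (\<forall>x. \<forall>p\<in>right_space Inl.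
           R (right_tensor Inl p x) = (right_tensor Inl p (T x) :: ('u::complex_vector, 'v::complex_vector) free_product))"
  using multilinear_tensor_word[where 'u='u and 'v='v] assms
  by (intro right_rep_ex1_aux[of _ True projl]) (auto simp: multilinear_on_words_def isl_def)

lemma right_rep_Inr_ex1:
  assumes "clinear T"
  shows "\<exists>!R. clinear R \<and> (\<forall>x. \<forall>p\<in>right_space Inr.
           R (right_tensor Inr p x) = (right_tensor Inr p (T x) :: ('u::complex_vector, 'v::complex_vector) free_product))"
  using multilinear_tensor_word[where 'u='u and 'v='v] assms
  by (intro right_rep_ex1_aux[of _ False projr]) (auto simp: multilinear_on_words_def range_Inr_iff)

lemma multilinear_vacuum_coeff:
  "multilinear_on_words (\<lambda>w. (if w = [] then 1 else 0) :: complex)"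
  by (simp add: multilinear_on_words_def scaleC_complex_def alternating_def)

section \<open>Bi-freeness and distributions\<close>

text \<open>
  The type arguments are the spaces $\mathcal X_1^\circ$ and $\mathcal X_2^\circ$. As an assumption
  on otherwise unconstrained types, this expresses that suitable spaces exist.
  A list of pairs encodes a word in the four elements together with the same word in the
  four operators.
\<close>

definition bifree :: "'u::complex_vector itself \<Rightarrow> 'v::complex_vector itself \<Rightarrow>
    ('a::cstar_algebra \<Rightarrow> complex) \<Rightarrow> 'a \<times> 'a \<Rightarrow> 'a \<times> 'a \<Rightarrow> bool" where
  "bifree _ _ \<phi> c1 c2 \<longleftrightarrow>
     (\<exists>(T1 :: complex \<times> 'u \<Rightarrow> complex \<times> 'u) S1 (T2 :: complex \<times> 'v \<Rightarrow> complex \<times> 'v) S2.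
        clinear T1 \<and> clinear S1 \<and> clinear T2 \<and> clinear S2 \<and>
        (\<forall>ps \<in> lists {(fst c1, left_rep Inl T1), (fst c2, left_rep Inr T2),
                       (snd c1, right_rep Inl S1), (snd c2, right_rep Inr S2)}.
           \<phi> (prod_list (map fst ps)) = vacuum_state (foldr (\<circ>) (map snd ps) id)))"

definition is_distribution ::
    "('a::cstar_algebra \<Rightarrow> complex) \<Rightarrow> 'a \<Rightarrow> 'a \<Rightarrow> (real \<times> real) measure \<Rightarrow> bool" where
  "is_distribution \<phi> a b \<eta> \<longleftrightarrow>
     prob_space \<eta> \<and> sets \<eta> = sets borel \<and>
     (\<exists>K. compact K \<and> (AE p in \<eta>. p \<in> K)) \<and>
     (\<forall>m n. \<phi> (a ^ m * b ^ n) = complex_of_real (\<integral>p. fst p ^ m * snd p ^ n \<partial>\<eta>))"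

definition cauchy_transform :: "(real \<times> real) measure \<Rightarrow> complex \<Rightarrow> complex \<Rightarrow> complex" where
  "cauchy_transform \<eta> z w =
     (\<integral>p. 1 / ((z - complex_of_real (fst p)) * (w - complex_of_real (snd p))) \<partial>\<eta>)"

definition first_marginal :: "(real \<times> real) measure \<Rightarrow> real measure" where
  "first_marginal \<eta> = distr \<eta> borel fst"

definition second_marginal :: "(real \<times> real) measure \<Rightarrow> real measure" where
  "second_marginal \<eta> = distr \<eta> borel snd"

end

theory Submission
  imports Defs "HOL-Complex_Analysis.Great_Picard" "HOL-Real_Asymp.Real_Asymp"
begin

text \<open>
  Freezing one of the two variables in the hypothesis and using \<open>\<alpha> > 1/2\<close> with Cauchy--Schwarz shows
  that the Cauchy transform of each marginal of \<open>\<eta>\<close> blows up vertically, at \<open>x\<close> and at \<open>u\<close>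
  respectively. The left variables are free, and so are the right ones, so each marginal is a free
  additive convolution and it suffices to treat one face.

  There, with \<open>F = 1/G\<close>, subordination provides \<open>\<omega>\<^sub>1 + \<omega>\<^sub>2 = z + F(z)\<close> and
  \<open>F\<^sub>1(\<omega>\<^sub>1) = F\<^sub>2(\<omega>\<^sub>2) = F(z)\<close> on the upper half plane: \<open>\<omega>\<^sub>1(z)\<close> is a fixed point of
  \<open>w \<mapsto> z + h\<^sub>2(z + h\<^sub>1(w))\<close> with \<open>h\<^sub>j(w) = F\<^sub>j(w) - w\<close>, obtained from a normal family of iterates,
  and it is matched with \<open>F\<close> far from the real axis by an explicit resolvent identity for free elements.
  As \<open>z\<close> tends to \<open>x\<close>, \<open>F(z)\<close> tends to \<open>0\<close>, the \<open>\<omega>\<^sub>j\<close> accumulate at real points \<open>a\<close> and \<open>x - a\<close>,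
  and the limit superior of \<open>Im \<omega>\<^sub>j / Im F\<close> is at most the mass at these points, while the two
  quotients add up to at least \<open>1\<close>.
\<close>

section \<open>Reciprocal Cauchy transforms\<close>

text \<open>The exponent 1/2 is a Cauchy--Schwarz threshold. The absolute value now sits inside the
  integral; \<open>|G| \<ge> - Im G \<ge> y * I(y)^2\<close> recovers G with growth y^(1 -
  2\<alpha>), which diverges exactly for \<alpha> > 1/2.

  Subordination has to bridge two regions: power series in the algebra converge only far from the
  origin, whereas the atoms are seen at the real axis. Hence the fixed point is built
  holomorphically on the whole half plane, and the identity theorem carries its equation with F down
  to the axis. One estimate, |h_j(w)| \<le> C + C / Im w, makes the iterates locally bounded, makes
  the map a contraction high up, and makes the centred resolvents small enough to be multiplied
  out.\<close>

definition cauchy_real :: "real measure \<Rightarrow> complex \<Rightarrow> complex" where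
  "cauchy_real \<mu> z = (\<integral>t. 1 / (z - complex_of_real t) \<partial>\<mu>)"

definition recip_cauchy :: "real measure \<Rightarrow> complex \<Rightarrow> complex" where
  "recip_cauchy \<mu> z = inverse (cauchy_real \<mu> z)"

text \<open>By \<open>Im_cauchy_real\<close> this is \<open>- Im G(z) / Im z\<close>. Its comparison
  with \<open>|G(z)|^2\<close> underlies the estimates for \<open>F = 1/G\<close>.\<close>

definition square_cauchy :: "real measure \<Rightarrow> complex \<Rightarrow> real" where
  "square_cauchy \<mu> z = (\<integral>t. (cmod (1 / (z - complex_of_real t)))\<^sup>2 \<partial>\<mu>)"

text \<open>The integral of \<open>(f - s g)^2\<close> is a nonnegative quadratic in
  \<open>s\<close>, and its minimiser \<open>s = b / c\<close> gives the inequality. For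
  \<open>c = 0\<close> it is affine in \<open>s\<close>, and nonnegativity forces
  \<open>b = 0\<close>.\<close>

lemma Cauchy_Schwarz_integral:
  fixes f g :: "'a \<Rightarrow> real"
  assumes f: "integrable M (\<lambda>x. (f x)\<^sup>2)" and g: "integrable M (\<lambda>x. (g x)\<^sup>2)"
    and fg: "integrable M (\<lambda>x. f x * g x)"
  shows "(\<integral>x. f x * g x \<partial>M)\<^sup>2 \<le> (\<integral>x. (f x)\<^sup>2 \<partial>M) * (\<integral>x. (g x)\<^sup>2 \<partial>M)"
proof -
  define a b c where "a = (\<integral>x. (f x)\<^sup>2 \<partial>M)" and "b = (\<integral>x. f x * g x \<partial>M)" and "c = (\<integral>x. (g x)\<^sup>2 \<partial>M)"
  have quad: "0 \<le> a - 2 * s * b + s\<^sup>2 * c" for s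
  proof -
    have "0 \<le> (\<integral>x. (f x - s * g x)\<^sup>2 \<partial>M)" by simp
    also have "(\<lambda>x. (f x - s * g x)\<^sup>2) = (\<lambda>x. (f x)\<^sup>2 - (2 * s) * (f x * g x) + s\<^sup>2 * (g x)\<^sup>2)"
      by (auto simp: power2_eq_square algebra_simps)
    also have "(\<integral>x. \<dots> x \<partial>M) = a - 2 * s * b + s\<^sup>2 * c"
      using f g fg by (simp add: a_def b_def c_def)
    finally show ?thesis .
  qed
  have "c \<ge> 0" by (simp add: c_def)
  show ?thesis
  proof (cases "c = 0")
    case True
    have "b = 0"
    proof (rule ccontr)
      assume "b \<noteq> 0"
      then show False using quad[of "(a + 1) / (2 * b)"] True by simp
    qed
    then show ?thesis using True by (simp add: a_def b_def c_def)
  next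
    case False
    then have c: "c > 0" using \<open>c \<ge> 0\<close> by simp
    have "0 \<le> c * (a - 2 * (b / c) * b + (b / c)\<^sup>2 * c)"
      using quad[of "b / c"] c by simp
    also have "\<dots> = a * c - b\<^sup>2" using c by (simp add: power2_eq_square field_simps)
    finally show ?thesis by (simp add: a_def b_def c_def)
  qed
qed

locale real_prob = prob_space \<mu> for \<mu> :: "real measure" +
  assumes sets_eq [measurable_cong, simp]: "sets \<mu> = sets borel"
begin

lemma space_eq [simp]: "space \<mu> = UNIV"
  using sets_eq_imp_space_eq[OF sets_eq] by simp

lemma Im_le_kernel: "Im z \<le> cmod (z - complex_of_real t)"
  using abs_Im_le_cmod[of "z - complex_of_real t"] by simp

lemma kernel_ne: "0 < Im z \<Longrightarrow> z - complex_of_real t \<noteq> 0"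
  by (auto simp: complex_eq_iff)

lemma norm_kernel_le:
  assumes "0 < Im z" shows "cmod (1 / (z - complex_of_real t)) \<le> 1 / Im z"
  using Im_le_kernel[of z t] assms by (simp add: norm_divide frac_le)

lemma integrable_bounded:
  fixes f :: "real \<Rightarrow> 'b::{banach, second_countable_topology}"
  assumes "f \<in> borel_measurable borel" "\<And>t. norm (f t) \<le> B"
  shows "integrable \<mu> f"
  using assms by (intro integrable_const_bound[where B=B]) auto

lemma integrable_kernel: "0 < Im z \<Longrightarrow> integrable \<mu> (\<lambda>t. 1 / (z - complex_of_real t))"
  by (rule integrable_bounded[where B="1 / Im z"]) (simp_all add: norm_kernel_le del: norm_divide)

lemma integrable_kernel_norm: "0 < Im z \<Longrightarrow> integrable \<mu> (\<lambda>t. cmod (1 / (z - complex_of_real t)))"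
  using integrable_kernel by (rule integrable_norm)

lemma integrable_kernel_sq:
  assumes "0 < Im z" shows "integrable \<mu> (\<lambda>t. (cmod (1 / (z - complex_of_real t)))\<^sup>2)"
proof (rule integrable_bounded[where B="(1 / Im z)\<^sup>2"])
  show "norm ((cmod (1 / (z - complex_of_real t)))\<^sup>2) \<le> (1 / Im z)\<^sup>2" for t
    using power_mono[OF norm_kernel_le[OF assms, of t] norm_ge_zero, of 2] by simp
qed simp

text \<open>Cauchy--Schwarz against an indicator. The case \<open>A = UNIV\<close> compares
  \<open>G\<close> with \<open>square_cauchy\<close>; a short interval around a limit point brings
  in the mass of an atom.\<close>

lemma set_kernel_bound:
  assumes z: "0 < Im z" and A: "A \<in> sets borel"
  shows "(\<integral>t. indicator A t * cmod (1 / (z - complex_of_real t)) \<partial>\<mu>)\<^sup>2 \<le> measure \<mu> A * square_cauchy \<mu> z"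
proof -
  have "(\<integral>t. indicator A t * cmod (1 / (z - complex_of_real t)) \<partial>\<mu>)\<^sup>2
      \<le> (\<integral>t. (indicator A t)\<^sup>2 \<partial>\<mu>) * (\<integral>t. (cmod (1 / (z - complex_of_real t)))\<^sup>2 \<partial>\<mu>)"
  proof (rule Cauchy_Schwarz_integral)
    show "integrable \<mu> (\<lambda>t. (indicator A t :: real)\<^sup>2)"
      using A by (intro integrable_bounded[where B=1]) (auto simp: indicator_def)
    show "integrable \<mu> (\<lambda>t. indicator A t * cmod (1 / (z - complex_of_real t)))"
      using A norm_kernel_le[OF z] z
      by (intro integrable_bounded[where B="1 / Im z"]) (auto simp: indicator_def)
  qed (rule integrable_kernel_sq[OF z])
  also have "(\<lambda>t. (indicator A t :: real)\<^sup>2) = indicator A" by (auto simp: indicator_def)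
  finally show ?thesis using A by (simp add: square_cauchy_def)
qed

lemma Im_cauchy_real:
  assumes z: "0 < Im z" shows "Im (cauchy_real \<mu> z) = - Im z * square_cauchy \<mu> z"
proof -
  have "Im (cauchy_real \<mu> z) = (\<integral>t. Im (1 / (z - complex_of_real t)) \<partial>\<mu>)"
    unfolding cauchy_real_def using integrable_kernel[OF z]
    by (intro integral_bounded_linear[OF bounded_linear_Im, symmetric])
  also have "(\<lambda>t. Im (1 / (z - complex_of_real t))) = (\<lambda>t. - Im z * (cmod (1 / (z - complex_of_real t)))\<^sup>2)"
    by (auto simp: Im_divide cmod_power2 norm_divide power_divide)
  finally show ?thesis by (simp add: square_cauchy_def)
qed

lemma square_cauchy_pos: assumes z: "0 < Im z" shows "0 < square_cauchy \<mu> z"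
  unfolding square_cauchy_def
  using kernel_ne[OF z] integrable_kernel_sq[OF z] by (intro expectation_greater) auto

lemma cauchy_real_ne: "0 < Im z \<Longrightarrow> cauchy_real \<mu> z \<noteq> 0"
  using Im_cauchy_real[of z] square_cauchy_pos[of z] by (auto simp: complex_eq_iff)

lemma norm_cauchy_le: "cmod (cauchy_real \<mu> z) \<le> (\<integral>t. cmod (1 / (z - complex_of_real t)) \<partial>\<mu>)"
  unfolding cauchy_real_def by simp

lemma integral_kernel_norm_sq_le:
  "0 < Im z \<Longrightarrow> (\<integral>t. cmod (1 / (z - complex_of_real t)) \<partial>\<mu>)\<^sup>2 \<le> square_cauchy \<mu> z"
  using set_kernel_bound[of z UNIV] prob_space by simp

lemma cauchy_sq_le: "0 < Im z \<Longrightarrow> (cmod (cauchy_real \<mu> z))\<^sup>2 \<le> square_cauchy \<mu> z"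
  using integral_kernel_norm_sq_le norm_cauchy_le power_mono[OF norm_cauchy_le norm_ge_zero]
  by (meson order_trans)

lemma Im_recip_cauchy:
  assumes z: "0 < Im z"
  shows "Im (recip_cauchy \<mu> z) * (cmod (cauchy_real \<mu> z))\<^sup>2 = Im z * square_cauchy \<mu> z"
proof -
  have "Im (inverse w) * (cmod w)\<^sup>2 = - Im w" if "w \<noteq> 0" for w
    using that by (simp flip: cmod_power2)
  from this[OF cauchy_real_ne[OF z]] show ?thesis
    unfolding recip_cauchy_def Im_cauchy_real[OF z] by simp
qed

text \<open>After multiplication by \<open>|G|^2\<close> this is \<open>cauchy_sq_le\<close>. It
  says that \<open>F(w) - w\<close> takes values in the closed upper half plane, which keeps the
  later iteration inside the half plane.\<close>

lemma Im_recip_ge: assumes z: "0 < Im z" shows "Im z \<le> Im (recip_cauchy \<mu> z)"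
proof -
  have "Im z * (cmod (cauchy_real \<mu> z))\<^sup>2 \<le> Im (recip_cauchy \<mu> z) * (cmod (cauchy_real \<mu> z))\<^sup>2"
    unfolding Im_recip_cauchy[OF z] using cauchy_sq_le[OF z] z by simp
  then show ?thesis using cauchy_real_ne[OF z] by simp
qed

lemma cauchy_real_deriv:
  assumes z: "0 < Im z"
  shows "(cauchy_real \<mu> has_field_derivative (- (\<integral>t. 1 / (z - complex_of_real t)\<^sup>2 \<partial>\<mu>))) (at z)"
proof -
  have "((\<lambda>h. (cauchy_real \<mu> (z + h) - cauchy_real \<mu> z) / h) \<longlongrightarrow> - (\<integral>t. 1 / (z - complex_of_real t)\<^sup>2 \<partial>\<mu>)) (at 0)"
  proof (rule LIM_zero_cancel, rule Lim_null_comparison)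
    \<comment> \<open>The error is the integral of \<open>h\<close> times the kernel at
      \<open>z + h\<close> times the squared kernel at \<open>z\<close>. For
      \<open>|h| < Im z / 2\<close> the first kernel is at most \<open>2 / Im z\<close>, each of the
      others at most \<open>1 / Im z\<close>.\<close>
    define C where "C = 2 / (Im z)^3"
    show "((\<lambda>h. C * norm h) \<longlongrightarrow> 0) (at (0::complex))" by (auto intro!: tendsto_eq_intros)
    have "\<forall>\<^sub>F h in at 0. h \<in> ball 0 (Im z / 2) - {0}"
      using z by (intro eventually_at_in_open) auto
    then show "\<forall>\<^sub>F h in at 0. norm ((cauchy_real \<mu> (z + h) - cauchy_real \<mu> z) / h - - (\<integral>t. 1 / (z - complex_of_real t)\<^sup>2 \<partial>\<mu>))
         \<le> C * norm h"
    proof eventually_elim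
      case (elim h)
      then have h: "h \<noteq> 0" "norm h < Im z / 2" by auto
      have zh: "Im z / 2 < Im (z + h)" using abs_Im_le_cmod[of h] h by (auto simp: abs_if split: if_splits)
      then have zh0: "0 < Im (z + h)" using z by simp
      have sq: "integrable \<mu> (\<lambda>t. 1 / (z - complex_of_real t)\<^sup>2)"
      proof (rule integrable_bounded[where B="(1 / Im z)\<^sup>2"])
        show "norm (1 / (z - complex_of_real t)\<^sup>2) \<le> (1 / Im z)\<^sup>2" for t
          using power_mono[OF norm_kernel_le[OF z, of t] norm_ge_zero, of 2]
          by (simp add: norm_divide power_divide norm_power)
      qed simp
      have "(cauchy_real \<mu> (z + h) - cauchy_real \<mu> z) / h - - (\<integral>t. 1 / (z - complex_of_real t)\<^sup>2 \<partial>\<mu>)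
          = (\<integral>t. (1 / (z + h - complex_of_real t) - 1 / (z - complex_of_real t)) / h + 1 / (z - complex_of_real t)\<^sup>2 \<partial>\<mu>)"
        unfolding cauchy_real_def using integrable_kernel[OF z] integrable_kernel[OF zh0] sq by simp
      also have "norm \<dots> \<le> C * norm h"
      proof (rule order_trans[OF integral_norm_bound], rule integral_le_const)
        have eq: "(1 / (z + h - complex_of_real t) - 1 / (z - complex_of_real t)) / h + 1 / (z - complex_of_real t)\<^sup>2
           = h * (1 / (z + h - complex_of_real t)) * (1 / (z - complex_of_real t))\<^sup>2" for t
        proof -
          define w where "w = z - complex_of_real t"
          have w: "z + h - complex_of_real t = w + h" "w \<noteq> 0" "w + h \<noteq> 0"
            using kernel_ne[OF z, of t] kernel_ne[OF zh0, of t] by (simp_all add: w_def algebra_simps)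
          show ?thesis
            unfolding w(1) w_def[symmetric] using w h(1) by (simp add: divide_simps power2_eq_square)
        qed
        have "cmod ((1 / (z + h - complex_of_real t) - 1 / (z - complex_of_real t)) / h + 1 / (z - complex_of_real t)\<^sup>2) \<le> C * norm h" for t
        proof -
          have "norm (h * (1 / (z + h - complex_of_real t)) * (1 / (z - complex_of_real t))\<^sup>2)
              \<le> norm h * (1 / (Im z / 2)) * (1 / Im z)\<^sup>2"
            unfolding norm_mult norm_power
          proof (intro mult_mono power_mono order_refl)
            have "norm (1 / (z + h - complex_of_real t)) \<le> 1 / Im (z + h)" by (rule norm_kernel_le[OF zh0])
            also have "\<dots> \<le> 1 / (Im z / 2)" using zh z by (intro divide_left_mono) auto
            finally show "norm (1 / (z + h - complex_of_real t)) \<le> 1 / (Im z / 2)" .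
          qed (use norm_kernel_le[OF z, of t] z in auto)
          also have "\<dots> = C * norm h" by (simp add: C_def power_divide power2_eq_square power3_eq_cube mult_ac)
          finally show ?thesis unfolding eq .
        qed
        then show "AE t in \<mu>. cmod ((1 / (z + h - complex_of_real t) - 1 / (z - complex_of_real t)) / h + 1 / (z - complex_of_real t)\<^sup>2) \<le> C * norm h"
          by simp
        show "integrable \<mu> (\<lambda>t. cmod ((1 / (z + h - complex_of_real t) - 1 / (z - complex_of_real t)) / h + 1 / (z - complex_of_real t)\<^sup>2))"
          using integrable_kernel[OF z] integrable_kernel[OF zh0] sq by (intro integrable_norm) simp
      qed
      finally show ?case .
    qed
  qed
  then show ?thesis by (simp add: DERIV_def)
qed

lemma recip_cauchy_holomorphic: "recip_cauchy \<mu> holomorphic_on {z. 0 < Im z}"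
proof -
  have "cauchy_real \<mu> holomorphic_on {z. 0 < Im z}"
    by (rule holomorphic_onI)
      (use cauchy_real_deriv has_field_derivative_at_within field_differentiable_def in blast)
  then have "(\<lambda>z. inverse (cauchy_real \<mu> z)) holomorphic_on {z. 0 < Im z}"
    by (rule holomorphic_on_inverse) (use cauchy_real_ne in auto)
  then show ?thesis by (simp add: recip_cauchy_def[abs_def])
qed

end

section \<open>Compactly supported measures: F stays close to the identity\<close>

locale compact_real_prob = real_prob \<mu> for \<mu> :: "real measure" +
  fixes R :: real
  assumes support: "AE t in \<mu>. \<bar>t\<bar> \<le> R"
begin

lemma R_nonneg: "0 \<le> R"
proof (rule ccontr)
  assume "\<not> 0 \<le> R"
  then have "AE t in \<mu>. False"
    by (intro eventually_mono[OF support]) auto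
  then show False by simp
qed

lemma integrable_power: "integrable \<mu> (\<lambda>t. t ^ n)"
proof (rule integrable_const_bound[where B="R ^ n"])
  show "AE t in \<mu>. norm (t ^ n) \<le> R ^ n"
    using support by eventually_elim (simp add: power_abs power_mono)
qed simp

text \<open>With \<open>k = z - F(z) - m\<close>, the product \<open>k G\<close> is the covariance
  of \<open>t\<close> and \<open>r(t) = 1 / (z - t)\<close>. Cauchy--Schwarz bounds
  \<open>|k G|^2\<close> by the product of the two variances: that of \<open>t\<close> is at most
  \<open>R^2\<close>, that of \<open>r\<close> is
  \<open>square_cauchy - |G|^2 = - Im k |G|^2 / Im z\<close>. Since \<open>|Im k| \<le> |k|\<close>,
  one factor \<open>|k|\<close> cancels and \<open>|k| \<le> R^2 / Im z\<close> remains.\<close>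

lemma recip_cauchy_near_identity:
  assumes z: "0 < Im z"
  shows "cmod (recip_cauchy \<mu> z - z) \<le> R + R\<^sup>2 / Im z"
proof -
  define m where "m = (\<integral>t. t \<partial>\<mu>)"
  define G where "G = cauchy_real \<mu> z"
  define r where "r = (\<lambda>t. 1 / (z - complex_of_real t))"
  define k where "k = z - recip_cauchy \<mu> z - m"
  note int1 = integrable_power[of 1, simplified] and int2 = integrable_power[of 2]
  have intr: "integrable \<mu> r" unfolding r_def by (rule integrable_kernel[OF z])
  have Gr: "G = (\<integral>t. r t \<partial>\<mu>)" by (simp add: G_def cauchy_real_def r_def)
  have G0: "G \<noteq> 0" unfolding G_def by (rule cauchy_real_ne[OF z])
  have nr: "cmod (r t) \<le> 1 / Im z" for t unfolding r_def by (rule norm_kernel_le[OF z])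
  have tr: "complex_of_real t * r t = z * r t - 1" for t
    using kernel_ne[OF z, of t] by (simp add: r_def field_simps)
  have inttr: "integrable \<mu> (\<lambda>t. complex_of_real t * r t)" unfolding tr using intr by simp
  have int1c: "integrable \<mu> (\<lambda>t. complex_of_real t)" using int1 by simp
  have m_le: "\<bar>m\<bar> \<le> R"
  proof -
    have "norm m \<le> (\<integral>t. norm t \<partial>\<mu>)" unfolding m_def by (rule integral_norm_bound)
    also have "\<dots> \<le> R" using support int1 by (intro integral_le_const) auto
    finally show ?thesis by simp
  qed
  have V: "(\<integral>t. (\<bar>t - m\<bar>)\<^sup>2 \<partial>\<mu>) \<le> R\<^sup>2"
  proof -
    have "(\<lambda>t. (\<bar>t - m\<bar>)\<^sup>2) = (\<lambda>t. t\<^sup>2 - 2 * m * t + m\<^sup>2)"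
      by (auto simp: power2_eq_square algebra_simps)
    then have "(\<integral>t. (\<bar>t - m\<bar>)\<^sup>2 \<partial>\<mu>) = (\<integral>t. t\<^sup>2 \<partial>\<mu>) - m\<^sup>2"
      using int1 int2 prob_space by (simp add: m_def[symmetric] power2_eq_square)
    also have "\<dots> \<le> (\<integral>t. t\<^sup>2 \<partial>\<mu>)" by simp
    also have "\<dots> \<le> R\<^sup>2"
    proof (rule integral_le_const[OF int2])
      show "AE t in \<mu>. t\<^sup>2 \<le> R\<^sup>2"
        using support by eventually_elim (metis abs_ge_zero power2_abs power_mono)
    qed
    finally show ?thesis .
  qed
  have D: "(\<integral>t. (cmod (r t - G))\<^sup>2 \<partial>\<mu>) = square_cauchy \<mu> z - (cmod G)\<^sup>2"
  proof -
    have "(cmod (r t - G))\<^sup>2 = (cmod (r t))\<^sup>2 - 2 * (Re (r t) * Re G + Im (r t) * Im G) + (cmod G)\<^sup>2" for t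
      unfolding cmod_power2 by (simp add: power2_eq_square algebra_simps)
    moreover have "integrable \<mu> (\<lambda>t. (cmod (r t))\<^sup>2)"
      unfolding r_def by (rule integrable_kernel_sq[OF z])
    moreover have "(\<integral>t. Re (r t) \<partial>\<mu>) = Re G" "(\<integral>t. Im (r t) \<partial>\<mu>) = Im G"
      unfolding Gr using intr by (auto intro!: integral_bounded_linear[OF bounded_linear_Re] integral_bounded_linear[OF bounded_linear_Im])
    moreover have "integrable \<mu> (\<lambda>t. Re (r t))" "integrable \<mu> (\<lambda>t. Im (r t))"
      using intr by auto
    ultimately show ?thesis
      using prob_space by (simp add: square_cauchy_def r_def[unfolded fun_eq_iff, rule_format, symmetric]
          cmod_power2[of G] power2_eq_square[of "Re G"] power2_eq_square[of "Im G"] del: norm_divide)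
  qed
  have kG: "k * G = (\<integral>t. complex_of_real (t - m) * (r t - G) \<partial>\<mu>)"
  proof -
    have "(\<integral>t. complex_of_real (t - m) * (r t - G) \<partial>\<mu>)
        = (\<integral>t. complex_of_real t * r t - m * r t - complex_of_real t * G + m * G \<partial>\<mu>)"
      by (simp add: algebra_simps)
    also have "\<dots> = (\<integral>t. complex_of_real t * r t \<partial>\<mu>) - m * G - m * G + m * G"
      using inttr intr int1c prob_space by (simp add: Gr[symmetric] m_def[symmetric])
    also have "(\<integral>t. complex_of_real t * r t \<partial>\<mu>) = z * G - 1"
      unfolding tr using intr prob_space by (simp add: Gr)
    finally show ?thesis using G0 by (simp add: k_def recip_cauchy_def G_def[symmetric] algebra_simps)
  qed
  have "(cmod k * cmod G)\<^sup>2 \<le> (\<integral>t. \<bar>t - m\<bar> * cmod (r t - G) \<partial>\<mu>)\<^sup>2"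
    unfolding norm_mult[symmetric] kG
    by (intro power_mono order_trans[OF integral_norm_bound]) (simp_all add: norm_mult flip: of_real_diff)
  also have "\<dots> \<le> (\<integral>t. (\<bar>t - m\<bar>)\<^sup>2 \<partial>\<mu>) * (\<integral>t. (cmod (r t - G))\<^sup>2 \<partial>\<mu>)"
  proof (rule Cauchy_Schwarz_integral)
    have "(\<lambda>t. (\<bar>t - m\<bar>)\<^sup>2) = (\<lambda>t. t\<^sup>2 - 2 * m * t + m\<^sup>2)"
      by (auto simp: power2_eq_square algebra_simps)
    then show "integrable \<mu> (\<lambda>t. (\<bar>t - m\<bar>)\<^sup>2)" using int1 int2 by simp
    have bd: "cmod (r t - G) \<le> 1 / Im z + cmod G" for t
      using norm_triangle_ineq4[of "r t" G] nr[of t] by linarith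
    have rm: "r \<in> borel_measurable borel" unfolding r_def by simp
    show "integrable \<mu> (\<lambda>t. (cmod (r t - G))\<^sup>2)"
      using power_mono[OF bd norm_ge_zero, of _ 2] rm
      by (intro integrable_bounded[where B="(1 / Im z + cmod G)\<^sup>2"]) auto
    have "integrable \<mu> (\<lambda>t. complex_of_real (t - m) * (r t - G))"
    proof -
      have "(\<lambda>t. complex_of_real (t - m) * (r t - G)) = (\<lambda>t. complex_of_real t * r t - m * r t - complex_of_real t * G + m * G)"
        by (auto simp: algebra_simps)
      then show ?thesis using inttr intr int1c by simp
    qed
    then show "integrable \<mu> (\<lambda>t. \<bar>t - m\<bar> * cmod (r t - G))"
      by (drule_tac integrable_norm) (simp add: norm_mult flip: of_real_diff)
  qed
  also have "\<dots> \<le> R\<^sup>2 * (square_cauchy \<mu> z - (cmod G)\<^sup>2)"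
    unfolding D[symmetric] by (intro mult_right_mono V) simp
  finally have "Im z * (cmod k * cmod G)\<^sup>2 \<le> Im z * (R\<^sup>2 * (square_cauchy \<mu> z - (cmod G)\<^sup>2))"
    using z by simp
  then have "Im z * ((cmod k)\<^sup>2 * (cmod G)\<^sup>2) \<le> R\<^sup>2 * (Im z * square_cauchy \<mu> z - Im z * (cmod G)\<^sup>2)"
    by (simp add: power_mult_distrib algebra_simps)
  also have "Im z * square_cauchy \<mu> z - Im z * (cmod G)\<^sup>2 = - Im k * (cmod G)\<^sup>2"
    using Im_recip_cauchy[OF z] by (simp add: k_def G_def algebra_simps)
  also have "R\<^sup>2 * (- Im k * (cmod G)\<^sup>2) \<le> R\<^sup>2 * (cmod k * (cmod G)\<^sup>2)"
    using abs_Im_le_cmod[of k] by (intro mult_left_mono mult_right_mono) auto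
  finally have "(cmod G)\<^sup>2 * (Im z * (cmod k)\<^sup>2) \<le> (cmod G)\<^sup>2 * (R\<^sup>2 * cmod k)" by (simp add: algebra_simps)
  then have "Im z * (cmod k)\<^sup>2 \<le> R\<^sup>2 * cmod k" using G0 by simp
  then have "cmod k \<le> R\<^sup>2 / Im z"
    using z by (cases "k = 0") (auto simp: power2_eq_square field_simps)
  moreover have "recip_cauchy \<mu> z - z = - k - m" by (simp add: k_def)
  moreover have "cmod (- k - m) \<le> cmod k + \<bar>m\<bar>"
    using norm_triangle_ineq4[of "-k" "complex_of_real m"] by simp
  ultimately show ?thesis using m_le by simp
qed

text \<open>Outside the disc of radius \<open>R\<close> the kernel is at most
  \<open>1 / (|z| - R)\<close>. Read backwards, a bound on \<open>F(w)\<close> confines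
  \<open>w\<close>; this supplies the convergent subsequence of subordination values.\<close>

lemma norm_le_recip_cauchy:
  assumes z: "0 < Im z" shows "cmod z \<le> cmod (recip_cauchy \<mu> z) + R"
proof (cases "cmod z \<le> R")
  case True
  then show ?thesis using norm_ge_zero[of "recip_cauchy \<mu> z"] by linarith
next
  case False
  have "cmod (cauchy_real \<mu> z) \<le> 1 / (cmod z - R)"
  proof (rule order_trans[OF norm_cauchy_le], rule integral_le_const[OF integrable_kernel_norm[OF z]])
    show "AE t in \<mu>. cmod (1 / (z - complex_of_real t)) \<le> 1 / (cmod z - R)"
      using support
    proof eventually_elim
      case (elim t)
      have "cmod z - R \<le> cmod (z - complex_of_real t)"
        using norm_triangle_ineq2[of z "complex_of_real t"] elim by simp
      then show ?case using False by (simp add: norm_divide frac_le)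
    qed
  qed
  then have "cmod z - R \<le> cmod (recip_cauchy \<mu> z)"
    using False cauchy_real_ne[OF z]
    by (simp add: recip_cauchy_def norm_inverse pos_le_divide_eq pos_divide_le_eq inverse_eq_divide mult.commute norm_divide)
  then show ?thesis by simp
qed

end

section \<open>Fixed points in the upper half plane\<close>

locale half_plane_perturbation =
  fixes h :: "complex \<Rightarrow> complex" and C :: real
  assumes holo: "h holomorphic_on {w. 0 < Im w}"
    and Im_nonneg: "0 < Im w \<Longrightarrow> 0 \<le> Im (h w)"
    and bound: "0 < Im w \<Longrightarrow> cmod (h w) \<le> C + C / Im w"
    and C_pos: "0 < C"
begin

text \<open>Cauchy's estimate on the disc of radius \<open>Im z / 2\<close> around \<open>z\<close>.
  There the imaginary part is at least 1, so \<open>|h| < 2 C + 1\<close> and the derivative is at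
  most \<open>2 (2 C + 1) / Im z\<close>, which is at most 1/2 once
  \<open>Im z \<ge> 8 C + 4\<close>.\<close>

lemma half_Lipschitz:
  assumes Y: "2 \<le> Y" "8 * C + 4 \<le> Y" and w: "Y \<le> Im w" "Y \<le> Im w'"
  shows "cmod (h w - h w') \<le> cmod (w - w') / 2"
proof -
  have "cmod (h w - h w') \<le> (1/2) * cmod (w - w')"
  proof (rule field_differentiable_bound[where S="{z. Y \<le> Im z}" and f'="deriv h"])
    show "convex {z. Y \<le> Im z}" by (rule convex_halfspace_Im_ge)
    fix z assume "z \<in> {z. Y \<le> Im z}"
    then have z: "Y \<le> Im z" by simp
    have Imball: "1 \<le> Im v" if "v \<in> cball z (Im z / 2)" for v
      using abs_Im_le_cmod[of "z - v"] that z Y by (simp add: dist_norm abs_if split: if_splits)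
    have sub: "cball z (Im z / 2) \<subseteq> {w. 0 < Im w}" using Imball by (auto dest!: Imball)
    have "0 < Im z" using z Y by simp
    then show "(h has_field_derivative deriv h z) (at z within {z. Y \<le> Im z})"
      using holo holomorphic_derivI[OF holo open_halfspace_Im_gt] has_field_derivative_at_within by blast
    have "cmod ((deriv ^^ 1) h z) \<le> fact 1 * (2 * C + 1) / (Im z / 2) ^ 1"
    proof (rule Cauchy_higher_deriv_bound[where y=0])
      show "h holomorphic_on ball z (Im z / 2)"
        by (rule holomorphic_on_subset[OF holo]) (use sub ball_subset_cball in blast)
      show "continuous_on (cball z (Im z / 2)) h"
        by (rule continuous_on_subset[OF holomorphic_on_imp_continuous_on[OF holo] sub])
      show "h v \<in> ball 0 (2 * C + 1)" if "v \<in> ball z (Im z / 2)" for v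
      proof -
        have v: "1 \<le> Im v" using Imball that by auto
        have "C / Im v \<le> C" using v C_pos by (simp add: divide_le_eq)
        then show ?thesis using bound[of v] v by simp
      qed
    qed (use \<open>0 < Im z\<close> in auto)
    also have "\<dots> \<le> 1/2" using \<open>0 < Im z\<close> z Y by (simp add: field_simps)
    finally show "cmod (deriv h z) \<le> 1/2" by simp
  qed (use w in auto)
  then show ?thesis by simp
qed

end

text \<open>The iterates of \<open>f z\<close> started at \<open>z\<close> satisfy a bound
  independent of \<open>n\<close> and continuous in \<open>z\<close>, because both perturbations are
  evaluated at height at least \<open>Im z\<close>; Montel's theorem then gives a limit along a
  subsequence. Such a limit need not be a fixed point by itself. High up, where \<open>f z\<close>
  is a contraction, it is one, and the identity theorem extends the equation to the whole half
  plane.\<close>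

lemma holomorphic_fixed_point:
  assumes "half_plane_perturbation h1 C" "half_plane_perturbation h2 C"
  obtains \<omega> where "\<omega> holomorphic_on {z. 0 < Im z}"
    "\<And>z. 0 < Im z \<Longrightarrow> Im z \<le> Im (\<omega> z)"
    "\<And>z. 0 < Im z \<Longrightarrow> \<omega> z = z + h2 (z + h1 (\<omega> z))"
proof -
  interpret h1: half_plane_perturbation h1 C by fact
  interpret h2: half_plane_perturbation h2 C by fact
  define U where "U = {z. 0 < Im z}"
  have U: "open U" "connected U"
    by (auto simp: U_def open_halfspace_Im_gt)
  define f where "f z w = z + h2 (z + h1 w)" for z w
  have inner_Im: "Im z \<le> Im (z + h1 w)" if "0 < Im w" for z w using h1.Im_nonneg[OF that] by simp
  have f_Im: "Im z \<le> Im (f z w)" if "0 < Im z" "0 < Im w" for z w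
    using h2.Im_nonneg[of "z + h1 w"] inner_Im[of w z] that by (simp add: f_def)
  have f_bound: "cmod (f z w) \<le> cmod z + (C + C / Im z)" if "0 < Im z" "0 < Im w" for z w
  proof -
    have "cmod (h2 (z + h1 w)) \<le> C + C / Im (z + h1 w)"
      using inner_Im[of w z] that by (intro h2.bound) auto
    also have "\<dots> \<le> C + C / Im z"
      using inner_Im[of w z] that h1.C_pos by (intro add_left_mono divide_left_mono) auto
    finally show ?thesis unfolding f_def using norm_triangle_ineq[of z "h2 (z + h1 w)"] by simp
  qed
  have f_holo: "(\<lambda>z. f z (g z)) holomorphic_on U"
    if g: "g holomorphic_on U" "\<And>z. z \<in> U \<Longrightarrow> Im z \<le> Im (g z)" for g
  proof -
    have gU: "g ` U \<subseteq> U" using g(2) by (force simp: U_def)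
    have 1: "(h1 \<circ> g) holomorphic_on U"
      by (rule holomorphic_on_compose_gen[OF g(1) h1.holo[folded U_def]]) (use gU in auto)
    then have 2: "(\<lambda>z. z + h1 (g z)) holomorphic_on U"
      by (auto intro!: holomorphic_intros simp: o_def)
    have "(h2 \<circ> (\<lambda>z. z + h1 (g z))) holomorphic_on U"
      by (rule holomorphic_on_compose_gen[OF 2 h2.holo[folded U_def]])
        (use inner_Im gU in \<open>force simp: U_def\<close>)
    then show ?thesis unfolding f_def by (auto intro!: holomorphic_intros simp: o_def)
  qed
  define it where "it n z = (f z ^^ n) z" for n z
  have it_0: "it 0 z = z" and it_Suc: "it (Suc n) z = f z (it n z)" for n z
    by (simp_all add: it_def)
  have it_Im: "Im z \<le> Im (it n z)" if "z \<in> U" for n z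
  proof (induction n)
    case (Suc n)
    then show ?case using f_Im[of z "it n z"] that by (simp add: it_Suc U_def)
  qed (simp add: it_0)
  have it_holo: "it n holomorphic_on U" for n
  proof (induction n)
    case 0
    then show ?case by (simp add: it_0[abs_def])
  next
    case (Suc n)
    then show ?case using f_holo[OF Suc it_Im] by (simp add: it_Suc[abs_def])
  qed
  have it_bound: "cmod (it n z) \<le> cmod z + (C + C / Im z)" if "z \<in> U" for n z
  proof (cases n)
    case 0
    then show ?thesis using that h1.C_pos by (simp add: it_0 U_def)
  next
    case (Suc m)
    then show ?thesis using f_bound[of z "it m z"] it_Im[OF that, of m] that by (simp add: it_Suc U_def)
  qed
  obtain \<omega> r where \<omega>: "\<omega> holomorphic_on U" and r: "strict_mono (r :: nat \<Rightarrow> nat)"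
    and lim: "\<And>z. z \<in> U \<Longrightarrow> (\<lambda>n. it (r n) z) \<longlonglongrightarrow> \<omega> z"
  proof (rule Montel[of U "range it" it])
    fix K assume K: "compact K" "K \<subseteq> U"
    have "continuous_on K (\<lambda>z. cmod z + (C + C / Im z))"
      using K by (intro continuous_intros) (auto simp: U_def)
    then have "bounded ((\<lambda>z. cmod z + (C + C / Im z)) ` K)"
      using K by (intro compact_imp_bounded compact_continuous_image)
    then obtain B where B: "norm (cmod z + (C + C / Im z)) \<le> B" if "z \<in> K" for z
      unfolding bounded_iff by auto
    have "cmod (it n z) \<le> B" if "z \<in> K" for n z
      using it_bound[of z n] B[OF that] that K by auto
    then have "\<forall>h\<in>range it. \<forall>z\<in>K. cmod (h z) \<le> B" by auto
    then show "\<exists>B. \<forall>h\<in>range it. \<forall>z\<in>K. cmod (h z) \<le> B" by blast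
  qed (use U it_holo in auto)
  have \<omega>_Im: "Im z \<le> Im (\<omega> z)" if "z \<in> U" for z
    by (rule tendsto_lowerbound[OF tendsto_Im[OF lim[OF that]]]) (use it_Im[OF that] in auto)
  define Y where "Y = max 2 (8 * C + 4)"
  have Y: "2 \<le> Y" "8 * C + 4 \<le> Y" by (auto simp: Y_def)
  have contr: "cmod (f z w - f z w') \<le> cmod (w - w') / 2" if "Y \<le> Im z" "Y \<le> Im w" "Y \<le> Im w'" for z w w'
  proof -
    have "cmod (f z w - f z w') \<le> cmod ((z + h1 w) - (z + h1 w')) / 2"
      using inner_Im[of w z] inner_Im[of w' z] that Y
        h2.half_Lipschitz[OF Y, of "z + h1 w" "z + h1 w'"] by (simp add: f_def)
    also have "\<dots> \<le> cmod (w - w') / 2"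
      using order_trans[OF h1.half_Lipschitz[OF Y that(2,3)], of "cmod (w - w')"] by simp
    finally show ?thesis .
  qed
  have fixed: "\<omega> z = f z (\<omega> z)" if "Y \<le> Im z" for z
  proof -
    have z: "z \<in> U" using that Y by (simp add: U_def)
    have ge: "Y \<le> Im (it n z)" for n using it_Im[OF z, of n] that by simp
    have small: "cmod (it (Suc n) z - it n z) \<le> (1/2) ^ n * cmod (f z z - z)" for n
    proof (induction n)
      case (Suc n)
      have "cmod (it (Suc (Suc n)) z - it (Suc n) z) \<le> cmod (it (Suc n) z - it n z) / 2"
        using contr[OF that ge[of "Suc n"] ge[of n]] by (simp add: it_Suc)
      then show ?case using Suc by simp
    qed (simp add: it_0 it_Suc)
    \<comment> \<open>Consecutive iterates approach each other, so the subsequence shifted by one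
      step has the same limit \<open>\<omega> z\<close>.\<close>
    have "(\<lambda>n. it (Suc n) z - it n z) \<longlonglongrightarrow> 0"
    proof (rule Lim_null_comparison)
      show "\<forall>\<^sub>F n in sequentially. cmod (it (Suc n) z - it n z) \<le> (1/2) ^ n * cmod (f z z - z)"
        using small by simp
      show "(\<lambda>n. (1/2) ^ n * cmod (f z z - z)) \<longlonglongrightarrow> 0"
        by (intro tendsto_mult_left_zero LIMSEQ_power_zero) simp
    qed
    from LIMSEQ_subseq_LIMSEQ[OF this r] have "(\<lambda>n. it (Suc (r n)) z - it (r n) z) \<longlonglongrightarrow> 0"
      by (simp add: o_def)
    from tendsto_add[OF this lim[OF z]] have 1: "(\<lambda>n. it (Suc (r n)) z) \<longlonglongrightarrow> \<omega> z" by simp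
    have "(\<lambda>n. it (Suc (r n)) z - f z (\<omega> z)) \<longlonglongrightarrow> 0"
    proof (rule Lim_null_comparison)
      show "\<forall>\<^sub>F n in sequentially. cmod (it (Suc (r n)) z - f z (\<omega> z)) \<le> cmod (it (r n) z - \<omega> z) / 2"
        using contr[OF that ge order_trans[OF that \<omega>_Im[OF z]]] by (simp add: it_Suc)
      show "(\<lambda>n. cmod (it (r n) z - \<omega> z) / 2) \<longlonglongrightarrow> 0"
        using tendsto_divide[OF tendsto_norm[OF tendsto_diff[OF lim[OF z] tendsto_const[of "\<omega> z"]]] tendsto_const[of 2]]
        by simp
    qed
    then have "(\<lambda>n. it (Suc (r n)) z) \<longlonglongrightarrow> f z (\<omega> z)" by (simp add: LIM_zero_iff)
    with 1 show ?thesis by (rule LIMSEQ_unique)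
  qed
  have "\<omega> z = f z (\<omega> z)" if "z \<in> U" for z
  proof (rule analytic_continuation_open[where s="{z. Y < Im z}" and s'=U and f=\<omega> and g="\<lambda>z. f z (\<omega> z)"])
    show "{z. Y < Im z} \<noteq> {}" using gt_ex[of Y] by (auto intro!: exI[of _ "Complex 0 (Y + 1)"])
    show "(\<lambda>z. f z (\<omega> z)) holomorphic_on U" by (rule f_holo[OF \<omega> \<omega>_Im])
  qed (use U \<omega> fixed that Y in \<open>auto simp: U_def open_halfspace_Im_gt\<close>)
  with \<omega> \<omega>_Im show thesis by (intro that[of \<omega>]) (auto simp: U_def f_def)
qed

section \<open>Atoms from subordination functions\<close>

context real_prob
begin

lemma shrinking_interval_measure:
  "(\<lambda>k. measure \<mu> {a - 1 / real (Suc k) .. a + 1 / real (Suc k)}) \<longlonglongrightarrow> measure \<mu> {a}"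
proof -
  have "(\<Inter>k. {a - 1 / real (Suc k) .. a + 1 / real (Suc k)}) = {a}"
  proof (intro equalityI subsetI)
    fix t assume t: "t \<in> (\<Inter>k. {a - 1 / real (Suc k) .. a + 1 / real (Suc k)})"
    have "\<bar>t - a\<bar> \<le> 1 / real (Suc k)" for k using t by (auto simp: abs_le_iff field_simps)
    then have "\<bar>t - a\<bar> \<le> 0"
      by (intro LIMSEQ_le_const[OF LIMSEQ_inverse_real_of_nat]) (auto simp: inverse_eq_divide)
    then show "t \<in> {a}" by simp
  qed auto
  moreover have "decseq (\<lambda>k. {a - 1 / real (Suc k) .. a + 1 / real (Suc k)})"
    by (rule decseq_SucI) (auto simp: field_simps)
  ultimately show ?thesis
    using finite_Lim_measure_decseq[of "\<lambda>k. {a - 1 / real (Suc k) .. a + 1 / real (Suc k)}"]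
    by (simp add: image_subset_iff)
qed

text \<open>The integral is split at the interval: inside, Cauchy--Schwarz applies; outside,
  \<open>t\<close> is farther than \<open>e\<close> from \<open>a\<close> while \<open>w\<close> is
  within \<open>e / 2\<close>, so the kernel is at most \<open>2 / e\<close>.\<close>

lemma cauchy_local_bound:
  assumes w: "0 < Im w" and e: "0 < e" "cmod (w - complex_of_real a) < e / 2"
  shows "cmod (cauchy_real \<mu> w) \<le> sqrt (measure \<mu> {a - e .. a + e}) * sqrt (square_cauchy \<mu> w) + 2 / e"
proof -
  define A where "A = {a - e .. a + e}"
  have A: "A \<in> sets borel" by (simp add: A_def)
  have int: "integrable \<mu> (\<lambda>t. indicator A t * cmod (1 / (w - complex_of_real t)))"
    using A norm_kernel_le[OF w] w
    by (intro integrable_bounded[where B="1 / Im w"]) (auto simp: indicator_def)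
  have "cmod (cauchy_real \<mu> w) \<le> (\<integral>t. cmod (1 / (w - complex_of_real t)) \<partial>\<mu>)" by (rule norm_cauchy_le)
  also have "\<dots> \<le> (\<integral>t. indicator A t * cmod (1 / (w - complex_of_real t)) + 2 / e \<partial>\<mu>)"
  proof (rule integral_mono[OF integrable_kernel_norm[OF w]])
    show "cmod (1 / (w - complex_of_real t)) \<le> indicator A t * cmod (1 / (w - complex_of_real t)) + 2 / e" for t
    proof (cases "t \<in> A")
      case False
      then have "e < cmod (complex_of_real (t - a))" using e by (auto simp: A_def abs_if simp del: of_real_diff)
      then have "e / 2 \<le> cmod (w - complex_of_real t)"
        using e(2) norm_triangle_ineq[of "w - complex_of_real t" "complex_of_real a - w"]
          norm_minus_commute[of w "complex_of_real a"] norm_minus_commute[of "complex_of_real a" "complex_of_real t"]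
        by simp
      then have "1 / cmod (w - complex_of_real t) \<le> 1 / (e / 2)" using e by (intro frac_le) auto
      then show ?thesis using False by (simp add: norm_divide)
    qed (use e in simp)
  qed (use int in simp)
  also have "\<dots> = (\<integral>t. indicator A t * cmod (1 / (w - complex_of_real t)) \<partial>\<mu>) + 2 / e"
    using int prob_space by simp
  also have "(\<integral>t. indicator A t * cmod (1 / (w - complex_of_real t)) \<partial>\<mu>) \<le> sqrt (measure \<mu> A * square_cauchy \<mu> w)"
    using set_kernel_bound[OF w A] by (rule real_le_rsqrt)
  finally show ?thesis by (simp add: A_def real_sqrt_mult)
qed

text \<open>By \<open>Im_recip_cauchy\<close> the quotient is the ratio of \<open>|G|\<^sup>2\<close> to the integral of the squared
  kernel, and Cauchy--Schwarz localised near the limit point bounds it by the mass there.\<close>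

lemma Im_quotient_le_atom:
  assumes w: "\<And>n. 0 < Im (w n)" "w \<longlonglongrightarrow> complex_of_real a"
    and F: "(\<lambda>n. recip_cauchy \<mu> (w n)) \<longlonglongrightarrow> 0" and e: "0 < e"
  obtains b where "b \<longlonglongrightarrow> measure \<mu> {a - e .. a + e}"
    "\<forall>\<^sub>F n in sequentially. Im (w n) / Im (recip_cauchy \<mu> (w n)) \<le> b n"
proof -
  define m where "m = measure \<mu> {a - e .. a + e}"
  \<comment> \<open>A convergent majorant stands in for a limit superior. It arises on dividing
    \<open>cauchy_local_bound\<close> by \<open>sqrt D\<close> and replacing
    \<open>1 / sqrt D\<close> by the larger \<open>1 / g = |F|\<close>, which tends to 0.\<close>
  define b where "b n = (sqrt m + 2 / e * cmod (recip_cauchy \<mu> (w n)))\<^sup>2" for n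
  have "b \<longlonglongrightarrow> (sqrt m + 2 / e * 0)\<^sup>2"
    unfolding b_def using tendsto_norm_zero[OF F] by (intro tendsto_intros)
  then have "b \<longlonglongrightarrow> m" by (simp add: m_def)
  moreover have "\<forall>\<^sub>F n in sequentially. cmod (w n - complex_of_real a) < e / 2"
    using tendstoD[OF w(2), of "e / 2"] e by (simp add: dist_norm)
  then have "\<forall>\<^sub>F n in sequentially. Im (w n) / Im (recip_cauchy \<mu> (w n)) \<le> b n"
  proof eventually_elim
    case (elim n)
    define D where "D = square_cauchy \<mu> (w n)"
    define g where "g = cmod (cauchy_real \<mu> (w n))"
    have D: "0 < D" unfolding D_def by (rule square_cauchy_pos[OF w(1)])
    have g: "0 < g" unfolding g_def using cauchy_real_ne[OF w(1)] by simp
    have gD: "g \<le> sqrt D" unfolding g_def D_def using cauchy_sq_le[OF w(1)] by (rule real_le_rsqrt)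
    have Fpos: "0 < Im (recip_cauchy \<mu> (w n))" using Im_recip_ge[OF w(1)[of n]] w(1)[of n] by simp
    have "g \<le> sqrt m * sqrt D + 2 / e"
      unfolding g_def m_def D_def by (rule cauchy_local_bound[OF w(1) e elim])
    then have "g / sqrt D \<le> sqrt m + 2 / e * (1 / sqrt D)" using D by (simp add: field_simps)
    also have "\<dots> \<le> sqrt m + 2 / e * (1 / g)"
      using gD g D e by (intro add_left_mono mult_left_mono divide_left_mono) auto
    also have "1 / g = cmod (recip_cauchy \<mu> (w n))"
      by (simp add: g_def recip_cauchy_def norm_inverse inverse_eq_divide norm_divide)
    finally have "(g / sqrt D)\<^sup>2 \<le> b n"
      unfolding b_def using g D by (intro power_mono) auto
    moreover have "(g / sqrt D)\<^sup>2 = Im (w n) / Im (recip_cauchy \<mu> (w n))"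
      using Im_recip_cauchy[OF w(1)[of n]] D Fpos
      by (simp add: power_divide D_def[symmetric] g_def[symmetric] field_simps)
    ultimately show ?case by simp
  qed
  ultimately show thesis by (intro that) (simp_all add: m_def)
qed

end

context compact_real_prob
begin

lemma half_plane_perturbation_recip:
  assumes "R \<le> C" "R\<^sup>2 \<le> C" "0 < C"
  shows "half_plane_perturbation (\<lambda>w. recip_cauchy \<mu> w - w) C"
proof
  show "(\<lambda>w. recip_cauchy \<mu> w - w) holomorphic_on {w. 0 < Im w}"
    by (intro holomorphic_intros recip_cauchy_holomorphic)
  fix w assume w: "0 < Im w"
  show "0 \<le> Im (recip_cauchy \<mu> w - w)" using Im_recip_ge[OF w] by simp
  have "R\<^sup>2 / Im w \<le> C / Im w" using assms w by (simp add: divide_right_mono)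
  then show "cmod (recip_cauchy \<mu> w - w) \<le> C + C / Im w"
    using recip_cauchy_near_identity[OF w] assms by simp
qed fact

end

text \<open>The subordination functions converge along a subsequence to real points \<open>a\<close> and \<open>x - a\<close>,
  and the imaginary parts in \<open>\<omega>1 + \<omega>2 = z + F(z)\<close> are compared after division by \<open>Im (F z)\<close>.\<close>

lemma atoms_of_subordination:
  assumes "compact_real_prob \<mu>1 R1" "compact_real_prob \<mu>2 R2"
    and z: "\<And>n. 0 < Im (z n)" "z \<longlonglongrightarrow> complex_of_real x"
    and w1: "\<And>n. 0 < Im (w1 n)" and w2: "\<And>n. 0 < Im (w2 n)"
    and F1: "\<And>n. recip_cauchy \<mu>1 (w1 n) = F n" and F2: "\<And>n. recip_cauchy \<mu>2 (w2 n) = F n"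
    and sum: "\<And>n. w1 n + w2 n = z n + F n" and F: "F \<longlonglongrightarrow> 0"
  shows "\<exists>a b. a + b = x \<and> 1 \<le> measure \<mu>1 {a} + measure \<mu>2 {b}"
proof -
  interpret m1: compact_real_prob \<mu>1 R1 by fact
  interpret m2: compact_real_prob \<mu>2 R2 by fact
  have "Bseq F" using F by (intro convergent_imp_Bseq convergentI)
  then obtain K where K: "cmod (F n) \<le> K" for n by (auto simp: Bseq_def)
  have "cmod (w1 n) \<le> K + R1" for n
    using m1.norm_le_recip_cauchy[OF w1[of n]] K[of n] by (simp add: F1)
  then have "bounded (range w1)" by (auto simp: bounded_iff)
  then obtain l r where r: "strict_mono (r :: nat \<Rightarrow> nat)" and l: "(w1 \<circ> r) \<longlonglongrightarrow> l"
    using bounded_imp_convergent_subsequence by blast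
  note sub = LIMSEQ_subseq_LIMSEQ[OF _ r, unfolded o_def]
  note l = l[unfolded o_def]
  have l2: "(\<lambda>n. w2 (r n)) \<longlonglongrightarrow> complex_of_real x - l"
  proof -
    have "w2 n = z n + F n - w1 n" for n using sum[of n] by (simp add: algebra_simps)
    then show ?thesis
      using tendsto_diff[OF tendsto_add[OF sub[OF z(2)] sub[OF F]] l] by simp
  qed
  \<comment> \<open>The limits of \<open>w1\<close> and \<open>w2\<close> both lie in the closed
    upper half plane and add up to the real number \<open>x\<close>, so both are real.\<close>
  have "0 \<le> Im l"
    by (rule tendsto_lowerbound[OF tendsto_Im[OF l]]) (simp_all add: less_imp_le[OF w1])
  moreover have "0 \<le> Im (complex_of_real x - l)"
    by (rule tendsto_lowerbound[OF tendsto_Im[OF l2]]) (simp_all add: less_imp_le[OF w2])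
  ultimately have "Im l = 0" by simp
  define a where "a = Re l"
  define b where "b = x - a"
  have la: "l = complex_of_real a" "complex_of_real x - l = complex_of_real b"
    using \<open>Im l = 0\<close> by (simp_all add: a_def b_def complex_eq_iff)
  \<comment> \<open>The order of limits matters: \<open>e\<close> stays fixed while \<open>n\<close>
    tends to infinity, and only afterwards do the intervals shrink to points.\<close>
  have local: "1 \<le> measure \<mu>1 {a - e .. a + e} + measure \<mu>2 {b - e .. b + e}" if e: "0 < e" for e
  proof -
    obtain b1 where b1: "b1 \<longlonglongrightarrow> measure \<mu>1 {a - e .. a + e}"
      "\<forall>\<^sub>F n in sequentially. Im (w1 (r n)) / Im (F (r n)) \<le> b1 n"
      using m1.Im_quotient_le_atom[OF w1 l[unfolded la(1)] _ e] sub[OF F] by (auto simp: F1)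
    obtain b2 where b2: "b2 \<longlonglongrightarrow> measure \<mu>2 {b - e .. b + e}"
      "\<forall>\<^sub>F n in sequentially. Im (w2 (r n)) / Im (F (r n)) \<le> b2 n"
      using m2.Im_quotient_le_atom[OF w2 l2[unfolded la(2)] _ e] sub[OF F] by (auto simp: F2)
    have "\<forall>\<^sub>F n in sequentially. 1 \<le> b1 n + b2 n"
      using b1(2) b2(2)
    proof eventually_elim
      case (elim n)
      have pos: "0 < Im (F (r n))"
        using m1.Im_recip_ge[OF w1[of "r n"]] w1[of "r n"] by (simp add: F1)
      have "Im (w1 (r n)) + Im (w2 (r n)) = Im (z (r n)) + Im (F (r n))"
        using arg_cong[OF sum[of "r n"], of Im] by simp
      then have "1 \<le> (Im (w1 (r n)) + Im (w2 (r n))) / Im (F (r n))"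
        using z(1)[of "r n"] pos by (simp add: field_simps)
      then show ?case using elim by (simp add: add_divide_distrib)
    qed
    then show ?thesis by (intro tendsto_lowerbound[OF tendsto_add[OF b1(1) b2(1)]]) auto
  qed
  have "1 \<le> measure \<mu>1 {a} + measure \<mu>2 {b}"
    by (rule tendsto_lowerbound[OF tendsto_add[OF m1.shrinking_interval_measure m2.shrinking_interval_measure]])
      (use local in auto)
  then show ?thesis by (intro exI[of _ a] exI[of _ b]) (simp add: b_def)
qed

section \<open>Bounded states and free elements\<close>

lemma norm_star: "norm (star x) = norm (x :: 'a::cstar_algebra)"
proof -
  have le: "norm y \<le> norm (star y)" for y :: 'a
  proof (cases "y = 0")
    case False
    have "norm y * norm y \<le> norm (star y) * norm y"
      using norm_star_mult_self[of y] norm_mult_ineq[of "star y" y] by (simp add: power2_eq_square)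
    then show ?thesis using False by simp
  qed simp
  show ?thesis using le[of x] le[of "star x"] by (simp add: star_star)
qed

lemma star_one: "star 1 = (1 :: 'a::cstar_algebra)"
  using star_mult[of "star 1" "1 :: 'a"] by (simp add: star_star)

lemma star_diff: "star (x - y) = star x - star (y :: 'a::cstar_algebra)"
  using star_add[of "x - y" y] by (simp add: algebra_simps)

lemma star_scaleR: "star (r *\<^sub>R x) = r *\<^sub>R star (x :: 'a::cstar_algebra)"
  by (simp add: scaleR_eq_scaleC star_scaleC)

lemma bounded_linear_star: "bounded_linear (star :: 'a::cstar_algebra \<Rightarrow> 'a)"
  by (rule bounded_linear_intro[where K=1]) (simp_all add: star_add star_scaleR norm_star)

text \<open>The equation \<open>(1 - y)^2 = 1 - h\<close> is equivalent to
  \<open>y = (h + y^2) / 2\<close>, whose right-hand side is a contraction of a small ball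
  preserving self-adjointness.\<close>

lemma self_adjoint_sqrt:
  fixes h :: "'a::cstar_algebra"
  assumes h: "star h = h" "norm h < 1"
  obtains b where "star b = b" "b * b = 1 - h"
proof -
  \<comment> \<open>The smaller root of \<open>(norm h + r^2) / 2 = r\<close>: the ball of radius
    \<open>r\<close> is mapped into itself, and \<open>r\<close> is also the Lipschitz constant
    there.\<close>
  define r where "r = 1 - sqrt (1 - norm h)"
  have r: "0 \<le> r" "r < 1" "(norm h + r * r) / 2 = r"
    using h(2) by (simp_all add: r_def field_simps)
  define f where "f y = (1/2) *\<^sub>R (h + y * y)" for y :: 'a
  define S where "S = {y :: 'a. norm y \<le> r \<and> star y = y}"
  have "\<exists>!y. y \<in> S \<and> f y = y"
  proof (rule Banach_fix[where c=r])
    have "continuous_on UNIV (star :: 'a \<Rightarrow> 'a)"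
      by (rule linear_continuous_on[OF bounded_linear_star])
    then have "closed S" unfolding S_def
      by (intro closed_Collect_conj closed_Collect_le closed_Collect_eq continuous_intros)
    then show "complete S" by (simp add: complete_eq_closed)
    have "star 0 = (0::'a)" using star_diff[of 0 "0::'a"] by simp
    then show "S \<noteq> {}" using r by (auto simp: S_def intro!: exI[of _ 0])
    show "f ` S \<subseteq> S"
    proof
      fix v assume "v \<in> f ` S"
      then obtain y where y: "y \<in> S" "v = f y" by auto
      have "norm (h + y * y) \<le> norm h + r * r"
        using norm_triangle_ineq[of h "y * y"] norm_mult_ineq[of y y] mult_mono[of "norm y" r "norm y" r] y r
        by (auto simp: S_def)
      then show "v \<in> S" using y r(3) by (simp add: S_def f_def star_scaleR star_add star_mult h)
    qed
    show "dist (f x) (f y) \<le> r * dist x y" if "x \<in> S" "y \<in> S" for x y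
    proof -
      have "f x - f y = (1/2) *\<^sub>R (x * (x - y) + (x - y) * y)"
        by (simp add: f_def algebra_simps)
      then have "norm (f x - f y) = (1/2) * norm (x * (x - y) + (x - y) * y)" by simp
      also have "\<dots> \<le> (1/2) * (norm x * norm (x - y) + norm (x - y) * norm y)"
        by (intro mult_left_mono order_trans[OF norm_triangle_ineq] add_mono norm_mult_ineq) simp
      also have "\<dots> \<le> (1/2) * (r * norm (x - y) + norm (x - y) * r)"
        using that by (intro mult_left_mono add_mono mult_right_mono) (auto simp: S_def)
      finally show ?thesis by (simp add: dist_norm)
    qed
  qed (use r in auto)
  then obtain y where y: "star y = y" "f y = y" by (auto simp: S_def)
  have "2 *\<^sub>R f y = h + y * y" by (simp add: f_def)
  then have "y + y = h + y * y" using y(2) by (simp add: scaleR_2)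
  then have "(1 - y) * (1 - y) = 1 - h" by (simp add: algebra_simps)
  moreover have "star (1 - y) = 1 - y" by (simp add: star_diff star_one y)
  ultimately show thesis by (intro that)
qed

text \<open>For self-adjoint \<open>h\<close> with norm below 1, \<open>1 - h\<close> is the square
  of a self-adjoint element, so positivity gives \<open>Re (\<phi> h) \<le> 1\<close>, and likewise
  for \<open>- h\<close>. In the constant 4 one factor 2 comes from rescaling to norm 1/2, the other
  from splitting into real and imaginary parts. Boundedness lets \<phi> act termwise on resolvent
  series.\<close>

lemma faithful_state_bounded_linear:
  assumes \<phi>: "faithful_state (\<phi> :: 'a::cstar_algebra \<Rightarrow> complex)"
  shows "bounded_linear \<phi>"
proof -
  have lin: "clinear \<phi>" and one: "\<phi> 1 = 1"
    and pos: "\<And>x. Im (\<phi> (star x * x)) = 0" "\<And>x. 0 \<le> Re (\<phi> (star x * x))"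
    using \<phi> by (auto simp: faithful_state_def)
  interpret \<phi>: Vector_Spaces.linear scaleC scaleC \<phi> by (rule lin)
  have scaleR: "\<phi> (r *\<^sub>R x) = r *\<^sub>R \<phi> x" for r x
    by (simp add: scaleR_eq_scaleC \<phi>.scale scaleC_complex_def scaleR_conv_of_real)
  have half: "Im (\<phi> h) = 0 \<and> Re (\<phi> h) \<le> 1" if h: "star h = h" "norm h < 1" for h
  proof -
    obtain b where "star b = b" "b * b = 1 - h" using self_adjoint_sqrt[OF h] .
    then show ?thesis using pos[of b] by (simp add: \<phi>.diff one)
  qed
  have unit: "cmod (\<phi> h) \<le> 1" if "star h = h" "norm h < 1" for h
  proof -
    have "star (- h) = - h" using star_diff[of 0 h] star_diff[of 0 "0::'a"] that by simp
    then have "- Re (\<phi> h) \<le> 1" using half[of "- h"] that by (simp add: \<phi>.neg)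
    with half[OF that] show ?thesis by (simp add: cmod_def abs_le_iff)
  qed
  have sa: "cmod (\<phi> h) \<le> 2 * norm h" if "star h = h" for h
  proof (cases "h = 0")
    case False
    define s where "s = 1 / (2 * norm h)"
    have s: "s > 0" using False by (simp add: s_def)
    have "cmod (\<phi> (s *\<^sub>R h)) \<le> 1"
      using False that by (intro unit) (simp_all add: star_scaleR s_def)
    then have "s * cmod (\<phi> h) \<le> 1" using s by (simp add: scaleR)
    then show ?thesis using False by (simp add: s_def field_simps)
  qed (simp add: \<phi>.zero)
  have "cmod (\<phi> x) \<le> norm x * 4" for x
  proof -
    define h k where "h = (1/2) *\<^sub>R (x + star x)" and "k = (\<i> / 2) *\<^sub>C (x - star x)"
    have "h = (1/2) *\<^sub>C x + (1/2) *\<^sub>C star x"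
      by (simp add: h_def scaleR_eq_scaleC scaleC_add_right)
    moreover have "(- \<i>) *\<^sub>C k = (1/2) *\<^sub>C x - (1/2) *\<^sub>C star x"
      by (simp add: k_def scaleC_scaleC complex_vector.scale_right_diff_distrib)
    moreover have "(1/2) *\<^sub>C x + (1/2) *\<^sub>C x = x"
      by (simp add: scaleC_one flip: scaleC_add_left)
    ultimately have x: "x = h + (- \<i>) *\<^sub>C k" by (simp add: algebra_simps)
    have "star h = h" by (simp add: h_def star_scaleR star_add star_star add.commute)
    moreover have "star k = k"
      by (simp add: k_def star_scaleC star_diff star_star complex_vector.scale_right_diff_distrib)
    moreover have "norm h \<le> norm x"
      using norm_triangle_ineq[of x "star x"] by (simp add: h_def norm_star)
    moreover have "norm k \<le> norm x"
      using norm_triangle_ineq4[of x "star x"] by (simp add: k_def norm_star norm_scaleC norm_divide)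
    moreover have "cmod (\<phi> x) \<le> cmod (\<phi> h) + cmod (\<phi> k)"
      using norm_triangle_ineq4[of "\<phi> h" "\<i> * \<phi> k"]
      by (subst x) (simp add: \<phi>.diff \<phi>.scale scaleC_complex_def norm_mult)
    ultimately show ?thesis using sa[of h] sa[of k] by simp
  qed
  then show ?thesis
    by (intro bounded_linear_intro[where K=4]) (simp_all add: \<phi>.add scaleR)
qed

section \<open>Freeness, and operators that produce it\<close>

definition centred_power :: "('a::cstar_algebra \<Rightarrow> complex) \<Rightarrow> 'a \<Rightarrow> nat \<Rightarrow> 'a" where
  "centred_power \<phi> a n = a ^ n - \<phi> (a ^ n) *\<^sub>C 1"

text \<open>Freeness of the unital algebras generated by \<open>c True\<close> and
  \<open>c False\<close>: when \<phi> is linear and unital, a polynomial in \<open>c i\<close> of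
  expectation 0 is a combination of centred powers, so alternating products of these suffice by
  multilinearity.\<close>

definition free_elements :: "('a::cstar_algebra \<Rightarrow> complex) \<Rightarrow> (bool \<Rightarrow> 'a) \<Rightarrow> bool" where
  "free_elements \<phi> c \<longleftrightarrow>
     (\<forall>ps. ps \<noteq> [] \<longrightarrow> successively (\<noteq>) (map fst ps) \<longrightarrow>
        \<phi> (prod_list (map (\<lambda>p. centred_power \<phi> (c (fst p)) (snd p)) ps)) = 0)"

lemma scaleC_zero_left: "0 *\<^sub>C x = (0 :: 'v::complex_vector)"
  by (rule complex_vector.scale_zero_left)

lemma scaleC_diff_right: "k *\<^sub>C (x - y) = k *\<^sub>C x - k *\<^sub>C (y :: 'v::complex_vector)"
  by (rule complex_vector.scale_right_diff_distrib)

text \<open>On \<open>S i\<close> the powers of \<open>A i\<close> act as they do on the vacuum. The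
  scalar \<open>k i n\<close> must be the moment of \<open>c i ^ n\<close>, as seen on
  \<open>\<xi>\<close>, so centring removes it and sends \<open>S i\<close> into the part of
  \<open>S (\<not> i)\<close> killed by \<open>vac\<close>. In an alternating product, read from the
  right, each factor thus meets a vector of the set it needs.\<close>

lemma free_elements_of_operators:
  fixes \<phi> :: "'a::cstar_algebra \<Rightarrow> complex" and A :: "bool \<Rightarrow> 'v \<Rightarrow> 'v::complex_vector"
  assumes \<phi>: "clinear \<phi>" and A: "\<And>i. clinear (A i)" and vac: "clinear vac"
    and \<xi>: "\<And>i. \<xi> \<in> S i" "vac \<xi> = 1"
    and step: "\<And>i n v. v \<in> S i \<Longrightarrow> \<exists>v'\<in>S (\<not> i). (A i ^^ n) v = k i n *\<^sub>C v + v' \<and> vac v' = 0"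
    and moments: "\<And>js. \<phi> (prod_list (map c js)) = vac (foldr A js \<xi>)"
  shows "free_elements \<phi> c"
  unfolding free_elements_def
proof (intro allI impI)
  interpret \<phi>: Vector_Spaces.linear scaleC scaleC \<phi> by fact
  interpret vac: Vector_Spaces.linear scaleC scaleC vac by fact
  define Cop where "Cop p v = (A (fst p) ^^ snd p) v - \<phi> (c (fst p) ^ snd p) *\<^sub>C v" for p v
  let ?P = "\<lambda>ps. prod_list (map (\<lambda>p. centred_power \<phi> (c (fst p)) (snd p)) ps)"
  have foldr_A: "clinear (foldr A js)" for js
  proof (induction js)
    case Nil
    then show ?case by (intro clinearI) auto
  next
    case (Cons j js)
    then show ?case
      by (intro clinearI) (simp_all add: clinear_add[OF Cons] clinear_add[OF A]
          clinear_scaleC[OF Cons] clinear_scaleC[OF A])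
  qed
  \<comment> \<open>The plain prefix \<open>js\<close> makes the induction work: expanding the
    leftmost centred factor leaves a pure power, which joins the prefix.\<close>
  have transport: "\<phi> (prod_list (map c js) * ?P ps) = vac (foldr A js (foldr Cop ps \<xi>))" for js ps
  proof (induction ps arbitrary: js)
    case Nil
    then show ?case by (simp add: moments)
  next
    case (Cons p ps)
    interpret J: Vector_Spaces.linear scaleC scaleC "foldr A js" by (rule foldr_A)
    obtain i n where p: "p = (i, n)" by (cases p)
    have pow: "prod_list (map c (js @ replicate n i)) = prod_list (map c js) * c i ^ n"
      by (simp add: prod_list_replicate)
    have "prod_list (map c js) * ?P (p # ps)
        = prod_list (map c (js @ replicate n i)) * ?P ps - \<phi> (c i ^ n) *\<^sub>C (prod_list (map c js) * ?P ps)"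
      unfolding pow by (simp add: p centred_power_def algebra_simps mult_scaleC_left mult_scaleC_right)
    then have "\<phi> (prod_list (map c js) * ?P (p # ps))
        = vac (foldr A (js @ replicate n i) (foldr Cop ps \<xi>)) - \<phi> (c i ^ n) * vac (foldr A js (foldr Cop ps \<xi>))"
      by (simp add: \<phi>.diff \<phi>.scale scaleC_complex_def Cons.IH del: map_append)
    also have "\<dots> = vac (foldr A js (foldr Cop (p # ps) \<xi>))"
      by (simp add: p Cop_def foldr_replicate J.diff J.scale vac.diff vac.scale scaleC_complex_def)
    finally show ?case .
  qed
  have mom: "\<phi> (c i ^ n) = k i n" for i n
  proof -
    obtain v' where "(A i ^^ n) \<xi> = k i n *\<^sub>C \<xi> + v'" "vac v' = 0" using step[OF \<xi>(1)[of i]] by blast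
    then show ?thesis
      using moments[of "replicate n i"]
      by (simp add: prod_list_replicate foldr_replicate vac.add vac.scale \<xi>(2) scaleC_complex_def)
  qed
  fix ps :: "(bool \<times> nat) list" assume "ps \<noteq> []" "successively (\<noteq>) (map fst ps)"
  then have "foldr Cop ps \<xi> \<in> S (\<not> fst (hd ps)) \<and> vac (foldr Cop ps \<xi>) = 0"
  proof (induction ps)
    case (Cons p ps)
    obtain i n where p: "p = (i, n)" by (cases p)
    have "foldr Cop ps \<xi> \<in> S i"
    proof (cases ps)
      case (Cons q qs)
      then show ?thesis using Cons.IH Cons.prems by (auto simp: p)
    qed (use \<xi> in simp)
    from step[OF this, of n] obtain v' where v': "v' \<in> S (\<not> i)" "vac v' = 0"
      "(A i ^^ n) (foldr Cop ps \<xi>) = k i n *\<^sub>C foldr Cop ps \<xi> + v'" by blast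
    have "Cop p v = v'" if "(A i ^^ n) v = k i n *\<^sub>C v + v'" for v
      using that by (simp add: Cop_def p mom)
    then show ?case using v' by (simp add: p)
  qed simp
  then show "\<phi> (?P ps) = 0" using transport[of "[]" ps] by simp
qed

section \<open>Left and right operators acting on tensor words\<close>

lemma tensor_word_zero_letter:
  "tensor_word (us @ Inl 0 # vs) = (0 :: ('u::complex_vector, 'v::complex_vector) free_product)"
  "tensor_word (us @ Inr 0 # vs) = (0 :: ('u, 'v) free_product)"
proof -
  have "tensor_word (us @ Inl (0 *\<^sub>C 0) # vs) = 0 *\<^sub>C (tensor_word (us @ Inl 0 # vs) :: ('u, 'v) free_product)"
    "tensor_word (us @ Inr (0 *\<^sub>C 0) # vs) = 0 *\<^sub>C (tensor_word (us @ Inr 0 # vs) :: ('u, 'v) free_product)"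
    using multilinear_tensor_word[where 'u='u and 'v='v] unfolding multilinear_on_words_def by blast+
  then show "tensor_word (us @ Inl 0 # vs) = (0 :: ('u, 'v) free_product)"
    "tensor_word (us @ Inr 0 # vs) = (0 :: ('u, 'v) free_product)"
    by (simp_all add: scaleC_zero_left)
qed

lemma multilinear_tensor_word_prepend:
  "multilinear_on_words (\<lambda>w. tensor_word (l # w) :: ('u::complex_vector, 'v::complex_vector) free_product)"
proof -
  note m = multilinear_tensor_word[where 'u='u and 'v='v, unfolded multilinear_on_words_def]
  have "\<not> alternating w \<Longrightarrow> \<not> alternating (l # w)" for w
    by (auto simp: alternating_def successively_Cons)
  then show ?thesis
    using m unfolding multilinear_on_words_def append_Cons[symmetric] by blast
qed

lemma multilinear_tensor_word_append:
  "multilinear_on_words (\<lambda>w. tensor_word (w @ [l]) :: ('u::complex_vector, 'v::complex_vector) free_product)"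
proof -
  note m = multilinear_tensor_word[where 'u='u and 'v='v, unfolded multilinear_on_words_def]
  have "\<not> alternating w \<Longrightarrow> \<not> alternating (w @ [l])" for w
    by (auto simp: alternating_def successively_append_iff)
  then show ?thesis
    using m unfolding multilinear_on_words_def append_assoc append_Cons by blast
qed

lemma left_tensor_tensor_word:
  "left_tensor e x (tensor_word w) = fst x *\<^sub>C tensor_word w + tensor_word (e (snd x) # w)"
  by (simp add: left_tensor_def extend_words_tensor_word multilinear_tensor_word_prepend)

lemma right_tensor_tensor_word:
  "right_tensor e (tensor_word w) x = fst x *\<^sub>C tensor_word w + tensor_word (w @ [e (snd x)])"
  by (simp add: right_tensor_def extend_words_tensor_word multilinear_tensor_word_append)

text \<open>The defining relation moves only \<open>x\<close> and keeps \<open>p\<close>, so it can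
  be iterated. With unique existence as a hypothesis, the statement covers both embeddings.\<close>

lemma left_rep_power:
  fixes e :: "'w \<Rightarrow> 'u::complex_vector + 'v::complex_vector"
  assumes ex1: "\<exists>!L. clinear L \<and> (\<forall>x. \<forall>p\<in>left_space e. L (left_tensor e x p) = left_tensor e (T x) p)"
  shows "clinear (left_rep e T)"
    and "p \<in> left_space e \<Longrightarrow> (left_rep e T ^^ n) (left_tensor e x p) = left_tensor e ((T ^^ n) x) p"
proof -
  note spec = theI'[OF ex1, folded left_rep_def]
  show "clinear (left_rep e T)" using spec by blast
  show "(left_rep e T ^^ n) (left_tensor e x p) = left_tensor e ((T ^^ n) x) p" if "p \<in> left_space e"
    using spec that by (induction n) (simp_all del: split_paired_All)
qed

lemma right_rep_power:
  fixes e :: "'w \<Rightarrow> 'u::complex_vector + 'v::complex_vector"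
  assumes ex1: "\<exists>!L. clinear L \<and> (\<forall>x. \<forall>p\<in>right_space e. L (right_tensor e p x) = right_tensor e p (T x))"
  shows "clinear (right_rep e T)"
    and "p \<in> right_space e \<Longrightarrow> (right_rep e T ^^ n) (right_tensor e p x) = right_tensor e p ((T ^^ n) x)"
proof -
  note spec = theI'[OF ex1, folded right_rep_def]
  show "clinear (right_rep e T)" using spec by blast
  show "(right_rep e T ^^ n) (right_tensor e p x) = right_tensor e p ((T ^^ n) x)" if "p \<in> right_space e"
    using spec that by (induction n) (simp_all del: split_paired_All)
qed

lemma foldr_comp_apply: "foldr (\<circ>) (map A js) id v = foldr A js v"
  by (induction js) auto

lemma vacuum_coefficient:
  "clinear (extend_words (\<lambda>w. if w = [] then 1 else 0) :: ('u::complex_vector, 'v::complex_vector) free_product \<Rightarrow> complex)"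
  "extend_words (\<lambda>w. if w = [] then 1 else (0::complex)) (tensor_word w :: ('u, 'v) free_product) = (if w = [] then 1 else 0)"
  by (rule clinear_extend_words[OF multilinear_vacuum_coeff])
    (rule extend_words_tensor_word[OF multilinear_vacuum_coeff])

text \<open>Here \<open>S i\<close> consists of the tensor words that do not begin with a letter of
  face \<open>i\<close>. A power of the operator of face \<open>i\<close> either keeps such a word,
  with the coefficient of the state vector in \<open>T^n (1, 0)\<close>, or puts one letter of that
  face in front, which lands in \<open>S (\<not> i)\<close> and away from the vacuum.\<close>

lemma bifree_left_free:
  fixes \<phi> :: "'a::cstar_algebra \<Rightarrow> complex"
  assumes \<phi>: "clinear \<phi>"
    and bifree: "bifree TYPE('u::complex_vector) TYPE('v::complex_vector) \<phi> (a1, b1) (a2, b2)"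
  shows "free_elements \<phi> (\<lambda>i. if i then a1 else a2)"
proof -
  obtain T1 :: "complex \<times> 'u \<Rightarrow> complex \<times> 'u" and S1 and T2 :: "complex \<times> 'v \<Rightarrow> complex \<times> 'v" and S2
    where lin: "clinear T1" "clinear T2"
    and mom: "\<And>ps. ps \<in> lists {(a1, left_rep Inl T1), (a2, left_rep Inr T2), (b1, right_rep Inl S1), (b2, right_rep Inr S2)}
       \<Longrightarrow> \<phi> (prod_list (map fst ps)) = vacuum_state (foldr (\<circ>) (map snd ps) id)"
    using bifree unfolding bifree_def fst_conv snd_conv by blast
  define A :: "bool \<Rightarrow> ('u, 'v) free_product \<Rightarrow> ('u, 'v) free_product"
    where "A i = (if i then left_rep Inl T1 else left_rep Inr T2)" for i
  define S where "S i = tensor_word ` {w :: ('u + 'v) list. w = [] \<or> isl (hd w) \<noteq> i}" for i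
  define k where "k i n = (if i then fst ((T1 ^^ n) (1, 0)) else fst ((T2 ^^ n) (1, 0)))" for i n
  note reps = left_rep_power[OF left_rep_Inl_ex1[OF lin(1)]] left_rep_power[OF left_rep_Inr_ex1[OF lin(2)]]
  show ?thesis
  proof (rule free_elements_of_operators[OF \<phi>, where A=A and S=S and k=k and \<xi>="tensor_word []"
        and vac="extend_words (\<lambda>w. if w = [] then 1 else 0)"])
    show "clinear (A i)" for i by (cases i) (simp_all add: A_def reps(1,3))
    show "\<exists>v'\<in>S (\<not> i). (A i ^^ n) v = k i n *\<^sub>C v + v' \<and> extend_words (\<lambda>w. if w = [] then 1 else 0) v' = (0::complex)"
      if v: "v \<in> S i" for i n v
    proof -
      obtain w where w: "w = [] \<or> isl (hd w) \<noteq> i" "v = tensor_word w" using v by (auto simp: S_def)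
      show ?thesis
      proof (cases i)
        case True
        have sp: "v \<in> left_space Inl" unfolding left_space_def w(2)
          using w(1) True by (intro complex_vector.span_base) (auto simp: isl_def)
        \<comment> \<open>This is \<open>v\<close> written as the state vector tensored with
          \<open>v\<close>: a word containing the letter 0 vanishes, so the extra term of
          \<open>left_tensor\<close> drops out.\<close>
        have v1: "v = left_tensor Inl (1, 0) v"
          using tensor_word_zero_letter(1)[of "[]" w] by (simp add: w(2) left_tensor_tensor_word scaleC_one)
        have "(A i ^^ n) v = left_tensor Inl ((T1 ^^ n) (1, 0)) v"
          using reps(2)[OF sp, of n "(1,0)"] v1 True by (simp add: A_def)
        also have "\<dots> = k i n *\<^sub>C v + tensor_word (Inl (snd ((T1 ^^ n) (1, 0))) # w)"
          using True by (simp add: w(2) left_tensor_tensor_word k_def)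
        finally show ?thesis using True
          by (intro bexI[of _ "tensor_word (Inl (snd ((T1 ^^ n) (1, 0))) # w)"])
            (auto simp: vacuum_coefficient S_def)
      next
        case False
        have sp: "v \<in> left_space Inr" unfolding left_space_def w(2)
          using w(1) False by (intro complex_vector.span_base) (auto simp: range_Inr_iff)
        have v1: "v = left_tensor Inr (1, 0) v"
          using tensor_word_zero_letter(2)[of "[]" w] by (simp add: w(2) left_tensor_tensor_word scaleC_one)
        have "(A i ^^ n) v = left_tensor Inr ((T2 ^^ n) (1, 0)) v"
          using reps(4)[OF sp, of n "(1,0)"] v1 False by (simp add: A_def)
        also have "\<dots> = k i n *\<^sub>C v + tensor_word (Inr (snd ((T2 ^^ n) (1, 0))) # w)"
          using False by (simp add: w(2) left_tensor_tensor_word k_def)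
        finally show ?thesis using False
          by (intro bexI[of _ "tensor_word (Inr (snd ((T2 ^^ n) (1, 0))) # w)"])
            (auto simp: vacuum_coefficient S_def)
      qed
    qed
    show "\<phi> (prod_list (map (\<lambda>i. if i then a1 else a2) js))
        = extend_words (\<lambda>w. if w = [] then 1 else 0) (foldr A js (tensor_word []))" for js
    proof -
      let ?ps = "map (\<lambda>i. (if i then a1 else a2, A i)) js"
      have "?ps \<in> lists {(a1, left_rep Inl T1), (a2, left_rep Inr T2), (b1, right_rep Inl S1), (b2, right_rep Inr S2)}"
        by (auto simp: A_def in_lists_conv_set)
      moreover have "map fst ?ps = map (\<lambda>i. if i then a1 else a2) js" "map snd ?ps = map A js"
        by (simp_all add: o_def)
      ultimately show ?thesis
        using mom[of ?ps] by (simp only: vacuum_state_def foldr_comp_apply)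
    qed
  qed (auto simp: vacuum_coefficient S_def)
qed

text \<open>The mirror image of the left case: letters are created at the end of a word, so
  \<open>S i\<close> is described by the last letter.\<close>

lemma bifree_right_free:
  fixes \<phi> :: "'a::cstar_algebra \<Rightarrow> complex"
  assumes \<phi>: "clinear \<phi>"
    and bifree: "bifree TYPE('u::complex_vector) TYPE('v::complex_vector) \<phi> (a1, b1) (a2, b2)"
  shows "free_elements \<phi> (\<lambda>i. if i then b1 else b2)"
proof -
  obtain T1 :: "complex \<times> 'u \<Rightarrow> complex \<times> 'u" and S1 and T2 :: "complex \<times> 'v \<Rightarrow> complex \<times> 'v" and S2
    where lin: "clinear S1" "clinear S2"
    and mom: "\<And>ps. ps \<in> lists {(a1, left_rep Inl T1), (a2, left_rep Inr T2), (b1, right_rep Inl S1), (b2, right_rep Inr S2)}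
       \<Longrightarrow> \<phi> (prod_list (map fst ps)) = vacuum_state (foldr (\<circ>) (map snd ps) id)"
    using bifree unfolding bifree_def fst_conv snd_conv by blast
  define A :: "bool \<Rightarrow> ('u, 'v) free_product \<Rightarrow> ('u, 'v) free_product"
    where "A i = (if i then right_rep Inl S1 else right_rep Inr S2)" for i
  define S where "S i = tensor_word ` {w :: ('u + 'v) list. w = [] \<or> isl (last w) \<noteq> i}" for i
  define k where "k i n = (if i then fst ((S1 ^^ n) (1, 0)) else fst ((S2 ^^ n) (1, 0)))" for i n
  note reps = right_rep_power[OF right_rep_Inl_ex1[OF lin(1)]] right_rep_power[OF right_rep_Inr_ex1[OF lin(2)]]
  show ?thesis
  proof (rule free_elements_of_operators[OF \<phi>, where A=A and S=S and k=k and \<xi>="tensor_word []"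
        and vac="extend_words (\<lambda>w. if w = [] then 1 else 0)"])
    show "clinear (A i)" for i by (cases i) (simp_all add: A_def reps(1,3))
    show "\<exists>v'\<in>S (\<not> i). (A i ^^ n) v = k i n *\<^sub>C v + v' \<and> extend_words (\<lambda>w. if w = [] then 1 else 0) v' = (0::complex)"
      if v: "v \<in> S i" for i n v
    proof -
      obtain w where w: "w = [] \<or> isl (last w) \<noteq> i" "v = tensor_word w" using v by (auto simp: S_def)
      show ?thesis
      proof (cases i)
        case True
        have sp: "v \<in> right_space Inl" unfolding right_space_def w(2)
          using w(1) True by (intro complex_vector.span_base) (auto simp: isl_def)
        have v1: "v = right_tensor Inl v (1, 0)"
          using tensor_word_zero_letter(1)[of w "[]"] by (simp add: w(2) right_tensor_tensor_word scaleC_one)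
        have "(A i ^^ n) v = right_tensor Inl v ((S1 ^^ n) (1, 0))"
          using reps(2)[OF sp, of n "(1,0)"] v1 True by (simp add: A_def)
        also have "\<dots> = k i n *\<^sub>C v + tensor_word (w @ [Inl (snd ((S1 ^^ n) (1, 0)))])"
          using True by (simp add: w(2) right_tensor_tensor_word k_def)
        finally show ?thesis using True
          by (intro bexI[of _ "tensor_word (w @ [Inl (snd ((S1 ^^ n) (1, 0)))])"])
            (auto simp: vacuum_coefficient S_def)
      next
        case False
        have sp: "v \<in> right_space Inr" unfolding right_space_def w(2)
          using w(1) False by (intro complex_vector.span_base) (auto simp: range_Inr_iff)
        have v1: "v = right_tensor Inr v (1, 0)"
          using tensor_word_zero_letter(2)[of w "[]"] by (simp add: w(2) right_tensor_tensor_word scaleC_one)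
        have "(A i ^^ n) v = right_tensor Inr v ((S2 ^^ n) (1, 0))"
          using reps(4)[OF sp, of n "(1,0)"] v1 False by (simp add: A_def)
        also have "\<dots> = k i n *\<^sub>C v + tensor_word (w @ [Inr (snd ((S2 ^^ n) (1, 0)))])"
          using False by (simp add: w(2) right_tensor_tensor_word k_def)
        finally show ?thesis using False
          by (intro bexI[of _ "tensor_word (w @ [Inr (snd ((S2 ^^ n) (1, 0)))])"])
            (auto simp: vacuum_coefficient S_def)
      qed
    qed
    show "\<phi> (prod_list (map (\<lambda>i. if i then b1 else b2) js))
        = extend_words (\<lambda>w. if w = [] then 1 else 0) (foldr A js (tensor_word []))" for js
    proof -
      let ?ps = "map (\<lambda>i. (if i then b1 else b2, A i)) js"
      have "?ps \<in> lists {(a1, left_rep Inl T1), (a2, left_rep Inr T2), (b1, right_rep Inl S1), (b2, right_rep Inr S2)}"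
        by (auto simp: A_def in_lists_conv_set)
      moreover have "map fst ?ps = map (\<lambda>i. if i then b1 else b2) js" "map snd ?ps = map A js"
        by (simp_all add: o_def)
      ultimately show ?thesis
        using mom[of ?ps] by (simp only: vacuum_state_def foldr_comp_apply)
    qed
  qed (auto simp: vacuum_coefficient S_def)
qed

section \<open>Resolvents of free sums\<close>

text \<open>The Neumann series of the inverse of \<open>w - a\<close>, applied where
  \<open>norm a < cmod w\<close>. As a series in powers of \<open>a\<close> it can be evaluated
  termwise by \<phi>.\<close>

definition resolvent :: "'a::cstar_algebra \<Rightarrow> complex \<Rightarrow> 'a" where
  "resolvent a w = suminf (\<lambda>n. inverse w ^ Suc n *\<^sub>C a ^ n)"

lemma bounded_linear_scaleC: "bounded_linear (\<lambda>x :: 'a::cstar_algebra. k *\<^sub>C x)"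
  by (rule bounded_linear_intro[where K="cmod k"])
    (simp_all add: scaleC_add_right scaleR_eq_scaleC scaleC_scaleC mult.commute norm_scaleC)

context
  fixes a :: "'a::cstar_algebra" and w :: complex
  assumes small: "norm a < cmod w"
begin

private lemma w_ne: "w \<noteq> 0" using small norm_ge_zero[of a] by (auto simp: not_less[symmetric] simp del: norm_ge_zero)

private lemma scaled_power: "inverse w ^ n *\<^sub>C a ^ n = (inverse w *\<^sub>C a) ^ n"
proof (induction n)
  case (Suc n)
  have "inverse w ^ Suc n *\<^sub>C a ^ Suc n = inverse w *\<^sub>C (a * (inverse w ^ n *\<^sub>C a ^ n))"
    by (simp add: mult_scaleC_right scaleC_scaleC)
  then show ?case by (simp add: Suc mult_scaleC_left)
qed (simp add: scaleC_one)

private lemma summable_scaled: "summable (\<lambda>n. inverse w ^ n *\<^sub>C a ^ n)"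
  unfolding scaled_power using small w_ne
  by (intro complete_algebra_summable_geometric) (simp add: norm_scaleC norm_inverse flip: divide_inverse_commute)

lemma resolvent_sums: "(\<lambda>n. inverse w ^ Suc n *\<^sub>C a ^ n) sums resolvent a w"
proof -
  have "summable (\<lambda>n. inverse w *\<^sub>C (inverse w ^ n *\<^sub>C a ^ n))"
    by (rule bounded_linear.summable[OF bounded_linear_scaleC summable_scaled])
  then show ?thesis unfolding resolvent_def by (simp add: scaleC_scaleC summable_sums)
qed

text \<open>Multiplying the resolvent series by \<open>w - a\<close> on either side yields exactly
  these terms, so both inverse laws follow from one telescoping sum.\<close>

private lemma telescope: "(\<lambda>n. inverse w ^ n *\<^sub>C a ^ n - inverse w ^ Suc n *\<^sub>C a ^ Suc n) sums 1"
  using telescope_sums'[OF summable_LIMSEQ_zero[OF summable_scaled]] by (simp add: scaleC_one)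

lemma resolvent_right_inverse: "(w *\<^sub>C 1 - a) * resolvent a w = 1"
proof -
  have "(\<lambda>n. (w *\<^sub>C 1 - a) * (inverse w ^ Suc n *\<^sub>C a ^ n)) sums ((w *\<^sub>C 1 - a) * resolvent a w)"
    by (rule bounded_linear.sums[OF bounded_linear_mult_right resolvent_sums])
  moreover have "(w *\<^sub>C 1 - a) * (inverse w ^ Suc n *\<^sub>C a ^ n)
      = inverse w ^ n *\<^sub>C a ^ n - inverse w ^ Suc n *\<^sub>C a ^ Suc n" for n
    using w_ne by (simp add: left_diff_distrib mult_scaleC_left mult_scaleC_right scaleC_scaleC
        scaleC_diff_right mult.commute)
  ultimately show ?thesis using telescope sums_unique2 by fastforce
qed

lemma resolvent_left_inverse: "resolvent a w * (w *\<^sub>C 1 - a) = 1"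
proof -
  have "(\<lambda>n. (inverse w ^ Suc n *\<^sub>C a ^ n) * (w *\<^sub>C 1 - a)) sums (resolvent a w * (w *\<^sub>C 1 - a))"
    by (rule bounded_linear.sums[OF bounded_linear_mult_left resolvent_sums])
  moreover have "(inverse w ^ Suc n *\<^sub>C a ^ n) * (w *\<^sub>C 1 - a)
      = inverse w ^ n *\<^sub>C a ^ n - inverse w ^ Suc n *\<^sub>C a ^ Suc n" for n
    using w_ne
    by (simp add: right_diff_distrib mult_scaleC_left mult_scaleC_right scaleC_scaleC power_commutes mult.commute)
  ultimately show ?thesis using telescope sums_unique2 by fastforce
qed

lemma norm_resolvent_le: "norm (resolvent a w) \<le> 1 / (cmod w - norm a)"
proof -
  have "w *\<^sub>C resolvent a w = 1 + a * resolvent a w"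
    using resolvent_right_inverse by (simp add: left_diff_distrib mult_scaleC_left algebra_simps)
  then have "cmod w * norm (resolvent a w) = norm (1 + a * resolvent a w)"
    by (metis norm_scaleC)
  also have "\<dots> \<le> 1 + norm a * norm (resolvent a w)"
    using norm_triangle_ineq[of 1 "a * resolvent a w"] norm_mult_ineq[of a "resolvent a w"] by simp
  finally show ?thesis using small by (simp add: field_simps)
qed

end

text \<open>The form in which freeness reaches resolvents: a centred resolvent is such a series,
  with \<open>k n\<close> proportional to \<open>inverse w ^ Suc n\<close>.\<close>

definition centred_series :: "('a::cstar_algebra \<Rightarrow> complex) \<Rightarrow> 'a \<Rightarrow> 'a \<Rightarrow> bool" where
  "centred_series \<phi> a u \<longleftrightarrow> (\<exists>k. (\<lambda>n. k n *\<^sub>C centred_power \<phi> a n) sums u)"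

lemma free_elements_series:
  assumes \<phi>: "clinear \<phi>" "bounded_linear \<phi>" and free: "free_elements \<phi> c"
    and xs: "xs \<noteq> []" "successively (\<noteq>) (map fst xs)"
    and series: "\<And>i u. (i, u) \<in> set xs \<Longrightarrow> centred_series \<phi> (c i) u"
  shows "\<phi> (prod_list (map snd xs)) = 0"
proof -
  interpret \<phi>: Vector_Spaces.linear scaleC scaleC \<phi> by fact
  let ?P = "\<lambda>ps. prod_list (map (\<lambda>p. centred_power \<phi> (c (fst p)) (snd p)) ps)"
  \<comment> \<open>The series are expanded one factor at a time from the right, \<open>ps\<close>
    recording the powers already chosen. The first condition says that \<open>xs\<close> and
    \<open>ps\<close> are not both empty; the 0 in it only adapts the types.\<close>
  have "\<phi> (prod_list (map snd xs) * ?P ps) = 0"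
    if "xs @ map (apsnd (\<lambda>_. 0)) ps \<noteq> []" "successively (\<noteq>) (map fst xs @ map fst ps)"
      "\<And>i u. (i, u) \<in> set xs \<Longrightarrow> centred_series \<phi> (c i) u" for ps
    using that
  proof (induction xs arbitrary: ps rule: rev_induct)
    case Nil
    then show ?case using free by (simp add: free_elements_def)
  next
    case (snoc x xs)
    obtain i u where x: "x = (i, u)" by (cases x)
    obtain k where k: "(\<lambda>n. k n *\<^sub>C centred_power \<phi> (c i) n) sums u"
      using snoc.prems(3)[of i u] by (auto simp: x centred_series_def)
    let ?Q = "prod_list (map snd xs)"
    have "bounded_linear (\<lambda>y. \<phi> (?Q * (y * ?P ps)))"
      by (intro bounded_linear_compose[OF \<phi>(2)] bounded_linear_compose[OF bounded_linear_mult_right]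
          bounded_linear_mult_left)
    from bounded_linear.sums[OF this k]
    have "(\<lambda>n. k n * \<phi> (?Q * ?P ((i, n) # ps))) sums \<phi> (?Q * (u * ?P ps))"
      by (simp add: mult_scaleC_left mult_scaleC_right \<phi>.scale scaleC_complex_def)
    moreover have "\<phi> (?Q * ?P ((i, n) # ps)) = 0" for n
      using snoc.prems by (intro snoc.IH) (auto simp: x)
    ultimately have "(\<lambda>n. 0) sums \<phi> (?Q * (u * ?P ps))" by simp
    then have "\<phi> (?Q * (u * ?P ps)) = 0" using sums_unique2 sums_zero by blast
    then show ?case by (simp add: x mult.assoc)
  qed
  from this[of "[]"] show ?thesis using xs series by simp
qed

text \<open>The four index patterns in the expansion of \<open>(1 + u2) (u1 u2)^n (1 + u1)\<close>,
  with \<open>True\<close> standing for \<open>u1\<close>.\<close>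

lemma alternating_blocks:
  "successively (\<noteq>) (concat (replicate n [True, False]))"
  "successively (\<noteq>) (concat (replicate n [True, False]) @ [True])"
  "successively (\<noteq>) (False # concat (replicate n [True, False]))"
  "successively (\<noteq>) (False # concat (replicate n [True, False]) @ [True])"
proof -
  have *: "successively (\<noteq>) (False # concat (replicate n [True, False]) @ [True])" for n
    by (induction n) auto
  have **: "successively (\<noteq>) (False # concat (replicate n [True, False]))" for n
    by (induction n) auto
  show "successively (\<noteq>) (concat (replicate n [True, False]))"
    "successively (\<noteq>) (concat (replicate n [True, False]) @ [True])"
    "successively (\<noteq>) (False # concat (replicate n [True, False]))"
    "successively (\<noteq>) (False # concat (replicate n [True, False]) @ [True])"
    using *[of n] **[of n] by (cases n; simp add: successively_Cons)+
qed

text \<open>With \<open>r\<^sub>j = (w\<^sub>j - a\<^sub>j)\<^sup>-\<^sup>1 = g (1 + u\<^sub>j)\<close> and \<open>\<phi>(u\<^sub>j) = 0\<close>, the resolvent of \<open>a\<^sub>1 + a\<^sub>2\<close> at \<open>z\<close> is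
  \<open>g (1 + u\<^sub>2) (1 - u\<^sub>1 u\<^sub>2)\<^sup>-\<^sup>1 (1 + u\<^sub>1)\<close>, whose expansion consists of alternating products.\<close>

lemma resolvent_free_sum:
  fixes \<phi> :: "'a::cstar_algebra \<Rightarrow> complex"
  assumes \<phi>: "clinear \<phi>" "bounded_linear \<phi>" "\<phi> 1 = 1"
    and free: "free_elements \<phi> (\<lambda>i. if i then a1 else a2)"
    and g: "\<phi> (resolvent a1 w1) = g" "\<phi> (resolvent a2 w2) = g" "g \<noteq> 0"
    and w: "cmod (1 / g - w1) + 2 * norm a1 < cmod w1" "cmod (1 / g - w2) + 2 * norm a2 < cmod w2"
    and z: "z = w1 + w2 - 1 / g" "norm (a1 + a2) < cmod z"
  shows "\<phi> (resolvent (a1 + a2) z) = g"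
proof -
  interpret \<phi>: Vector_Spaces.linear scaleC scaleC \<phi> by fact
  have lt: "norm a1 < cmod w1" "norm a2 < cmod w2"
    using w norm_ge_zero[of "1 / g - w1"] norm_ge_zero[of "1 / g - w2"] norm_ge_zero[of a1] norm_ge_zero[of a2]
    by linarith+
  \<comment> \<open>Since \<open>w R = 1 + a R\<close> for the resolvent \<open>R\<close>, the
    centred element equals \<open>(1/g - w) R + a R\<close>. With
    \<open>norm R \<le> 1 / (cmod w - norm a)\<close>, the assumption on \<open>w\<close> is just
    what makes its norm less than 1.\<close>
  have u: "centred_series \<phi> a ((1 / g) *\<^sub>C resolvent a w - 1)" "norm ((1 / g) *\<^sub>C resolvent a w - 1) < 1"
    if \<phi>R: "\<phi> (resolvent a w) = g" and w: "cmod (1 / g - w) + 2 * norm a < cmod w" "norm a < cmod w" for a w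
  proof -
    note sums = resolvent_sums[OF w(2)]
    have "(\<lambda>n. \<phi> (inverse w ^ Suc n *\<^sub>C a ^ n)) sums g"
      using bounded_linear.sums[OF \<phi>(2) sums] by (simp add: \<phi>R)
    then have "(\<lambda>n. \<phi> (inverse w ^ Suc n *\<^sub>C a ^ n) *\<^sub>C (1::'a)) sums (g *\<^sub>C 1)"
      by (rule bounded_linear.sums[rotated])
        (rule bounded_linear_intro[where K=1],
          simp_all add: scaleC_add_left scaleR_eq_scaleC scaleC_scaleC norm_scaleC scaleR_conv_of_real)
    from sums_diff[OF sums this]
    have "(\<lambda>n. inverse w ^ Suc n *\<^sub>C centred_power \<phi> a n) sums (resolvent a w - g *\<^sub>C 1)"
      by (simp add: centred_power_def scaleC_diff_right scaleC_scaleC \<phi>.scale scaleC_complex_def)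
    from bounded_linear.sums[OF bounded_linear_scaleC[of "1 / g"] this]
    have "(\<lambda>n. (1 / g * inverse w ^ Suc n) *\<^sub>C centred_power \<phi> a n) sums ((1 / g) *\<^sub>C resolvent a w - 1)"
      using g(3) by (simp add: scaleC_scaleC scaleC_diff_right scaleC_one)
    then show "centred_series \<phi> a ((1 / g) *\<^sub>C resolvent a w - 1)"
      unfolding centred_series_def by (rule exI[where x="\<lambda>n. 1 / g * inverse w ^ Suc n"])
    have "w *\<^sub>C resolvent a w = 1 + a * resolvent a w"
      using resolvent_right_inverse[OF w(2)] by (simp add: left_diff_distrib mult_scaleC_left algebra_simps)
    then have "(1 / g) *\<^sub>C resolvent a w - 1 = (1 / g - w) *\<^sub>C resolvent a w + a * resolvent a w"
      by (simp add: complex_vector.scale_left_diff_distrib)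
    also have "norm \<dots> \<le> (cmod (1 / g - w) + norm a) * norm (resolvent a w)"
      using norm_triangle_ineq[of "(1 / g - w) *\<^sub>C resolvent a w" "a * resolvent a w"]
        norm_mult_ineq[of a "resolvent a w"] by (simp add: norm_scaleC distrib_right)
    also have "\<dots> \<le> (cmod (1 / g - w) + norm a) * (1 / (cmod w - norm a))"
      by (intro mult_left_mono norm_resolvent_le w(2)) simp
    also have "\<dots> < 1" using w by (simp add: divide_less_eq)
    finally show "norm ((1 / g) *\<^sub>C resolvent a w - 1) < 1" .
  qed
  define v1 v2 where "v1 = (1 / g) *\<^sub>C resolvent a1 w1" and "v2 = (1 / g) *\<^sub>C resolvent a2 w2"
  define u1 u2 where "u1 = v1 - 1" and "u2 = v2 - 1"
  define S where "S = resolvent (u1 * u2) 1"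
  note u1 = u[OF g(1) w(1) lt(1), folded v1_def u1_def] and u2 = u[OF g(2) w(2) lt(2), folded v2_def u2_def]
  have "norm (u1 * u2) \<le> norm u1 * norm u2" by (rule norm_mult_ineq)
  also have "\<dots> < 1 * 1" using u1(2) u2(2) by (intro mult_strict_mono') auto
  finally have small: "norm (u1 * u2) < cmod 1" by simp
  have S: "(1 - u1 * u2) * S = 1"
    using resolvent_right_inverse[OF small] by (simp add: S_def scaleC_one)
  define p1 p2 where "p1 = w1 *\<^sub>C 1 - a1" and "p2 = w2 *\<^sub>C 1 - a2"
  have pv: "p1 * v1 = (1 / g) *\<^sub>C 1" "p2 * v2 = (1 / g) *\<^sub>C 1"
    unfolding p1_def p2_def v1_def v2_def mult_scaleC_right
    by (simp_all add: resolvent_right_inverse lt)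
  have c: "z *\<^sub>C 1 - (a1 + a2) = p1 + p2 - (1 / g) *\<^sub>C 1"
    by (simp add: z(1) p1_def p2_def scaleC_add_left complex_vector.scale_left_diff_distrib algebra_simps)
  \<comment> \<open>The scalar \<open>1 / g\<close> equals both \<open>p2 v2\<close> and
    \<open>p1 v1\<close>; the first form cancels a term and the second lets \<open>p1\<close> be
    factored out, as \<open>v2 - v1 u2 = 1 - u1 u2\<close>.\<close>
  have "(z *\<^sub>C 1 - (a1 + a2)) * v2 = p1 * v2 + (1 / g) *\<^sub>C 1 - (1 / g) *\<^sub>C v2"
    unfolding c by (simp add: algebra_simps pv mult_scaleC_left)
  also have "\<dots> = p1 * v2 - (1 / g) *\<^sub>C u2" by (simp add: u2_def scaleC_diff_right)
  also have "\<dots> = p1 * v2 - p1 * v1 * u2" by (simp add: pv mult_scaleC_left)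
  also have "\<dots> = p1 * (1 - u1 * u2)" by (simp add: u1_def u2_def algebra_simps)
  finally have cv: "(z *\<^sub>C 1 - (a1 + a2)) * v2 = p1 * (1 - u1 * u2)" .
  have "(z *\<^sub>C 1 - (a1 + a2)) * (g *\<^sub>C (v2 * S * v1)) = g *\<^sub>C (p1 * ((1 - u1 * u2) * S) * v1)"
    by (simp add: mult_scaleC_right cv mult.assoc flip: mult.assoc[of _ v2])
  also have "\<dots> = 1" using g(3) by (simp add: S pv scaleC_scaleC scaleC_one)
  finally have inv: "(z *\<^sub>C 1 - (a1 + a2)) * (g *\<^sub>C (v2 * S * v1)) = 1" .
  have res: "resolvent (a1 + a2) z = g *\<^sub>C (v2 * S * v1)"
    using resolvent_left_inverse[OF z(2)] inv by (metis mult.assoc mult.left_neutral mult.right_neutral)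
  \<comment> \<open>Every word in the expansion is alternating with centred factors and so has
    expectation 0, except the empty word, which occurs only for \<open>n = 0\<close>.\<close>
  have terms: "\<phi> (v2 * (u1 * u2) ^ n * v1) = (if n = 0 then 1 else 0)" for n
  proof -
    define L where "L n = concat (replicate n [(True, u1), (False, u2)])" for n
    have prodL: "prod_list (map snd (L n)) = (u1 * u2) ^ n" for n
      by (induction n) (simp_all add: L_def mult.assoc)
    have fstL: "map fst (L n) = concat (replicate n [True, False])"
      by (simp add: L_def map_concat)
    have setL: "set (L n) \<subseteq> {(True, u1), (False, u2)}" by (auto simp: L_def)
    have zero: "\<phi> (prod_list (map snd xs)) = 0"
      if "xs \<noteq> []" "successively (\<noteq>) (map fst xs)" "set xs \<subseteq> {(True, u1), (False, u2)}" for xs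
      using that u1(1) u2(1) by (intro free_elements_series[OF \<phi>(1,2) free]) auto
    have 1: "\<phi> ((u1 * u2) ^ n) = 0" if "n \<noteq> 0"
    proof -
      have "L n \<noteq> []" using that by (cases n) (auto simp: L_def)
      then show ?thesis using zero[of "L n"] alternating_blocks(1)[of n] setL by (simp add: fstL prodL)
    qed
    have 2: "\<phi> (u2 * (u1 * u2) ^ n) = 0"
      using zero[of "(False, u2) # L n"] alternating_blocks(3)[of n] setL by (simp add: fstL prodL)
    have 3: "\<phi> ((u1 * u2) ^ n * u1) = 0"
      using zero[of "L n @ [(True, u1)]"] alternating_blocks(2)[of n] setL by (simp add: fstL prodL)
    have 4: "\<phi> (u2 * (u1 * u2) ^ n * u1) = 0"
      using zero[of "(False, u2) # L n @ [(True, u1)]"] alternating_blocks(4)[of n] setL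
      by (simp add: fstL prodL mult.assoc)
    have v: "v2 = 1 + u2" "v1 = 1 + u1" by (simp_all add: u1_def u2_def)
    have "v2 * (u1 * u2) ^ n * v1
        = (u1 * u2) ^ n + u2 * (u1 * u2) ^ n + (u1 * u2) ^ n * u1 + u2 * (u1 * u2) ^ n * u1"
      unfolding v by (simp add: distrib_left distrib_right)
    then show ?thesis using 1 2 3 4 \<phi>(3) by (simp add: \<phi>.add)
  qed
  have "bounded_linear (\<lambda>y. \<phi> (v2 * y * v1))"
    by (intro bounded_linear_compose[OF \<phi>(2)] bounded_linear_compose[OF bounded_linear_mult_left]
        bounded_linear_mult_right)
  from bounded_linear.sums[OF this resolvent_sums[OF small]]
  have "(\<lambda>n. if n = 0 then 1 else 0) sums \<phi> (v2 * S * v1)"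
    by (simp add: S_def scaleC_one terms)
  moreover have "(\<lambda>n. if n = 0 then 1 else 0) sums (1::complex)"
    using sums_single[of 0 "\<lambda>_. 1::complex"] by simp
  ultimately have "\<phi> (v2 * S * v1) = 1" by (rule sums_unique2)
  then show ?thesis by (simp add: res \<phi>.scale scaleC_complex_def)
qed

section \<open>Free and bi-free additive convolution\<close>

lemma compact_real_prob_mono:
  assumes "compact_real_prob \<mu> R" "R \<le> R'"
  shows "compact_real_prob \<mu> R'"
proof -
  interpret compact_real_prob \<mu> R by fact
  show ?thesis
  proof
    show "AE t in \<mu>. \<bar>t\<bar> \<le> R'" using support by eventually_elim (use assms(2) in simp)
  qed
qed

text \<open>Both sides are the moment series in \<open>1 / z\<close>. On the measure side, sum and
  integral are exchanged using the geometric majorant of ratio \<open>R / |z|\<close>.\<close>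

lemma cauchy_real_eq_resolvent:
  assumes \<mu>: "compact_real_prob \<mu> R" and \<phi>: "clinear \<phi>" "bounded_linear \<phi>"
    and mom: "\<And>n. \<phi> (a ^ n) = complex_of_real (\<integral>t. t ^ n \<partial>\<mu>)"
    and z: "R < cmod z" "norm a < cmod z"
  shows "cauchy_real \<mu> z = \<phi> (resolvent a z)"
proof -
  interpret compact_real_prob \<mu> R by fact
  interpret \<phi>: Vector_Spaces.linear scaleC scaleC \<phi> by (rule \<phi>(1))
  have z0: "z \<noteq> 0" using z(1) R_nonneg by auto
  define f where "f n t = inverse z ^ Suc n * complex_of_real (t ^ n)" for n t
  have int: "integrable \<mu> (f n)" for n
    unfolding f_def using integrable_power by (intro integrable_mult_right integrable_of_real)
  have geo: "summable (\<lambda>n. inverse (cmod z) * (R / cmod z) ^ n)"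
    using z R_nonneg z0 by (intro summable_mult summable_geometric) (simp add: abs_mult)
  have nf: "norm (f n t) \<le> inverse (cmod z) * (R / cmod z) ^ n" if "\<bar>t\<bar> \<le> R" for n t
  proof -
    have "norm (f n t) = inverse (cmod z) * (\<bar>t\<bar> / cmod z) ^ n"
      by (simp add: f_def norm_mult norm_power norm_inverse power_divide power_inverse divide_inverse power_abs
          power_mult_distrib mult.commute)
    also have "\<dots> \<le> inverse (cmod z) * (R / cmod z) ^ n"
      using that by (intro mult_left_mono power_mono divide_right_mono) auto
    finally show ?thesis .
  qed
  have "(\<lambda>n. integral\<^sup>L \<mu> (f n)) sums (\<integral>t. suminf (\<lambda>n. f n t) \<partial>\<mu>)"
  proof (rule sums_integral[OF int])
    show "AE t in \<mu>. summable (\<lambda>n. norm (f n t))"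
      using support
    proof eventually_elim
      case (elim t)
      then show ?case using nf[OF elim] by (intro summable_comparison_test[OF _ geo]) auto
    qed
    have "norm (\<integral>t. norm (f n t) \<partial>\<mu>) \<le> inverse (cmod z) * (R / cmod z) ^ n" for n
    proof -
      have "(\<integral>t. norm (f n t) \<partial>\<mu>) \<le> inverse (cmod z) * (R / cmod z) ^ n"
        using support by (intro integral_le_const integrable_norm int) (auto elim!: eventually_mono intro: nf)
      then show ?thesis by simp
    qed
    then show "summable (\<lambda>n. \<integral>t. norm (f n t) \<partial>\<mu>)"
      by (intro summable_comparison_test[OF _ geo]) blast
  qed
  also have "(\<integral>t. suminf (\<lambda>n. f n t) \<partial>\<mu>) = cauchy_real \<mu> z"
    unfolding cauchy_real_def
  proof (rule integral_cong_AE)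
    show "AE t in \<mu>. suminf (\<lambda>n. f n t) = 1 / (z - complex_of_real t)"
      using support
    proof eventually_elim
      case (elim t)
      have lt: "norm (complex_of_real t / z) < 1" using elim z z0 by (simp add: norm_divide)
      have "(\<lambda>n. inverse z * (complex_of_real t / z) ^ n) sums (inverse z * (1 / (1 - complex_of_real t / z)))"
        by (intro sums_mult geometric_sums lt)
      moreover have "inverse z * (complex_of_real t / z) ^ n = f n t" for n
        by (simp add: f_def power_divide power_inverse divide_inverse power_mult_distrib mult_ac)
      moreover have "inverse z * (1 / (1 - complex_of_real t / z)) = 1 / (z - complex_of_real t)"
        using z0 by (simp add: field_simps)
      ultimately show ?case using sums_unique by fastforce
    qed
  qed (simp_all add: f_def)
  finally have 1: "(\<lambda>n. integral\<^sup>L \<mu> (f n)) sums cauchy_real \<mu> z" .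
  have "integral\<^sup>L \<mu> (f n) = \<phi> (inverse z ^ Suc n *\<^sub>C a ^ n)" for n
  proof -
    have "integral\<^sup>L \<mu> (f n) = inverse z ^ Suc n * (\<integral>t. complex_of_real (t ^ n) \<partial>\<mu>)"
      unfolding f_def by (rule integral_mult_right_zero)
    then show ?thesis by (simp only: integral_complex_of_real \<phi>.scale mom scaleC_complex_def)
  qed
  moreover have "(\<lambda>n. \<phi> (inverse z ^ Suc n *\<^sub>C a ^ n)) sums \<phi> (resolvent a z)"
    by (rule bounded_linear.sums[OF \<phi>(2) resolvent_sums[OF z(2)]])
  ultimately show ?thesis using 1 sums_unique2 by fastforce
qed

text \<open>The fixed point equation already gives
  \<open>F1(\<omega>) = F2(\<omega>') = \<omega> + \<omega>' - z\<close>, but says nothing about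
  \<mu>. High up, the common value \<open>g\<close> of the two Cauchy transforms meets the
  hypotheses of \<open>resolvent_free_sum\<close>, which identifies it with the Cauchy transform of
  \<mu>; analytic continuation does the rest.\<close>

lemma free_convolution_subordination:
  fixes \<phi> :: "'a::cstar_algebra \<Rightarrow> complex"
  assumes \<phi>: "clinear \<phi>" "bounded_linear \<phi>" "\<phi> 1 = 1"
    and free: "free_elements \<phi> (\<lambda>i. if i then a1 else a2)"
    and supp: "compact_real_prob \<mu>1 R" "compact_real_prob \<mu>2 R" "compact_real_prob \<mu> R"
    and mom1: "\<And>n. \<phi> (a1 ^ n) = complex_of_real (\<integral>t. t ^ n \<partial>\<mu>1)"
    and mom2: "\<And>n. \<phi> (a2 ^ n) = complex_of_real (\<integral>t. t ^ n \<partial>\<mu>2)"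
    and mom: "\<And>n. \<phi> ((a1 + a2) ^ n) = complex_of_real (\<integral>t. t ^ n \<partial>\<mu>)"
  obtains \<omega>1 \<omega>2 where
    "\<And>z. 0 < Im z \<Longrightarrow> 0 < Im (\<omega>1 z)" "\<And>z. 0 < Im z \<Longrightarrow> 0 < Im (\<omega>2 z)"
    "\<And>z. 0 < Im z \<Longrightarrow> recip_cauchy \<mu>1 (\<omega>1 z) = recip_cauchy \<mu> z"
    "\<And>z. 0 < Im z \<Longrightarrow> recip_cauchy \<mu>2 (\<omega>2 z) = recip_cauchy \<mu> z"
    "\<And>z. 0 < Im z \<Longrightarrow> \<omega>1 z + \<omega>2 z = z + recip_cauchy \<mu> z"
proof -
  interpret m1: compact_real_prob \<mu>1 R by fact
  interpret m2: compact_real_prob \<mu>2 R by fact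
  interpret m: compact_real_prob \<mu> R by fact
  define C where "C = R + R\<^sup>2 + 1"
  have C: "R \<le> C" "R\<^sup>2 \<le> C" "0 < C" using m.R_nonneg by (auto simp: C_def add_nonneg_pos)
  define h1 h2 where "h1 w = recip_cauchy \<mu>1 w - w" and "h2 w = recip_cauchy \<mu>2 w - w" for w
  have pert: "half_plane_perturbation h1 C" "half_plane_perturbation h2 C"
    unfolding h1_def h2_def
    using m1.half_plane_perturbation_recip[OF C] m2.half_plane_perturbation_recip[OF C] by simp_all
  interpret h1: half_plane_perturbation h1 C by fact
  interpret h2: half_plane_perturbation h2 C by fact
  obtain \<omega> where holo: "\<omega> holomorphic_on {z. 0 < Im z}"
    and Im_\<omega>: "\<And>z. 0 < Im z \<Longrightarrow> Im z \<le> Im (\<omega> z)"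
    and fixed: "\<And>z. 0 < Im z \<Longrightarrow> \<omega> z = z + h2 (z + h1 (\<omega> z))"
    using holomorphic_fixed_point[OF pert] by blast
  define \<omega>' where "\<omega>' z = z + h1 (\<omega> z)" for z
  have Im_\<omega>': "Im z \<le> Im (\<omega>' z)" if "0 < Im z" for z
    using h1.Im_nonneg[of "\<omega> z"] Im_\<omega>[OF that] that by (simp add: \<omega>'_def)
  have F1: "recip_cauchy \<mu>1 (\<omega> z) = \<omega> z + \<omega>' z - z" for z
    by (simp add: \<omega>'_def h1_def)
  have F2: "recip_cauchy \<mu>2 (\<omega>' z) = \<omega> z + \<omega>' z - z" if "0 < Im z" for z
    using fixed[OF that] by (simp add: \<omega>'_def[symmetric] h2_def algebra_simps)
  \<comment> \<open>The part \<open>2 C + 2 norm a_j\<close> yields the smallness condition of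
    \<open>resolvent_free_sum\<close>, since \<open>|1/g - \<omega>| \<le> 2 C\<close>;
    \<open>R\<close> and \<open>norm (a1 + a2)\<close> ensure that the series converge, and the 1
    gives \<open>C / Im v \<le> C\<close>.\<close>
  define Y where "Y = 2 * C + 2 * norm a1 + 2 * norm a2 + norm (a1 + a2) + R + 1"
  have Y1: "1 \<le> Y" using C m.R_nonneg by (simp add: Y_def)
  have far: "recip_cauchy \<mu> z = recip_cauchy \<mu>1 (\<omega> z)" if z: "Y < Im z" for z
  proof -
    have z0: "0 < Im z" using z Y1 by simp
    define g where "g = cauchy_real \<mu>1 (\<omega> z)"
    have big: "Y < cmod v" if "Im z \<le> Im v" for v
      using abs_Im_le_cmod[of v] that z by simp
    have Im_pos: "0 < Im (\<omega> z)" "0 < Im (\<omega>' z)" using Im_\<omega>[OF z0] Im_\<omega>'[OF z0] z0 by simp_all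
    have RY: "R < Y" "norm (a1 + a2) < Y" "norm a1 < Y" "norm a2 < Y"
      using C m.R_nonneg norm_ge_zero[of a1] norm_ge_zero[of a2] norm_ge_zero[of "a1 + a2"]
      by (simp_all add: Y_def del: norm_ge_zero)
    note b = big[OF Im_\<omega>[OF z0]] big[OF Im_\<omega>'[OF z0]] big[OF order_refl]
    have g': "cauchy_real \<mu>2 (\<omega>' z) = g"
      using F1[of z] F2[OF z0] unfolding g_def recip_cauchy_def by (metis inverse_inverse_eq)
    have inv: "1 / g = recip_cauchy \<mu>1 (\<omega> z)" "1 / g = recip_cauchy \<mu>2 (\<omega>' z)"
      by (simp_all add: recip_cauchy_def g' inverse_eq_divide) (simp add: g_def)
    have close: "C + C / Im v \<le> 2 * C" if "Im z \<le> Im v" for v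
      using that z Y1 C by (simp add: divide_le_eq)
    have d: "cmod (1 / g - \<omega> z) \<le> 2 * C" "cmod (1 / g - \<omega>' z) \<le> 2 * C"
      using h1.bound[OF Im_pos(1)] close[OF Im_\<omega>[OF z0]] h2.bound[OF Im_pos(2)] close[OF Im_\<omega>'[OF z0]]
      unfolding h1_def h2_def inv(1)[symmetric] inv(2)[symmetric] by simp_all
    have "\<phi> (resolvent (a1 + a2) z) = g"
    proof (rule resolvent_free_sum[OF \<phi> free])
      show "\<phi> (resolvent a1 (\<omega> z)) = g"
        unfolding g_def using b RY by (intro cauchy_real_eq_resolvent[OF supp(1) \<phi>(1,2) mom1, symmetric]) auto
      show "\<phi> (resolvent a2 (\<omega>' z)) = g"
        unfolding g'[symmetric] using b RY by (intro cauchy_real_eq_resolvent[OF supp(2) \<phi>(1,2) mom2, symmetric]) auto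
      show "g \<noteq> 0" unfolding g_def by (rule m1.cauchy_real_ne[OF Im_pos(1)])
      show "z = \<omega> z + \<omega>' z - 1 / g" unfolding inv(1) F1 by simp
      show "cmod (1 / g - \<omega> z) + 2 * norm a1 < cmod (\<omega> z)" "cmod (1 / g - \<omega>' z) + 2 * norm a2 < cmod (\<omega>' z)"
        using d b m.R_nonneg norm_ge_zero[of a1] norm_ge_zero[of a2] norm_ge_zero[of "a1 + a2"]
        unfolding Y_def by linarith+
      show "norm (a1 + a2) < cmod z" using b RY by simp
    qed
    then have "cauchy_real \<mu> z = g"
      using cauchy_real_eq_resolvent[OF supp(3) \<phi>(1,2) mom, of z] b RY by simp
    then show ?thesis by (simp add: recip_cauchy_def g_def)
  qed
  have F: "recip_cauchy \<mu> z = recip_cauchy \<mu>1 (\<omega> z)" if "0 < Im z" for z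
  proof (rule analytic_continuation_open[where s="{z. Y < Im z}" and s'="{z. 0 < Im z}"
        and f="recip_cauchy \<mu>" and g="\<lambda>z. recip_cauchy \<mu>1 (\<omega> z)"])
    show "{z. Y < Im z} \<noteq> {}" by (auto intro!: exI[of _ "Complex 0 (Y + 1)"])
    have "(recip_cauchy \<mu>1 \<circ> \<omega>) holomorphic_on {z. 0 < Im z}"
      by (rule holomorphic_on_compose_gen[OF holo m1.recip_cauchy_holomorphic]) (use Im_\<omega> in force)
    then show "(\<lambda>z. recip_cauchy \<mu>1 (\<omega> z)) holomorphic_on {z. 0 < Im z}" by (simp add: o_def)
  qed (use that far Y1 m.recip_cauchy_holomorphic in \<open>auto simp: open_halfspace_Im_gt\<close>)
  show thesis
  proof (rule that[of \<omega> \<omega>'])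
    fix z assume z: "0 < Im z"
    show "0 < Im (\<omega> z)" "0 < Im (\<omega>' z)" using Im_\<omega>[OF z] Im_\<omega>'[OF z] z by simp_all
    show "recip_cauchy \<mu>1 (\<omega> z) = recip_cauchy \<mu> z" "recip_cauchy \<mu>2 (\<omega>' z) = recip_cauchy \<mu> z"
      using F[OF z] F1[of z] F2[OF z] by simp_all
    show "\<omega> z + \<omega>' z = z + recip_cauchy \<mu> z" using F[OF z] F1[of z] by simp
  qed
qed

lemma free_convolution_atoms:
  fixes \<phi> :: "'a::cstar_algebra \<Rightarrow> complex"
  assumes "clinear \<phi>" "bounded_linear \<phi>" "\<phi> 1 = 1"
    and "free_elements \<phi> (\<lambda>i. if i then a1 else a2)"
    and supp: "compact_real_prob \<mu>1 R1" "compact_real_prob \<mu>2 R2" "compact_real_prob \<mu> R3"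
    and "\<And>n. \<phi> (a1 ^ n) = complex_of_real (\<integral>t. t ^ n \<partial>\<mu>1)"
    and "\<And>n. \<phi> (a2 ^ n) = complex_of_real (\<integral>t. t ^ n \<partial>\<mu>2)"
    and "\<And>n. \<phi> ((a1 + a2) ^ n) = complex_of_real (\<integral>t. t ^ n \<partial>\<mu>)"
    and blowup: "filterlim (\<lambda>y. cmod (cauchy_real \<mu> (Complex x y))) at_top (at_right 0)"
  shows "\<exists>a b. a + b = x \<and> 1 \<le> measure \<mu>1 {a} + measure \<mu>2 {b}"
proof -
  define R where "R = max R1 (max R2 R3)"
  have R: "compact_real_prob \<mu>1 R" "compact_real_prob \<mu>2 R" "compact_real_prob \<mu> R"
    by (rule compact_real_prob_mono[OF supp(1)] compact_real_prob_mono[OF supp(2)]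
        compact_real_prob_mono[OF supp(3)], simp add: R_def)+
  obtain \<omega>1 \<omega>2 where \<omega>: "\<And>z. 0 < Im z \<Longrightarrow> 0 < Im (\<omega>1 z)" "\<And>z. 0 < Im z \<Longrightarrow> 0 < Im (\<omega>2 z)"
    "\<And>z. 0 < Im z \<Longrightarrow> recip_cauchy \<mu>1 (\<omega>1 z) = recip_cauchy \<mu> z"
    "\<And>z. 0 < Im z \<Longrightarrow> recip_cauchy \<mu>2 (\<omega>2 z) = recip_cauchy \<mu> z"
    "\<And>z. 0 < Im z \<Longrightarrow> \<omega>1 z + \<omega>2 z = z + recip_cauchy \<mu> z"
    using free_convolution_subordination[OF assms(1-4) R assms(8-10)] by blast
  define y where "y n = inverse (real (Suc n))" for n
  define z where "z n = Complex x (y n)" for n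
  have y: "y \<longlonglongrightarrow> 0" "0 < y n" for n
    unfolding y_def using LIMSEQ_inverse_real_of_nat by auto
  have z: "0 < Im (z n)" for n using y(2) by (simp add: z_def)
  have zlim: "z \<longlonglongrightarrow> complex_of_real x"
    using tendsto_Complex[OF tendsto_const y(1), of x] by (simp add: z_def[abs_def] complex_of_real_def)
  have "filterlim y (at_right 0) sequentially"
    using y by (intro filterlim_at_withinI) auto
  from filterlim_compose[OF blowup this]
  have "filterlim (\<lambda>n. cmod (cauchy_real \<mu> (z n))) at_top sequentially" by (simp add: z_def)
  then have "(\<lambda>n. inverse (cmod (cauchy_real \<mu> (z n)))) \<longlonglongrightarrow> 0" by (rule tendsto_inverse_0_at_top)
  then have F0: "(\<lambda>n. recip_cauchy \<mu> (z n)) \<longlonglongrightarrow> 0"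
    by (intro tendsto_norm_zero_cancel[of "\<lambda>n. recip_cauchy \<mu> (z n)"]) (simp add: recip_cauchy_def norm_inverse)
  show ?thesis
    by (rule atoms_of_subordination[OF R(1,2) z zlim, of "\<lambda>n. \<omega>1 (z n)" "\<lambda>n. \<omega>2 (z n)" "\<lambda>n. recip_cauchy \<mu> (z n)"])
      (use \<omega> z F0 in auto)
qed

section \<open>From the two-variable Cauchy transform to the marginals\<close>

lemma (in real_prob) cauchy_real_blowup:
  assumes \<alpha>: "1 / 2 < \<alpha>" and b: "0 < b" and d: "0 < d"
    and lower: "\<And>y. 0 < y \<Longrightarrow> y < d \<Longrightarrow>
      1 \<le> (y * b) powr \<alpha> * ((\<integral>t. cmod (1 / (Complex x y - complex_of_real t)) \<partial>\<mu>) / b)"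
  shows "filterlim (\<lambda>y. cmod (cauchy_real \<mu> (Complex x y))) at_top (at_right 0)"
proof (rule filterlim_at_top_mono)
  \<comment> \<open>Squaring the lower bound gives \<open>c \<le> y^(2 \<alpha>) I^2\<close>;
    multiplication by \<open>y^(1 - 2 \<alpha>)\<close> turns the right-hand side into
    \<open>y I^2\<close>, which is at most \<open>|G|\<close>.\<close>
  define c where "c = b\<^sup>2 / b powr (2 * \<alpha>)"
  have "0 < c" using b by (simp add: c_def)
  show "filterlim (\<lambda>y. c * y powr (1 - 2 * \<alpha>)) at_top (at_right 0)"
    using \<open>0 < c\<close> \<alpha> by real_asymp
  have "\<forall>\<^sub>F y in at_right 0. y \<in> {0<..<d}" by (rule eventually_at_rightI[OF _ d]) simp
  then show "\<forall>\<^sub>F y in at_right 0. c * y powr (1 - 2 * \<alpha>) \<le> cmod (cauchy_real \<mu> (Complex x y))"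
  proof eventually_elim
    case (elim y)
    then have y: "0 < y" "y < d" by auto
    define I where "I = (\<integral>t. cmod (1 / (Complex x y - complex_of_real t)) \<partial>\<mu>)"
    have "y * I\<^sup>2 \<le> y * square_cauchy \<mu> (Complex x y)"
      unfolding I_def using integral_kernel_norm_sq_le[of "Complex x y"] y by simp
    also have "\<dots> = - Im (cauchy_real \<mu> (Complex x y))"
      using Im_cauchy_real[of "Complex x y"] y by simp
    also have "\<dots> \<le> cmod (cauchy_real \<mu> (Complex x y))"
      using abs_Im_le_cmod[of "cauchy_real \<mu> (Complex x y)"] by simp
    finally have G: "y * I\<^sup>2 \<le> cmod (cauchy_real \<mu> (Complex x y))" .
    have "b \<le> (y * b) powr \<alpha> * I"
      using lower[OF y] b by (simp add: I_def[symmetric] field_simps)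
    then have "b\<^sup>2 \<le> ((y * b) powr \<alpha> * I)\<^sup>2" using b by (intro power_mono) auto
    also have "\<dots> = y powr (2 * \<alpha>) * b powr (2 * \<alpha>) * I\<^sup>2"
      using y b by (simp add: power_mult_distrib powr_mult powr_power mult.commute)
    finally have "c \<le> y powr (2 * \<alpha>) * I\<^sup>2"
      using b by (simp add: c_def divide_le_eq mult_ac)
    then have "c * y powr (1 - 2 * \<alpha>) \<le> (y powr (2 * \<alpha>) * I\<^sup>2) * y powr (1 - 2 * \<alpha>)"
      by (intro mult_right_mono) auto
    also have "\<dots> = (y powr (2 * \<alpha>) * y powr (1 - 2 * \<alpha>)) * I\<^sup>2" by (simp add: mult_ac)
    also have "\<dots> = y * I\<^sup>2" using y by (simp flip: powr_add)
    finally show ?case using G by simp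
  qed
qed

lemma marginals:
  assumes \<eta>: "is_distribution \<phi> a b \<eta>"
  obtains R where "compact_real_prob (first_marginal \<eta>) R" "compact_real_prob (second_marginal \<eta>) R"
    "\<And>n. \<phi> (a ^ n) = complex_of_real (\<integral>t. t ^ n \<partial>first_marginal \<eta>)"
    "\<And>n. \<phi> (b ^ n) = complex_of_real (\<integral>t. t ^ n \<partial>second_marginal \<eta>)"
proof -
  obtain K where K: "compact K" "AE p in \<eta>. p \<in> K"
    and prob: "prob_space \<eta>" and sets: "sets \<eta> = sets borel"
    and mom: "\<And>m n. \<phi> (a ^ m * b ^ n) = complex_of_real (\<integral>p. fst p ^ m * snd p ^ n \<partial>\<eta>)"
    using \<eta> by (auto simp: is_distribution_def)
  interpret prob_space \<eta> by fact
  have meas: "fst \<in> measurable \<eta> borel" "snd \<in> measurable \<eta> borel"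
    by (simp_all add: measurable_cong_sets[OF sets refl] borel_measurable_continuous_onI continuous_on_fst continuous_on_snd continuous_on_id)
  obtain R where R: "\<And>p. p \<in> K \<Longrightarrow> norm p \<le> R"
    using compact_imp_bounded[OF K(1)] by (auto simp: bounded_iff)
  have R': "\<bar>fst p\<bar> \<le> R" "\<bar>snd p\<bar> \<le> R" if "p \<in> K" for p
    using R[OF that] norm_fst_le[of "fst p" "snd p"] norm_snd_le[of "snd p" "fst p"] by simp_all
  have 1: "compact_real_prob (first_marginal \<eta>) R"
    unfolding first_marginal_def compact_real_prob_def real_prob_def real_prob_axioms_def compact_real_prob_axioms_def
    using prob_space_distr[OF meas(1)] meas(1) K(2) R'(1)
    by (auto simp: AE_distr_iff elim!: eventually_mono)
  have 2: "compact_real_prob (second_marginal \<eta>) R"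
    unfolding second_marginal_def compact_real_prob_def real_prob_def real_prob_axioms_def compact_real_prob_axioms_def
    using prob_space_distr[OF meas(2)] meas(2) K(2) R'(2)
    by (auto simp: AE_distr_iff elim!: eventually_mono)
  show thesis
  proof (rule that[OF 1 2])
    show "\<phi> (a ^ n) = complex_of_real (\<integral>t. t ^ n \<partial>first_marginal \<eta>)" for n
      using mom[of n 0] meas(1) by (simp add: first_marginal_def integral_distr)
    show "\<phi> (b ^ n) = complex_of_real (\<integral>t. t ^ n \<partial>second_marginal \<eta>)" for n
      using mom[of 0 n] meas(2) by (simp add: second_marginal_def integral_distr)
  qed
qed

text \<open>One factor of the kernel is bounded by the reciprocal of its imaginary part, so the
  integrand depends on one coordinate only. The absolute value remains under the integral, which is
  why the blow-up lemma starts from such integrals.\<close>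

lemma cauchy_transform_marginal_bounds:
  assumes \<eta>: "is_distribution \<phi> a b \<eta>" and z: "0 < Im z" and w: "0 < Im w"
  shows "cmod (cauchy_transform \<eta> z w) \<le> (\<integral>t. cmod (1 / (z - complex_of_real t)) \<partial>first_marginal \<eta>) / Im w"
    and "cmod (cauchy_transform \<eta> z w) \<le> (\<integral>t. cmod (1 / (w - complex_of_real t)) \<partial>second_marginal \<eta>) / Im z"
proof -
  have prob: "prob_space \<eta>" and sets: "sets \<eta> = sets borel"
    using \<eta> by (auto simp: is_distribution_def)
  interpret prob_space \<eta> by fact
  have meas: "fst \<in> measurable \<eta> borel" "snd \<in> measurable \<eta> borel"
    by (simp_all add: measurable_cong_sets[OF sets refl] borel_measurable_continuous_onI continuous_on_fst continuous_on_snd continuous_on_id)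
  note [measurable] = meas
  have ker: "cmod (1 / (v - complex_of_real t)) \<le> 1 / Im v" if "0 < Im v" for v t
    using abs_Im_le_cmod[of "v - complex_of_real t"] that by (simp add: norm_divide frac_le)
  have int1: "integrable \<eta> (\<lambda>p. cmod (1 / (z - complex_of_real (fst p))))"
    by (rule integrable_const_bound[where B="1 / Im z"]) (use ker[OF z] in auto)
  have int2: "integrable \<eta> (\<lambda>p. cmod (1 / (w - complex_of_real (snd p))))"
    by (rule integrable_const_bound[where B="1 / Im w"]) (use ker[OF w] in auto)
  have prod: "cmod (1 / ((z - complex_of_real (fst p)) * (w - complex_of_real (snd p))))
      = cmod (1 / (z - complex_of_real (fst p))) * cmod (1 / (w - complex_of_real (snd p)))" for p
    by (simp add: norm_divide norm_mult)
  have int: "integrable \<eta> (\<lambda>p. cmod (1 / ((z - complex_of_real (fst p)) * (w - complex_of_real (snd p)))))"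
  proof (rule integrable_const_bound[where B="1 / Im z * (1 / Im w)"])
    show "AE p in \<eta>. norm (cmod (1 / ((z - complex_of_real (fst p)) * (w - complex_of_real (snd p))))) \<le> 1 / Im z * (1 / Im w)"
      unfolding prod using mult_mono[OF ker[OF z] ker[OF w]] z w by auto
  qed measurable
  have le: "cmod (cauchy_transform \<eta> z w)
      \<le> (\<integral>p. cmod (1 / ((z - complex_of_real (fst p)) * (w - complex_of_real (snd p)))) \<partial>\<eta>)"
    unfolding cauchy_transform_def by (rule integral_norm_bound)
  also have "\<dots> \<le> (\<integral>p. cmod (1 / (z - complex_of_real (fst p))) * (1 / Im w) \<partial>\<eta>)"
    using int1 by (intro integral_mono[OF int]) (auto simp only: prod intro!: norm_ge_zero mult_left_mono ker[OF w] integrable_mult_left)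
  also have "\<dots> = (\<integral>t. cmod (1 / (z - complex_of_real t)) \<partial>first_marginal \<eta>) / Im w"
    unfolding first_marginal_def by (subst integral_distr) auto
  finally show "cmod (cauchy_transform \<eta> z w) \<le> (\<integral>t. cmod (1 / (z - complex_of_real t)) \<partial>first_marginal \<eta>) / Im w" .
  note le
  also have "(\<integral>p. cmod (1 / ((z - complex_of_real (fst p)) * (w - complex_of_real (snd p)))) \<partial>\<eta>)
      \<le> (\<integral>p. (1 / Im z) * cmod (1 / (w - complex_of_real (snd p))) \<partial>\<eta>)"
    using int2 by (intro integral_mono[OF int]) (auto simp only: prod intro!: norm_ge_zero mult_right_mono ker[OF z] integrable_mult_right)
  also have "\<dots> = (\<integral>t. cmod (1 / (w - complex_of_real t)) \<partial>second_marginal \<eta>) / Im z"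
    unfolding second_marginal_def by (subst integral_distr) auto
  finally show "cmod (cauchy_transform \<eta> z w) \<le> (\<integral>t. cmod (1 / (w - complex_of_real t)) \<partial>second_marginal \<eta>) / Im z" .
qed

theorem corollary3p10:
  fixes \<phi> :: "'a::cstar_algebra \<Rightarrow> complex"
    and a1 b1 a2 b2 :: 'a
    and \<eta>1 \<eta>2 \<eta> :: "(real \<times> real) measure"
    and u x \<alpha> :: real
  assumes "faithful_state \<phi>"
    and "self_adjoint_pair a1 b1" and "self_adjoint_pair a2 b2"
    and "bipartite_pair a1 b1" and "bipartite_pair a2 b2"
    and "bifree TYPE('u::complex_vector) TYPE('v::complex_vector) \<phi> (a1, b1) (a2, b2)"
    and "\<not> scalar_multiple_of_one a1" and "\<not> scalar_multiple_of_one b1"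
    and "\<not> scalar_multiple_of_one a2" and "\<not> scalar_multiple_of_one b2"
    and "is_distribution \<phi> a1 b1 \<eta>1" and "is_distribution \<phi> a2 b2 \<eta>2"
    and "is_distribution \<phi> (a1 + a2) (b1 + b2) \<eta>"
    and "\<alpha> > 1 / 2"
    and "filterlim
           (\<lambda>(y1, y2). (y1 * y2) powr \<alpha> * cmod (cauchy_transform \<eta> (Complex x y1) (Complex u y2)))
           at_top (at (0, 0) within {0<..} \<times> {0<..})"
  shows "\<exists>\<alpha>1 \<alpha>2 \<beta>1 \<beta>2 :: real.
           \<alpha>1 + \<beta>1 = x \<and> \<alpha>2 + \<beta>2 = u \<and>
           measure (first_marginal \<eta>1) {\<alpha>1} + measure (first_marginal \<eta>2) {\<beta>1} \<ge> 1 \<and>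
           measure (second_marginal \<eta>1) {\<alpha>2} + measure (second_marginal \<eta>2) {\<beta>2} \<ge> 1"
proof -
  have \<phi>: "clinear \<phi>" "bounded_linear \<phi>" "\<phi> 1 = 1"
    using assms(1) faithful_state_bounded_linear by (auto simp: faithful_state_def)
  obtain R1 where m1: "compact_real_prob (first_marginal \<eta>1) R1" "compact_real_prob (second_marginal \<eta>1) R1"
    "\<And>n. \<phi> (a1 ^ n) = complex_of_real (\<integral>t. t ^ n \<partial>first_marginal \<eta>1)"
    "\<And>n. \<phi> (b1 ^ n) = complex_of_real (\<integral>t. t ^ n \<partial>second_marginal \<eta>1)"
    using marginals[OF assms(11)] by blast
  obtain R2 where m2: "compact_real_prob (first_marginal \<eta>2) R2" "compact_real_prob (second_marginal \<eta>2) R2"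
    "\<And>n. \<phi> (a2 ^ n) = complex_of_real (\<integral>t. t ^ n \<partial>first_marginal \<eta>2)"
    "\<And>n. \<phi> (b2 ^ n) = complex_of_real (\<integral>t. t ^ n \<partial>second_marginal \<eta>2)"
    using marginals[OF assms(12)] by blast
  obtain R where m: "compact_real_prob (first_marginal \<eta>) R" "compact_real_prob (second_marginal \<eta>) R"
    "\<And>n. \<phi> ((a1 + a2) ^ n) = complex_of_real (\<integral>t. t ^ n \<partial>first_marginal \<eta>)"
    "\<And>n. \<phi> ((b1 + b2) ^ n) = complex_of_real (\<integral>t. t ^ n \<partial>second_marginal \<eta>)"
    using marginals[OF assms(13)] by blast
  interpret f: real_prob "first_marginal \<eta>" using m(1) by (simp add: compact_real_prob_def)
  interpret s: real_prob "second_marginal \<eta>" using m(2) by (simp add: compact_real_prob_def)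
  have "\<forall>\<^sub>F p in at (0, 0) within {0<..} \<times> {0<..}.
      1 \<le> (case p of (y1, y2) \<Rightarrow> (y1 * y2) powr \<alpha> * cmod (cauchy_transform \<eta> (Complex x y1) (Complex u y2)))"
    using assms(15) unfolding filterlim_at_top by blast
  then obtain d where d: "0 < d" "\<And>p. p \<in> {0<..} \<times> {0<..} \<Longrightarrow> p \<noteq> (0, 0) \<Longrightarrow> dist p (0, 0) < d \<Longrightarrow>
      1 \<le> (case p of (y1, y2) \<Rightarrow> (y1 * y2) powr \<alpha> * cmod (cauchy_transform \<eta> (Complex x y1) (Complex u y2)))"
    unfolding eventually_at by blast
  \<comment> \<open>One variable is frozen at \<open>e\<close> and the other stays below
    \<open>e\<close>, so their sum is less than \<open>d\<close> and the lower bound near the origin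
    applies.\<close>
  define e where "e = d / 2"
  have e: "0 < e" using d(1) by (simp add: e_def)
  have lower: "1 \<le> (y1 * y2) powr \<alpha> * cmod (cauchy_transform \<eta> (Complex x y1) (Complex u y2))"
    if "0 < y1" "0 < y2" "y1 + y2 < d" for y1 y2
  proof -
    have "dist (y1, y2) (0, 0) \<le> y1 + y2"
      using sqrt_sum_squares_le_sum[of y1 y2] that by (simp add: dist_Pair_Pair)
    then show ?thesis using d(2)[of "(y1, y2)"] that by simp
  qed
  have "filterlim (\<lambda>y. cmod (cauchy_real (first_marginal \<eta>) (Complex x y))) at_top (at_right 0)"
  proof (rule f.cauchy_real_blowup[OF assms(14) e e])
    fix y :: real assume y: "0 < y" "y < e"
    have "1 \<le> (y * e) powr \<alpha> * cmod (cauchy_transform \<eta> (Complex x y) (Complex u e))"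
      using y e by (intro lower) (auto simp: e_def)
    also have "\<dots> \<le> (y * e) powr \<alpha> * ((\<integral>t. cmod (1 / (Complex x y - complex_of_real t)) \<partial>first_marginal \<eta>) / e)"
      using cauchy_transform_marginal_bounds(1)[OF assms(13), of "Complex x y" "Complex u e"] y e
      by (intro mult_left_mono) auto
    finally show "1 \<le> (y * e) powr \<alpha> * ((\<integral>t. cmod (1 / (Complex x y - complex_of_real t)) \<partial>first_marginal \<eta>) / e)" .
  qed
  from free_convolution_atoms[OF \<phi> bifree_left_free[OF \<phi>(1) assms(6)] m1(1) m2(1) m(1) m1(3) m2(3) m(3) this]
  obtain \<alpha>1 \<beta>1 where 1: "\<alpha>1 + \<beta>1 = x" "1 \<le> measure (first_marginal \<eta>1) {\<alpha>1} + measure (first_marginal \<eta>2) {\<beta>1}"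
    by blast
  have "filterlim (\<lambda>y. cmod (cauchy_real (second_marginal \<eta>) (Complex u y))) at_top (at_right 0)"
  proof (rule s.cauchy_real_blowup[OF assms(14) e e])
    fix y :: real assume y: "0 < y" "y < e"
    have "1 \<le> (e * y) powr \<alpha> * cmod (cauchy_transform \<eta> (Complex x e) (Complex u y))"
      using y e by (intro lower) (auto simp: e_def)
    also have "\<dots> \<le> (e * y) powr \<alpha> * ((\<integral>t. cmod (1 / (Complex u y - complex_of_real t)) \<partial>second_marginal \<eta>) / e)"
      using cauchy_transform_marginal_bounds(2)[OF assms(13), of "Complex x e" "Complex u y"] y e
      by (intro mult_left_mono) auto
    finally show "1 \<le> (y * e) powr \<alpha> * ((\<integral>t. cmod (1 / (Complex u y - complex_of_real t)) \<partial>second_marginal \<eta>) / e)"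
      by (simp add: mult.commute)
  qed
  from free_convolution_atoms[OF \<phi> bifree_right_free[OF \<phi>(1) assms(6)] m1(2) m2(2) m(2) m1(4) m2(4) m(4) this]
  obtain \<alpha>2 \<beta>2 where 2: "\<alpha>2 + \<beta>2 = u" "1 \<le> measure (second_marginal \<eta>1) {\<alpha>2} + measure (second_marginal \<eta>2) {\<beta>2}"
    by blast
  show ?thesis using 1 2 by blast
qed

end
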